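(* Let $\Gamma \subset \mathbb{P}^1_{an}$ be a finite vertex set of Type II points, and let $U$ be a $\Gamma$-domain. If $U$ is a disk bounded by $\zeta$, then $U$ is Farey if and only if $\mathfrak b(\zeta) = \min_{\xi \in U}\mathfrak m(\xi)$, in which case $\mathfrak b(\zeta) \mid \mathfrak m(\xi) \mid \mathfrak b(\xi)$ for every $\xi \in U$. If $U$ is an annulus bounded by $\alpha$ and $\beta$, then the following are equivalent: 1. $U$ is Farey: $\min_{\xi \in U}\mathfrak b(\xi) > \max(\mathfrak b(\alpha), \mathfrak b(\beta))$. 2. $\mathfrak b(\zeta) > \max(\mathfrak b(\alpha), \mathfrak b(\beta))$ for every $\zeta \in (\alpha, \beta)$. 3. $\mathfrak g(\zeta) \in \mathbb N^+\langle \mathfrak b(\alpha), \mathfrak b(\beta)\rangle$ for all $\zeta \in U$. 4. $\alpha \prec \beta$ and $\mathfrak a(\alpha)\mathfrak b(\beta)-\mathfrak b(\alpha)\mathfrak a(\beta) = \mathfrak m(\alpha) = \mathrm{HCF}(\mathfrak b(\alpha), \mathfrak b(\beta))$, or vice versa (the same with $\alpha$ and $\beta$ interchanged).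
   Context: **Fields and Berkovich line.** $k$ is an algebraically closed field of characteristic $0$; $\mathbb{K}=\bigcup_{n\ge 1}k((x^{1/n}))$ is the field of Puiseux series with its $x$-adic absolute value ($0<|x|<1$ fixed), and $\hat{\mathbb K}$ its completion. $\mathbb{P}^1_{an}=\mathbb{P}^1_{an}(\hat{\mathbb K})$ is the Berkovich projective line with coordinate $y$, a uniquely path-connected space. Its points are: Type I (elements of $\hat{\mathbb K}\cup\{\infty\}$); $\zeta(a,r)$, the sup norm on the closed disk $\overline D(a,r)$, of Type II if $r\in |x|^{\mathbb Q}$ and Type III for other $r>0$; and Type IV (limits of nested closed disks with empty intersection). $(\alpha,\beta)$ is the open interval (unique path without endpoints) between $\alpha$ and $\beta$. Order: $\zeta\prec\xi$ iff $\xi\in(\zeta,\infty]$ (e.g. $\zeta(a,r)\prec\zeta(a,R)$ for $r<R$). $\mathrm{diam}(\zeta(a,r))=r$. $G=\mathrm{Gal}(\mathbb K/k((x)))$ acts by isometries on $\hat{\mathbb K}$ (the element attached to a compatible system $\omega=(\omega_n)$ of roots of unity sends $x^{m/n}\mapsto\omega_n^m x^{m/n}$), hence on $\mathbb{P}^1_{an}$. **Invariants.** The multiplicity $\mathfrak m(\zeta)\in\mathbb N_+\cup\{\infty\}$ is the cardinality of the $G$-orbit of $\zeta$. The generic multiplicity $\mathfrak g(\zeta)$ is: $\mathfrak m(\zeta)$ if $\zeta$ is Type I; $\mathrm{lcm}(\mathfrak m(\zeta),q)$ if $\zeta$ is Type II, written $\zeta=\zeta(a,|x|^{p/q})$ with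 $\gcd(p,q)=1$; $\infty$ if $\zeta$ is Type III or IV. $\mathfrak b(\zeta)$ denotes the same number as $\mathfrak g(\zeta)$. For a Type II point, the Farey parameter $(\mathfrak a(\zeta),\mathfrak b(\zeta))$ has $\mathfrak b(\zeta)=\mathfrak g(\zeta)$ and $\mathfrak a(\zeta)\in\mathbb Z$ determined by $\zeta=\zeta(\gamma,|x|^{\mathfrak a(\zeta)/\mathfrak b(\zeta)})$, i.e. $\mathfrak a(\zeta)=\mathfrak b(\zeta)\log_{|x|}\mathrm{diam}(\zeta)$. Convention: every positive integer divides $\infty$, and $\infty\mid\infty$. **Vertex sets.** A vertex set is a finite set $\Gamma$ of Type II points. The $\Gamma$-domains are the connected components of $\mathbb P^1_{an}\setminus\Gamma$; one with exactly one boundary point is a $\Gamma$-disk, one with exactly two is a $\Gamma$-annulus. A $\Gamma$-domain $U$ is *Farey* iff either (1) $U$ is a disk with boundary point $\zeta$ and $\min_{\xi\in U}\mathfrak m(\xi)=\mathfrak g(\zeta)$; or (2) $U$ is an annulus with boundary points $\alpha,\beta$ and $\mathfrak g(\zeta)>\max(\mathfrak g(\alpha),\mathfrak g(\beta))$ for all $\zeta\in U$. $\mathbb N^+=\{1,2,3,\dots\}$ and $\mathbb N^+\langle a,b\rangle=\{ma+nb: m,n\in\mathbb N^+\}$. HCF denotes the highest common factor.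
   Formalization: In condition 3, the value ∞ of g(ζ) is allowed in addition to elements of N^+<b(α), b(β)>; every annulus contains Type III points, where g = ∞, so the condition read literally could never hold. *)

theory Defs
  imports
    "HOL-Analysis.Analysis"
    "HOL-Computational_Algebra.Formal_Laurent_Series"
begin

section \<open>The completed field of Puiseux series\<close>

text \<open>
  The completion of the field of Puiseux series is realised as the field of formal sums
  \<open>\<Sum>\<^sub>q c\<^sub>q x\<^sup>q\<close> with \<open>q\<close> rational whose support meets every half line
  \<open>{..r}\<close> in a finite set.  That this is the completion is proved below: the field is complete
  for the \<open>x\<close>-adic absolute value (\<open>mcomplete_ph\<close>), and the union of the images of the fields
  \<open>k((x\<^bsup>1/n\<^esup>))\<close>, which sit in it as subrings (\<open>of_fls_mult\<close> etc.), is dense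
  (\<open>puiseux_dense\<close>).
\<close>

typedef (overloaded) 'a puiseux_hat =
  "{f :: rat \<Rightarrow> 'a::zero. \<forall>r. finite {q. q \<le> r \<and> f q \<noteq> 0}}"
  morphisms ph_nth Abs_puiseux_hat
  by (rule exI[of _ "\<lambda>_. 0"]) simp

setup_lifting type_definition_puiseux_hat

lemma ph_eqI: "(\<And>q. ph_nth f q = ph_nth g q) \<Longrightarrow> f = g"
  by (metis ph_nth_inject ext)

lemma ph_finite: "finite {q. q \<le> r \<and> ph_nth f q \<noteq> 0}"
  using ph_nth[of f] by simp

lemma ph_bounded_below: "\<exists>a. \<forall>q. ph_nth f q \<noteq> 0 \<longrightarrow> a \<le> q"
proof -
  let ?S = "{q. q \<le> 0 \<and> ph_nth f q \<noteq> 0}"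
  have fin: "finite (insert 0 ?S)" using ph_finite by simp
  have "Min (insert 0 ?S) \<le> q" if "ph_nth f q \<noteq> 0" for q
  proof (cases "q \<le> 0")
    case True
    then show ?thesis using that fin by (intro Min_le) auto
  next
    case False
    have "Min (insert 0 ?S) \<le> 0" using fin by (intro Min_le) auto
    then show ?thesis using False by linarith
  qed
  then show ?thesis by blast
qed

instantiation puiseux_hat :: (comm_monoid_add) comm_monoid_add
begin

lift_definition zero_puiseux_hat :: "'a puiseux_hat" is "\<lambda>_. 0" by simp

lift_definition plus_puiseux_hat :: "'a puiseux_hat \<Rightarrow> 'a puiseux_hat \<Rightarrow> 'a puiseux_hat"
  is "\<lambda>f g q. f q + g q"
proof -
  fix f g :: "rat \<Rightarrow> 'a"
  fix r
  assume fg: "\<And>r. finite {q. q \<le> r \<and> f q \<noteq> 0}" "\<And>r. finite {q. q \<le> r \<and> g q \<noteq> 0}"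
    from fg have "finite ({q. q \<le> r \<and> f q \<noteq> 0} \<union> {q. q \<le> r \<and> g q \<noteq> 0})" by simp
    then show "finite {q. q \<le> r \<and> f q + g q \<noteq> 0}" by (rule finite_subset[rotated]) auto
qed

instance
proof
  fix f g h :: "'a puiseux_hat"
  show "f + g + h = f + (g + h)" by transfer (simp add: add.assoc)
  show "f + g = g + f" by transfer (simp add: add.commute)
  show "0 + f = f" by transfer simp
qed

end

instantiation puiseux_hat :: (ab_group_add) ab_group_add
begin

lift_definition uminus_puiseux_hat :: "'a puiseux_hat \<Rightarrow> 'a puiseux_hat"
  is "\<lambda>f q. - f q" by simp

definition minus_puiseux_hat :: "'a puiseux_hat \<Rightarrow> 'a puiseux_hat \<Rightarrow> 'a puiseux_hat"
  where "f - g = f + - (g :: 'a puiseux_hat)"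

instance
proof
  fix f g :: "'a puiseux_hat"
  show "- f + f = 0" by transfer simp
  show "f - g = f + - g" by (rule minus_puiseux_hat_def)
qed

end

lemma ph_nth_0 [simp]: "ph_nth 0 q = 0" by transfer simp
lemma ph_nth_add [simp]: "ph_nth (f + g) q = ph_nth f q + ph_nth g q" by transfer simp
lemma ph_nth_uminus [simp]: "ph_nth (- f) q = - ph_nth f q" by transfer simp
lemma ph_nth_diff [simp]: "ph_nth (f - g) q = ph_nth f q - ph_nth (g :: 'a::ab_group_add puiseux_hat) q"
  unfolding minus_puiseux_hat_def by (simp del: add_uminus_conv_diff)

lemma ph_conv_finite:
  "finite {s. ph_nth f s \<noteq> 0 \<and> ph_nth g (q - s) \<noteq> 0}"
proof -
  obtain b where b: "\<And>q. ph_nth g q \<noteq> 0 \<Longrightarrow> b \<le> q" using ph_bounded_below by blast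
  have "{s. ph_nth f s \<noteq> 0 \<and> ph_nth g (q - s) \<noteq> 0} \<subseteq> {s. s \<le> q - b \<and> ph_nth f s \<noteq> 0}"
    using b by (force simp: algebra_simps)
  then show ?thesis using ph_finite finite_subset by blast
qed

instantiation puiseux_hat :: (comm_semiring_0) comm_semiring_0
begin

lift_definition times_puiseux_hat :: "'a puiseux_hat \<Rightarrow> 'a puiseux_hat \<Rightarrow> 'a puiseux_hat"
  is "\<lambda>f g q. \<Sum>s | f s \<noteq> 0 \<and> g (q - s) \<noteq> 0. f s * g (q - s)"
proof -
  fix f' g' :: "rat \<Rightarrow> 'a"
  assume "\<And>r. finite {q. q \<le> r \<and> f' q \<noteq> 0}" "\<And>r. finite {q. q \<le> r \<and> g' q \<noteq> 0}"
  then have fg: "f' = ph_nth (Abs_puiseux_hat f')" "g' = ph_nth (Abs_puiseux_hat g')"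
    by (simp_all add: Abs_puiseux_hat_inverse)
  define f g where "f = Abs_puiseux_hat f'" and "g = Abs_puiseux_hat g'"
  note fg = fg[folded f_def g_def]
  obtain a where a: "\<And>q. ph_nth f q \<noteq> 0 \<Longrightarrow> a \<le> q" using ph_bounded_below by blast
  obtain b where b: "\<And>q. ph_nth g q \<noteq> 0 \<Longrightarrow> b \<le> q" using ph_bounded_below by blast
  fix r
  let ?S = "{s. s \<le> r - b \<and> ph_nth f s \<noteq> 0}" and ?T = "{s. s \<le> r - a \<and> ph_nth g s \<noteq> 0}"
  have "{q. q \<le> r \<and> (\<Sum>s | f' s \<noteq> 0 \<and> g' (q - s) \<noteq> 0. f' s * g' (q - s)) \<noteq> 0}
    \<subseteq> (\<lambda>(s, t). s + t) ` (?S \<times> ?T)"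
  proof (rule subsetI, clarify)
    fix q assume q: "q \<le> r" "(\<Sum>s | f' s \<noteq> 0 \<and> g' (q - s) \<noteq> 0. f' s * g' (q - s)) \<noteq> 0"
    obtain s where s: "ph_nth f s \<noteq> 0" "ph_nth g (q - s) \<noteq> 0"
      using sum.not_neutral_contains_not_neutral[OF q(2)] unfolding fg by blast
    have "s \<le> r - b" using b[OF s(2)] q(1) by linarith
    moreover have "q - s \<le> r - a" using a[OF s(1)] q(1) by linarith
    ultimately have "(s, q - s) \<in> ?S \<times> ?T" using s by auto
    moreover have "q = (\<lambda>(s, t). s + t) (s, q - s)" by simp
    ultimately show "q \<in> (\<lambda>(s, t). s + t) ` (?S \<times> ?T)" by blast
  qed
  moreover have "finite ((\<lambda>(s, t). s + t) ` (?S \<times> ?T))"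
    by (intro finite_imageI finite_cartesian_product ph_finite)
  ultimately show "finite {q. q \<le> r \<and> (\<Sum>s | f' s \<noteq> 0 \<and> g' (q - s) \<noteq> 0. f' s * g' (q - s)) \<noteq> 0}"
    using finite_subset by blast
qed

lemma ph_nth_mult: "ph_nth (f * g) q =
    (\<Sum>s | ph_nth f s \<noteq> 0 \<and> ph_nth g (q - s) \<noteq> 0. ph_nth f s * ph_nth g (q - s))"
  for f g :: "'a puiseux_hat"
  by transfer simp

lemma ph_nth_mult_superset:
  fixes f g :: "'a puiseux_hat"
  assumes "finite A" "\<And>s. ph_nth f s \<noteq> 0 \<Longrightarrow> ph_nth g (q - s) \<noteq> 0 \<Longrightarrow> s \<in> A"
  shows "ph_nth (f * g) q = (\<Sum>s\<in>A. ph_nth f s * ph_nth g (q - s))"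
  unfolding ph_nth_mult using assms by (intro sum.mono_neutral_left) auto

lemma ph_nth_mult_nonzero:
  fixes f g :: "'a puiseux_hat"
  assumes "ph_nth (f * g) q \<noteq> 0"
  obtains s where "ph_nth f s \<noteq> 0" "ph_nth g (q - s) \<noteq> 0"
  using sum.not_neutral_contains_not_neutral[OF assms[unfolded ph_nth_mult]] by blast

instance
proof
  fix f g h :: "'a puiseux_hat"
  show "f * g = g * f"
  proof (rule ph_eqI)
    fix q
    show "ph_nth (f * g) q = ph_nth (g * f) q" unfolding ph_nth_mult
      by (rule sum.reindex_bij_witness[of _ "\<lambda>s. q - s" "\<lambda>s. q - s"]) (auto simp: mult.commute)
  qed
  show "0 * f = 0" "f * 0 = 0" by (auto intro!: ph_eqI simp: ph_nth_mult)
  show "(f + g) * h = f * h + g * h"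
  proof (rule ph_eqI)
    fix q
    let ?A = "{s. ph_nth f s \<noteq> 0 \<and> ph_nth h (q - s) \<noteq> 0} \<union> {s. ph_nth g s \<noteq> 0 \<and> ph_nth h (q - s) \<noteq> 0}"
    have fin: "finite ?A" by (intro finite_UnI ph_conv_finite)
    have 1: "ph_nth ((f + g) * h) q = (\<Sum>s\<in>?A. ph_nth (f + g) s * ph_nth h (q - s))"
      by (rule ph_nth_mult_superset[OF fin]) auto
    have 2: "ph_nth (f * h) q = (\<Sum>s\<in>?A. ph_nth f s * ph_nth h (q - s))"
      by (rule ph_nth_mult_superset[OF fin]) auto
    have 3: "ph_nth (g * h) q = (\<Sum>s\<in>?A. ph_nth g s * ph_nth h (q - s))"
      by (rule ph_nth_mult_superset[OF fin]) auto
    show "ph_nth ((f + g) * h) q = ph_nth (f * h + g * h) q"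
      by (simp add: 1 2 3 sum.distrib distrib_right)
  qed
  show "f * g * h = f * (g * h)"
  proof (rule ph_eqI)
    fix q
    obtain a where a: "\<And>q. ph_nth f q \<noteq> 0 \<Longrightarrow> a \<le> q" using ph_bounded_below by blast
    obtain b where b: "\<And>q. ph_nth g q \<noteq> 0 \<Longrightarrow> b \<le> q" using ph_bounded_below by blast
    obtain c where c: "\<And>q. ph_nth h q \<noteq> 0 \<Longrightarrow> c \<le> q" using ph_bounded_below by blast
    define S where "S = {s. s \<le> q - b - c \<and> ph_nth f s \<noteq> 0}"
    define T where "T = {t. t \<le> q - a - c \<and> ph_nth g t \<noteq> 0}"
    define W where "W = (\<lambda>(s, t). s + t) ` (S \<times> T)"
    have finS: "finite S" and finT: "finite T" unfolding S_def T_def by (rule ph_finite)+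
    then have finW: "finite W" unfolding W_def by (intro finite_imageI finite_cartesian_product)
    have mem_W: "w \<in> W" if "s \<in> S" "w - s \<in> T" for w s
      unfolding W_def using that by (intro image_eqI[of _ _ "(s, w - s)"]) auto
    have "ph_nth (f * g * h) q = (\<Sum>w\<in>W. ph_nth (f * g) w * ph_nth h (q - w))"
    proof (rule ph_nth_mult_superset[OF finW])
      fix w assume w: "ph_nth (f * g) w \<noteq> 0" "ph_nth h (q - w) \<noteq> 0"
      from w(1) obtain s where s: "ph_nth f s \<noteq> 0" "ph_nth g (w - s) \<noteq> 0"
        by (rule ph_nth_mult_nonzero)
      have "s \<in> S" "w - s \<in> T"
        unfolding S_def T_def using s a[OF s(1)] b[OF s(2)] c[OF w(2)] by auto
      then show "w \<in> W" by (rule mem_W)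
    qed
    also have "\<dots> = (\<Sum>w\<in>W. \<Sum>s\<in>S. ph_nth f s * (ph_nth g (w - s) * ph_nth h (q - w)))"
    proof (rule sum.cong[OF refl])
      fix w assume "w \<in> W"
      show "ph_nth (f * g) w * ph_nth h (q - w)
          = (\<Sum>s\<in>S. ph_nth f s * (ph_nth g (w - s) * ph_nth h (q - w)))"
      proof (cases "ph_nth h (q - w) = 0")
        case True
        then show ?thesis by simp
      next
        case False
        have "ph_nth (f * g) w = (\<Sum>s\<in>S. ph_nth f s * ph_nth g (w - s))"
        proof (rule ph_nth_mult_superset[OF finS])
          fix s assume s: "ph_nth f s \<noteq> 0" "ph_nth g (w - s) \<noteq> 0"
          show "s \<in> S" unfolding S_def using s b[OF s(2)] c[OF False] by auto
        qed
        then show ?thesis by (simp add: sum_distrib_right mult.assoc)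
      qed
    qed
    also have "\<dots> = (\<Sum>s\<in>S. ph_nth f s * (\<Sum>w\<in>W. ph_nth g (w - s) * ph_nth h (q - w)))"
      by (simp add: sum_distrib_left sum.swap[of _ S W])
    also have "\<dots> = (\<Sum>s\<in>S. ph_nth f s * ph_nth (g * h) (q - s))"
    proof (rule sum.cong[OF refl])
      fix s assume s: "s \<in> S"
      then have as: "a \<le> s" using a unfolding S_def by auto
      have "ph_nth (g * h) (q - s) = (\<Sum>t\<in>T. ph_nth g t * ph_nth h (q - s - t))"
      proof (rule ph_nth_mult_superset[OF finT])
        fix t assume t: "ph_nth g t \<noteq> 0" "ph_nth h (q - s - t) \<noteq> 0"
        show "t \<in> T" unfolding T_def using t c[OF t(2)] as by auto
      qed
      also have "\<dots> = (\<Sum>w\<in>(\<lambda>t. s + t) ` T. ph_nth g (w - s) * ph_nth h (q - w))"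
        by (subst sum.reindex) (auto simp: algebra_simps)
      also have "\<dots> = (\<Sum>w\<in>W. ph_nth g (w - s) * ph_nth h (q - w))"
      proof (rule sum.mono_neutral_left[OF finW])
        show "(\<lambda>t. s + t) ` T \<subseteq> W" using mem_W[OF s] by auto
        show "\<forall>w\<in>W - (\<lambda>t. s + t) ` T. ph_nth g (w - s) * ph_nth h (q - w) = 0"
        proof
          fix w assume w: "w \<in> W - (\<lambda>t. s + t) ` T"
          have "w - s \<notin> T"
          proof
            assume "w - s \<in> T"
            then have "s + (w - s) \<in> (\<lambda>t. s + t) ` T" by (rule imageI)
            then show False using w by simp
          qed
          have "w - s \<in> T" if "ph_nth g (w - s) \<noteq> 0" "ph_nth h (q - w) \<noteq> 0"
            unfolding T_def using that(1) c[OF that(2)] as by simp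
          with \<open>w - s \<notin> T\<close> have "ph_nth g (w - s) = 0 \<or> ph_nth h (q - w) = 0" by blast
          then show "ph_nth g (w - s) * ph_nth h (q - w) = 0" by auto
        qed
      qed
      finally show "ph_nth f s * (\<Sum>w\<in>W. ph_nth g (w - s) * ph_nth h (q - w))
        = ph_nth f s * ph_nth (g * h) (q - s)" by simp
    qed
    also have "\<dots> = ph_nth (f * (g * h)) q"
    proof (rule ph_nth_mult_superset[OF finS, symmetric])
      fix s assume s: "ph_nth f s \<noteq> 0" "ph_nth (g * h) (q - s) \<noteq> 0"
      from s(2) obtain t where t: "ph_nth g t \<noteq> 0" "ph_nth h (q - s - t) \<noteq> 0"
        by (rule ph_nth_mult_nonzero)
      show "s \<in> S" unfolding S_def using s(1) b[OF t(1)] c[OF t(2)] by auto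
    qed
    finally show "ph_nth (f * g * h) q = ph_nth (f * (g * h)) q" .
  qed
qed

end

lift_definition ph_monom :: "'a::zero \<Rightarrow> rat \<Rightarrow> 'a puiseux_hat"
  is "\<lambda>c p q. if q = p then c else 0"
proof -
  fix c :: 'a and p :: rat
  show "finite {q. q \<le> r \<and> (if q = p then c else 0) \<noteq> 0}" for r
    by (rule finite_subset[of _ "{p}"]) auto
qed

lemma ph_nth_monom: "ph_nth (ph_monom c p) q = (if q = p then c else 0)" by transfer simp

lemma ph_nth_monom_mult:
  "ph_nth (ph_monom c p * g) q = c * ph_nth (g :: 'a::comm_semiring_0 puiseux_hat) (q - p)"
proof -
  have "ph_nth (ph_monom c p * g) q = (\<Sum>s\<in>{p}. ph_nth (ph_monom c p) s * ph_nth g (q - s))"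
    by (rule ph_nth_mult_superset) (auto simp: ph_nth_monom split: if_splits)
  then show ?thesis by (simp add: ph_nth_monom)
qed

instantiation puiseux_hat :: (comm_ring_1) comm_ring_1
begin

definition one_puiseux_hat :: "'a puiseux_hat" where "1 = ph_monom 1 0"

instance
proof
  fix f :: "'a puiseux_hat"
  show "1 * f = f" unfolding one_puiseux_hat_def by (rule ph_eqI) (simp add: ph_nth_monom_mult)
  show "(0 :: 'a puiseux_hat) \<noteq> 1"
    by (metis one_puiseux_hat_def ph_nth_0 ph_nth_monom zero_neq_one)
qed

end

lemma ph_nth_1: "ph_nth 1 q = (if q = 0 then 1 else 0)"
  by (simp add: one_puiseux_hat_def ph_nth_monom)

text \<open>The order of vanishing at \<open>x = 0\<close>; its value at the zero series is irrelevant.\<close>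

definition ph_ord :: "'a::zero puiseux_hat \<Rightarrow> rat" where
  "ph_ord f = (LEAST q. ph_nth f q \<noteq> 0)"

lemma ph_ord_least:
  assumes "f \<noteq> (0 :: 'a::comm_monoid_add puiseux_hat)"
  shows "ph_nth f (ph_ord f) \<noteq> 0" "\<And>q. ph_nth f q \<noteq> 0 \<Longrightarrow> ph_ord f \<le> q"
proof -
  obtain r where r: "ph_nth f r \<noteq> 0" using assms ph_eqI[of f 0] by auto
  let ?S = "{q. q \<le> r \<and> ph_nth f q \<noteq> 0}"
  have fin: "finite ?S" by (rule ph_finite)
  have ne: "?S \<noteq> {}" using r by auto
  have M: "Min ?S \<in> ?S" using Min_in[OF fin ne] .
  have le: "Min ?S \<le> q" if "ph_nth f q \<noteq> 0" for q
  proof (cases "q \<le> r")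
    case True
    then show ?thesis using that fin by (intro Min_le) auto
  next
    case False
    then show ?thesis using M by auto
  qed
  have eq: "ph_ord f = Min ?S" unfolding ph_ord_def
    by (rule Least_equality) (use M le in auto)
  show "ph_nth f (ph_ord f) \<noteq> 0" using M eq by auto
  show "ph_ord f \<le> q" if "ph_nth f q \<noteq> 0" for q using le[OF that] eq by simp
qed

lemma ph_nth_ord_mult:
  assumes "f \<noteq> (0 :: 'a::comm_semiring_0 puiseux_hat)" "g \<noteq> 0"
  shows "ph_nth (f * g) (ph_ord f + ph_ord g) = ph_nth f (ph_ord f) * ph_nth g (ph_ord g)"
proof -
  have "ph_nth (f * g) (ph_ord f + ph_ord g)
     = (\<Sum>s\<in>{ph_ord f}. ph_nth f s * ph_nth g (ph_ord f + ph_ord g - s))"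
  proof (rule ph_nth_mult_superset)
    fix s assume s: "ph_nth f s \<noteq> 0" "ph_nth g (ph_ord f + ph_ord g - s) \<noteq> 0"
    show "s \<in> {ph_ord f}"
      using ph_ord_least(2)[OF assms(1) s(1)] ph_ord_least(2)[OF assms(2) s(2)] by auto
  qed simp
  then show ?thesis by simp
qed

instance puiseux_hat :: (idom) idom
proof
  fix f g :: "'a puiseux_hat" assume "f \<noteq> 0" "g \<noteq> 0"
  then have "ph_nth (f * g) (ph_ord f + ph_ord g) \<noteq> 0"
    by (simp add: ph_nth_ord_mult ph_ord_least)
  then show "f * g \<noteq> 0" by auto
qed

lemma ph_ord_mult:
  assumes "f \<noteq> (0 :: 'a::idom puiseux_hat)" "g \<noteq> 0"
  shows "ph_ord (f * g) = ph_ord f + ph_ord g"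
  unfolding ph_ord_def[of "f * g"]
proof (rule Least_equality)
  show "ph_nth (f * g) (ph_ord f + ph_ord g) \<noteq> 0"
    using assms by (simp add: ph_nth_ord_mult ph_ord_least)
  fix q assume "ph_nth (f * g) q \<noteq> 0"
  then obtain s where s: "ph_nth f s \<noteq> 0" "ph_nth g (q - s) \<noteq> 0" by (rule ph_nth_mult_nonzero)
  show "ph_ord f + ph_ord g \<le> q"
    using ph_ord_least(2)[OF assms(1) s(1)] ph_ord_least(2)[OF assms(2) s(2)] by auto
qed

lemma ph_nth_sum: "ph_nth (\<Sum>i\<in>A. f i) q = (\<Sum>i\<in>A. ph_nth (f i) q)"
  by (induction A rule: infinite_finite_induct) auto

lemma ph_nth_power_eq_0:
  fixes g :: "'a::comm_ring_1 puiseux_hat"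
  assumes "\<And>q. ph_nth g q \<noteq> 0 \<Longrightarrow> d \<le> q" "q < of_nat n * d"
  shows "ph_nth (g ^ n) q = 0"
  using assms(2)
proof (induction n arbitrary: q)
  case 0
  then show ?case by (simp add: ph_nth_1)
next
  case (Suc n)
  show ?case
  proof (rule ccontr)
    assume "ph_nth (g ^ Suc n) q \<noteq> 0"
    then obtain s where s: "ph_nth g s \<noteq> 0" "ph_nth (g ^ n) (q - s) \<noteq> 0"
      by (metis power_Suc ph_nth_mult_nonzero)
    have "\<not> q - s < of_nat n * d" using Suc.IH[of "q - s"] s(2) by blast
    then show False using assms(1)[OF s(1)] Suc.prems by (simp add: algebra_simps)
  qed
qed

lemma ph_geometric_inverse:
  fixes g :: "'a::comm_ring_1 puiseux_hat"
  assumes g: "\<And>q. ph_nth g q \<noteq> 0 \<Longrightarrow> d \<le> q" and "d > 0"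
  shows "\<exists>h. (1 - g) * h = 1"
proof -
  define N where "N r = nat \<lceil>r / d\<rceil> + 1" for r
  have N: "r < of_nat (N r) * d" for r
  proof -
    have "r / d < of_nat (N r)" unfolding N_def using of_nat_ceiling[of "r / d"] by simp
    then show ?thesis using \<open>d > 0\<close> by (simp add: pos_divide_less_eq)
  qed
  define P where "P n = (\<Sum>i<n. g ^ i)" for n
  have stable: "ph_nth (P n) q = ph_nth (P (N r)) q" if "q \<le> r" "N r \<le> n" for n q r
  proof -
    have "ph_nth (P (N r)) q = (\<Sum>i<N r. ph_nth (g ^ i) q)" by (simp add: P_def ph_nth_sum)
    also have "\<dots> = (\<Sum>i<n. ph_nth (g ^ i) q)"
    proof (rule sum.mono_neutral_left)
      show "\<forall>i\<in>{..<n} - {..<N r}. ph_nth (g ^ i) q = 0"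
      proof
        fix i assume i: "i \<in> {..<n} - {..<N r}"
        then have "of_nat (N r) * d \<le> of_nat i * d" using \<open>d > 0\<close> by auto
        then have "q < of_nat i * d" using N[of r] that(1) by linarith
        then show "ph_nth (g ^ i) q = 0" using ph_nth_power_eq_0[OF g] by blast
      qed
    qed (use that in auto)
    finally show ?thesis by (simp add: P_def ph_nth_sum)
  qed
  define H where "H = (\<lambda>q. ph_nth (P (N q)) q)"
  have Nmono: "N q \<le> N r" if "q \<le> r" for q r
    unfolding N_def using that \<open>d > 0\<close> by (intro add_mono nat_mono ceiling_mono divide_right_mono) auto
  have H: "H q = ph_nth (P (N r)) q" if "q \<le> r" for q r
    unfolding H_def using stable[of q q "N r"] Nmono[OF that] by simp
  have "finite {q. q \<le> r \<and> H q \<noteq> 0}" for r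
    using H ph_finite[of r "P (N r)"] by (auto elim!: finite_subset[rotated])
  then have h': "ph_nth (Abs_puiseux_hat H) = H" by (simp add: Abs_puiseux_hat_inverse)
  define h where "h = Abs_puiseux_hat H"
  note h = h'[folded h_def]
  have "(1 - g) * h = 1"
  proof (rule ph_eqI)
    fix q
    have coeff_eq: "ph_nth (g * h) q = ph_nth (g * P (N q)) q"
    proof -
      let ?A = "{s. s \<le> q \<and> ph_nth g s \<noteq> 0}"
      have fin: "finite {s. ph_nth g s \<noteq> 0 \<and> ph_nth h (q - s) \<noteq> 0}"
        "finite {s. ph_nth g s \<noteq> 0 \<and> ph_nth (P (N q)) (q - s) \<noteq> 0}" by (rule ph_conv_finite)+
      have same: "ph_nth h (q - s) = ph_nth (P (N q)) (q - s)" if "ph_nth g s \<noteq> 0" for s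
        using g[OF that] \<open>d > 0\<close> H[of "q - s" q] h by auto
      have sets: "{s. ph_nth g s \<noteq> 0 \<and> ph_nth h (q - s) \<noteq> 0}
        = {s. ph_nth g s \<noteq> 0 \<and> ph_nth (P (N q)) (q - s) \<noteq> 0}" using same by auto
      show ?thesis unfolding ph_nth_mult sets by (rule sum.cong) (auto simp: same)
    qed
    have "ph_nth ((1 - g) * h) q = ph_nth h q - ph_nth (g * h) q" by (simp add: algebra_simps)
    also have "\<dots> = ph_nth ((1 - g) * P (N q)) q"
      unfolding coeff_eq using H[of q q] h by (simp add: algebra_simps)
    also have "(1 - g) * P (N q) = 1 - g ^ N q"
      unfolding P_def by (simp add: one_diff_power_eq)
    also have "ph_nth (1 - g ^ N q) q = ph_nth 1 q"
      using ph_nth_power_eq_0[OF g N[of q]] by simp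
    finally show "ph_nth ((1 - g) * h) q = ph_nth 1 q" .
  qed
  then show ?thesis by blast
qed

lemma ph_inverse_exists:
  fixes f :: "'a::field puiseux_hat"
  assumes "f \<noteq> 0"
  shows "\<exists>h. h * f = 1"
proof -
  define v where "v = ph_ord f"
  define c where "c = ph_nth f v"
  have c: "c \<noteq> 0" using assms ph_ord_least(1) unfolding c_def v_def by blast
  define g where "g = 1 - ph_monom (inverse c) (- v) * f"
  have g0: "ph_nth g q \<noteq> 0 \<Longrightarrow> q > 0" for q
  proof -
    assume q: "ph_nth g q \<noteq> 0"
    have "ph_nth g q = (if q = 0 then 1 else 0) - inverse c * ph_nth f (q + v)"
      by (simp add: g_def ph_nth_monom_mult ph_nth_1)
    then have "q \<noteq> 0" "ph_nth f (q + v) \<noteq> 0" using q c by (auto simp: c_def split: if_splits)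
    moreover have "v \<le> q + v" using ph_ord_least(2)[OF assms] calculation(2) unfolding v_def by blast
    ultimately show "q > 0" by simp
  qed
  obtain d where d: "d > 0" "\<And>q. ph_nth g q \<noteq> 0 \<Longrightarrow> d \<le> q"
  proof (cases "g = 0")
    case True
    then show ?thesis using that[of 1] by simp
  next
    case False
    then show ?thesis using that[of "ph_ord g"] g0 ph_ord_least by blast
  qed
  obtain h where "(1 - g) * h = 1" using ph_geometric_inverse[OF d(2) d(1)] by blast
  then have "(h * ph_monom (inverse c) (- v)) * f = 1" by (simp add: g_def ac_simps)
  then show ?thesis by blast
qed

instantiation puiseux_hat :: (field) field
begin

definition inverse_puiseux_hat :: "'a puiseux_hat \<Rightarrow> 'a puiseux_hat" where
  "inverse_puiseux_hat f = (if f = 0 then 0 else (SOME h. h * f = 1))"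

definition divide_puiseux_hat :: "'a puiseux_hat \<Rightarrow> 'a puiseux_hat \<Rightarrow> 'a puiseux_hat" where
  "f div g = f * inverse (g :: 'a puiseux_hat)"

instance
proof
  fix f g :: "'a puiseux_hat"
  show "f \<noteq> 0 \<Longrightarrow> inverse f * f = 1"
    using someI_ex[OF ph_inverse_exists[of f]] by (simp add: inverse_puiseux_hat_def)
  show "f div g = f * inverse g" by (rule divide_puiseux_hat_def)
  show "inverse (0 :: 'a puiseux_hat) = 0" by (simp add: inverse_puiseux_hat_def)
qed

end

text \<open>The absolute value, normalised by \<open>\<bar>x\<bar> = \<rho>\<close>.\<close>

definition ph_abs :: "real \<Rightarrow> 'a::zero puiseux_hat \<Rightarrow> real" where
  "ph_abs \<rho> f = (if \<forall>q. ph_nth f q = 0 then 0 else \<rho> powr of_rat (ph_ord f))"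

lemma ph_abs_eq_0_iff:
  "0 < \<rho> \<Longrightarrow> ph_abs \<rho> (f :: 'a::comm_monoid_add puiseux_hat) = 0 \<longleftrightarrow> f = 0"
  by (auto simp: ph_abs_def intro: ph_eqI)

lemma ph_abs_nonneg: "0 \<le> ph_abs \<rho> f"
  by (simp add: ph_abs_def)

lemma ph_abs_nonzero:
  "f \<noteq> 0 \<Longrightarrow> ph_abs \<rho> (f :: 'a::comm_monoid_add puiseux_hat) = \<rho> powr of_rat (ph_ord f)"
  using ph_eqI[of f 0] by (auto simp: ph_abs_def)

lemma ph_abs_mult:
  "0 < \<rho> \<Longrightarrow> ph_abs \<rho> (f * g) = ph_abs \<rho> f * ph_abs \<rho> (g :: 'a::idom puiseux_hat)"
proof (cases "f = 0 \<or> g = 0")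
  case True
  then show ?thesis by (auto simp: ph_abs_def)
next
  case False
  then show ?thesis by (simp add: ph_abs_nonzero ph_ord_mult of_rat_add powr_add)
qed

lemma ph_abs_le_iff:
  assumes "0 < \<rho>" "\<rho> < 1"
  shows "ph_abs \<rho> f \<le> \<rho> powr of_rat r \<longleftrightarrow> (\<forall>q<r. ph_nth (f :: 'a::comm_monoid_add puiseux_hat) q = 0)"
proof (cases "f = 0")
  case True
  then show ?thesis by (simp add: ph_abs_def)
next
  case False
  have "\<rho> powr a \<le> \<rho> powr b \<longleftrightarrow> b \<le> a" for a b
    using powr_less_mono'[of \<rho> a b] powr_mono'[of b a \<rho>] assms by (auto simp: not_less[symmetric])
  then have "ph_abs \<rho> f \<le> \<rho> powr of_rat r \<longleftrightarrow> r \<le> ph_ord f"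
    using False by (simp add: ph_abs_nonzero of_rat_less_eq)
  also have "\<dots> \<longleftrightarrow> (\<forall>q<r. ph_nth f q = 0)"
    using ph_ord_least[OF False] by (meson le_less_trans not_less)
  finally show ?thesis .
qed

lemma ph_abs_add:
  assumes "0 < \<rho>" "\<rho> < 1"
  shows "ph_abs \<rho> (f + g) \<le> max (ph_abs \<rho> f) (ph_abs \<rho> (g :: 'a::comm_monoid_add puiseux_hat))"
proof (cases "f + g = 0")
  case True
  then show ?thesis by (simp add: ph_abs_def le_max_iff_disj)
next
  case False
  have *: "\<rho> powr of_rat (ph_ord (f + g)) \<le> ph_abs \<rho> h" if "ph_nth h (ph_ord (f + g)) \<noteq> 0"
    for h :: "'a puiseux_hat"
  proof -
    have "h \<noteq> 0" using that by auto
    then have "ph_ord h \<le> ph_ord (f + g)" using ph_ord_least(2) that by blast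
    then have "\<rho> powr of_rat (ph_ord (f + g)) \<le> \<rho> powr of_rat (ph_ord h)"
      using assms by (intro powr_mono') (auto simp: of_rat_less_eq)
    then show ?thesis using \<open>h \<noteq> 0\<close> by (simp add: ph_abs_nonzero)
  qed
  have "ph_nth f (ph_ord (f + g)) \<noteq> 0 \<or> ph_nth g (ph_ord (f + g)) \<noteq> 0"
    using ph_ord_least(1)[OF False] by auto
  then show ?thesis using * by (auto simp: ph_abs_nonzero[OF False] le_max_iff_disj)
qed

lemma ph_abs_uminus: "ph_abs \<rho> (- f) = ph_abs \<rho> (f :: 'a::ab_group_add puiseux_hat)"
  by (simp add: ph_abs_def ph_ord_def)

definition ph_dist :: "real \<Rightarrow> 'a::ab_group_add puiseux_hat \<Rightarrow> 'a puiseux_hat \<Rightarrow> real" where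
  "ph_dist \<rho> f g = ph_abs \<rho> (f - g)"

lemma Metric_space_ph:
  assumes "0 < \<rho>" "\<rho> < 1"
  shows "Metric_space UNIV (ph_dist \<rho>)"
proof
  fix f g h :: "'a puiseux_hat"
  show "0 \<le> ph_dist \<rho> f g" by (simp add: ph_dist_def ph_abs_nonneg)
  show "ph_dist \<rho> f g = ph_dist \<rho> g f"
    unfolding ph_dist_def using ph_abs_uminus[of \<rho> "f - g"] by simp
  show "ph_dist \<rho> f g = 0 \<longleftrightarrow> f = g"
    using assms by (simp add: ph_dist_def ph_abs_eq_0_iff)
  have "ph_dist \<rho> f h \<le> max (ph_dist \<rho> f g) (ph_dist \<rho> g h)"
    unfolding ph_dist_def using ph_abs_add[OF assms, of "f - g" "g - h"] by simp
  then show "ph_dist \<rho> f h \<le> ph_dist \<rho> f g + ph_dist \<rho> g h"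
    using ph_abs_nonneg[of \<rho> "f - g"] ph_abs_nonneg[of \<rho> "g - h"] unfolding ph_dist_def by linarith
qed

lemma ph_dist_le_power_iff:
  assumes "0 < \<rho>" "\<rho> < 1"
  shows "ph_dist \<rho> f g \<le> \<rho> ^ m \<longleftrightarrow>
    (\<forall>q < of_nat m. ph_nth f q = ph_nth (g :: 'a::ab_group_add puiseux_hat) q)"
  using ph_abs_le_iff[OF assms, of "f - g" "of_nat m"] assms
  by (simp add: ph_dist_def powr_realpow)

lemma mcomplete_ph:
  assumes "0 < \<rho>" "\<rho> < 1"
  shows "Metric_space.mcomplete (UNIV :: 'a::ab_group_add puiseux_hat set) (ph_dist \<rho>)"
proof -
  interpret Metric_space "UNIV :: 'a puiseux_hat set" "ph_dist \<rho>"
    by (rule Metric_space_ph[OF assms])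
  show ?thesis
    unfolding mcomplete_def
  proof (intro allI impI)
    fix \<sigma> :: "nat \<Rightarrow> 'a puiseux_hat" assume "MCauchy \<sigma>"
    then have cauchy: "\<exists>N. \<forall>n n'. N \<le> n \<longrightarrow> N \<le> n' \<longrightarrow> ph_dist \<rho> (\<sigma> n) (\<sigma> n') < e" if "e > 0" for e
      using that unfolding MCauchy_def by blast
    have "\<exists>N. \<forall>n n'. N \<le> n \<longrightarrow> N \<le> n' \<longrightarrow> ph_dist \<rho> (\<sigma> n) (\<sigma> n') \<le> \<rho> ^ m" for m
      using cauchy[of "\<rho> ^ m"] assms(1) by (meson less_imp_le zero_less_power)
    then obtain N where N: "ph_dist \<rho> (\<sigma> n) (\<sigma> n') \<le> \<rho> ^ m" if "N m \<le> n" "N m \<le> n'" for m n n'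
      by metis
    have agree: "ph_nth (\<sigma> n) q = ph_nth (\<sigma> n') q" if "N m \<le> n" "N m \<le> n'" "q < of_nat m" for m n n' q
      using N[OF that(1,2)] that(3) unfolding ph_dist_le_power_iff[OF assms] by blast
    define M where "M q = nat \<lceil>q :: rat\<rceil> + 1" for q
    have M: "q < of_nat (M q)" for q
      unfolding M_def using of_nat_ceiling[of q] by simp
    define H where "H q = ph_nth (\<sigma> (N (M q))) q" for q
    have H: "H q = ph_nth (\<sigma> n) q" if "q < of_nat m" "N m \<le> n" for m n q
    proof -
      have "H q = ph_nth (\<sigma> (max (N m) (N (M q)))) q"
        unfolding H_def by (rule agree[OF _ _ M]) auto
      also have "\<dots> = ph_nth (\<sigma> n) q"
        by (rule agree[OF _ _ that(1)]) (use that in auto)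
      finally show ?thesis .
    qed
    have "finite {q. q \<le> r \<and> H q \<noteq> 0}" for r
    proof (rule finite_subset[OF _ ph_finite[of r "\<sigma> (N (M r))"]])
      show "{q. q \<le> r \<and> H q \<noteq> 0} \<subseteq> {q. q \<le> r \<and> ph_nth (\<sigma> (N (M r))) q \<noteq> 0}"
        using H[of _ "M r" "N (M r)"] M[of r] by auto
    qed
    then have h: "ph_nth (Abs_puiseux_hat H) = H" by (simp add: Abs_puiseux_hat_inverse)
    have "limitin mtopology \<sigma> (Abs_puiseux_hat H) sequentially"
      unfolding limitin_metric
    proof (intro conjI allI impI)
      fix e :: real assume "e > 0"
      then obtain m where m: "\<rho> ^ m < e" using real_arch_pow_inv assms by blast
      have "ph_dist \<rho> (\<sigma> n) (Abs_puiseux_hat H) \<le> \<rho> ^ m" if "N m \<le> n" for n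
        unfolding ph_dist_le_power_iff[OF assms] h using H[OF _ that] by auto
      then have "\<forall>n\<ge>N m. \<sigma> n \<in> UNIV \<and> ph_dist \<rho> (\<sigma> n) (Abs_puiseux_hat H) < e"
        using m by fastforce
      then show "\<forall>\<^sub>F n in sequentially. \<sigma> n \<in> UNIV \<and> ph_dist \<rho> (\<sigma> n) (Abs_puiseux_hat H) < e"
        using eventually_sequentially by blast
    qed simp
    then show "\<exists>x. limitin mtopology \<sigma> x sequentially" by blast
  qed
qed

text \<open>
  The embedding of \<open>k((x\<^bsup>1/n\<^esup>))\<close>, as the field of formal Laurent series in a
  variable that is sent to \<open>x\<^bsup>1/n\<^esup>\<close>, for \<open>n > 0\<close>.
\<close>

lift_definition of_fls :: "nat \<Rightarrow> 'a::zero fls \<Rightarrow> 'a puiseux_hat"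
  is "\<lambda>n F q. if n > 0 \<and> of_nat n * q \<in> \<int> then fls_nth F \<lfloor>of_nat n * q\<rfloor> else 0"
proof -
  fix n and F :: "'a fls" and r
  show "finite {q. q \<le> r \<and>
    (if n > 0 \<and> of_nat n * q \<in> \<int> then fls_nth F \<lfloor>of_nat n * q\<rfloor> else 0) \<noteq> 0}" (is "finite ?S")
  proof (rule finite_subset)
    show "?S \<subseteq> (\<lambda>i. of_int i / of_nat n) ` {fls_subdegree F..\<lfloor>of_nat n * r\<rfloor>}"
    proof
      fix q assume "q \<in> ?S"
      then have q: "q \<le> r" "n > 0" "of_nat n * q \<in> \<int>" "fls_nth F \<lfloor>of_nat n * q\<rfloor> \<noteq> 0"
        by (auto split: if_splits)
      have "of_int \<lfloor>of_nat n * q\<rfloor> = of_nat n * q" 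
        using q(3) by (metis Ints_cases floor_of_int)
      then have "q = of_int \<lfloor>of_nat n * q\<rfloor> / of_nat n"
        using q(2) by (metis less_irrefl nonzero_mult_div_cancel_left of_nat_0_eq_iff)
      moreover have "fls_subdegree F \<le> \<lfloor>of_nat n * q\<rfloor>" using q(4) by (rule fls_subdegree_leI)
      moreover have "\<lfloor>of_nat n * q\<rfloor> \<le> \<lfloor>of_nat n * r\<rfloor>"
        using q(1) by (intro floor_mono mult_left_mono) auto
      ultimately show "q \<in> (\<lambda>i. of_int i / of_nat n) ` {fls_subdegree F..\<lfloor>of_nat n * r\<rfloor>}" by auto
    qed
  qed simp
qed

lemma ph_nth_of_fls:
  "n > 0 \<Longrightarrow> ph_nth (of_fls n F) (of_int i / of_nat n) = fls_nth F i"
  "of_nat n * q \<notin> \<int> \<Longrightarrow> ph_nth (of_fls n F) q = 0"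
  by (transfer; simp)+

lemma rat_frac_cases:
  assumes "n > 0"
  obtains i where "q = of_int i / of_nat n" | "of_nat n * (q :: rat) \<notin> \<int>"
  using assms by (metis Ints_cases nonzero_mult_div_cancel_left of_nat_0_eq_iff less_irrefl)

lemma of_fls_eqI:
  assumes "n > 0" "\<And>i. ph_nth f (of_int i / of_nat n) = fls_nth F i"
    "\<And>q. of_nat n * q \<notin> \<int> \<Longrightarrow> ph_nth f q = 0"
  shows "of_fls n F = f"
proof (rule ph_eqI)
  fix q
  show "ph_nth (of_fls n F) q = ph_nth f q"
    using assms(1) by (rule rat_frac_cases[of n q]) (simp_all add: ph_nth_of_fls assms)
qed

lemma of_fls_inject: "n > 0 \<Longrightarrow> of_fls n F = of_fls n G \<longleftrightarrow> F = G"
  by (metis fls_eqI ph_nth_of_fls(1))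

lemma of_fls_add:
  "n > 0 \<Longrightarrow> of_fls n (F + G) = of_fls n F + of_fls n (G :: 'a::comm_monoid_add fls)"
  by (rule of_fls_eqI) (simp_all add: ph_nth_of_fls)

lemma of_fls_1: "n > 0 \<Longrightarrow> of_fls n (1 :: 'a::comm_ring_1 fls) = 1"
  by (rule of_fls_eqI) (auto simp: ph_nth_1)

lemma of_fls_mult:
  assumes n: "n > 0"
  shows "of_fls n (F * G) = of_fls n F * of_fls n (G :: 'a::comm_ring_1 fls)"
proof (rule of_fls_eqI[OF n])
  fix i
  let ?A = "{fls_subdegree F..i - fls_subdegree G}"
  have "ph_nth (of_fls n F * of_fls n G) (of_int i / of_nat n)
    = (\<Sum>s\<in>(\<lambda>j. of_int j / of_nat n) ` ?A.
        ph_nth (of_fls n F) s * ph_nth (of_fls n G) (of_int i / of_nat n - s))"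
  proof (rule ph_nth_mult_superset)
    fix s
    assume s: "ph_nth (of_fls n F) s \<noteq> 0" "ph_nth (of_fls n G) (of_int i / of_nat n - s) \<noteq> 0"
    then obtain j where j: "s = of_int j / of_nat n"
      using rat_frac_cases[OF n, of s] ph_nth_of_fls(2) by metis
    have "of_int i / of_nat n - s = of_int (i - j) / of_nat n" by (simp add: j diff_divide_distrib)
    then have "fls_nth F j \<noteq> 0" "fls_nth G (i - j) \<noteq> 0"
      using s n by (auto simp: j ph_nth_of_fls(1) simp del: of_int_diff)
    then have "j \<in> ?A" using fls_subdegree_leI[of F j] fls_subdegree_leI[of G "i - j"] by auto
    then show "s \<in> (\<lambda>j. of_int j / of_nat n) ` ?A" using j by blast
  qed simp
  also have "\<dots> = (\<Sum>j\<in>?A. fls_nth F j * fls_nth G (i - j))"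
  proof (subst sum.reindex)
    show "inj_on (\<lambda>j. of_int j / of_nat n :: rat) ?A" using n by (auto intro!: inj_onI)
    have "ph_nth (of_fls n G) (of_int i / of_nat n - of_int j / of_nat n) = fls_nth G (i - j)" for j
      using ph_nth_of_fls(1)[OF n, of G "i - j"] by (simp add: diff_divide_distrib)
    then show "sum ((\<lambda>s. ph_nth (of_fls n F) s * ph_nth (of_fls n G) (of_int i / of_nat n - s))
        \<circ> (\<lambda>j. of_int j / of_nat n)) ?A = (\<Sum>j\<in>?A. fls_nth F j * fls_nth G (i - j))"
      using n by (simp add: ph_nth_of_fls(1))
  qed
  also have "\<dots> = fls_nth (F * G) i" by (simp add: fls_times_nth(2))
  finally show "ph_nth (of_fls n F * of_fls n G) (of_int i / of_nat n) = fls_nth (F * G) i" .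
next
  fix q :: rat assume q: "of_nat n * q \<notin> \<int>"
  show "ph_nth (of_fls n F * of_fls n G) q = 0"
  proof (rule ccontr)
    assume "ph_nth (of_fls n F * of_fls n G) q \<noteq> 0"
    then obtain s where "ph_nth (of_fls n F) s \<noteq> 0" "ph_nth (of_fls n G) (q - s) \<noteq> 0"
      by (rule ph_nth_mult_nonzero)
    then have "of_nat n * s \<in> \<int>" "of_nat n * (q - s) \<in> \<int>" using ph_nth_of_fls(2) by blast+
    then have "of_nat n * s + of_nat n * (q - s) \<in> \<int>" by (rule Ints_add)
    then show False using q by (simp add: algebra_simps)
  qed
qed

definition puiseux :: "'a::zero puiseux_hat set" where
  "puiseux = (\<Union>n\<in>{1..}. range (of_fls n))"

lemma common_denominator:
  "finite S \<Longrightarrow> \<exists>n>0. \<forall>q\<in>S. of_nat n * (q :: rat) \<in> \<int>"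
proof (induction S rule: finite_induct)
  case (insert p S)
  then obtain n where n: "n > 0" "\<forall>q\<in>S. of_nat n * q \<in> \<int>" by blast
  obtain a b where ab: "p = of_int a / of_int b" "b > 0" by (metis Rat_cases Fract_of_int_quotient)
  have "of_nat (n * nat b) * p = of_int (int n * a)" using ab by simp
  then have "of_nat (n * nat b) * p \<in> \<int>" by (metis Ints_of_int)
  moreover have "of_nat (n * nat b) * q \<in> \<int>" if "q \<in> S" for q
  proof -
    have "of_nat (n * nat b) * q = of_nat (nat b) * (of_nat n * q)"
      by (simp only: of_nat_mult ac_simps)
    also have "\<dots> \<in> \<int>" by (rule Ints_mult[OF Ints_of_nat bspec[OF n(2) that]])
    finally show ?thesis .
  qed
  ultimately have "\<forall>q\<in>insert p S. of_nat (n * nat b) * q \<in> \<int>" by blast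
  moreover have "n * nat b > 0" using n(1) ab(2) by simp
  ultimately show ?case by blast
qed auto

lemma puiseux_dense:
  assumes "0 < \<rho>" "\<rho> < 1"
  shows "Metric_space.mtopology UNIV (ph_dist \<rho>) closure_of puiseux
    = (UNIV :: 'a::ab_group_add puiseux_hat set)"
proof -
  interpret Metric_space "UNIV :: 'a puiseux_hat set" "ph_dist \<rho>"
    by (rule Metric_space_ph[OF assms])
  have "\<exists>p\<in>puiseux. p \<in> mball f e" if "e > 0" for f :: "'a puiseux_hat" and e
  proof -
    obtain m where m: "\<rho> ^ m < e" using real_arch_pow_inv assms \<open>e > 0\<close> by blast
    let ?S = "{q. q \<le> of_nat m \<and> ph_nth f q \<noteq> 0}"
    obtain n where n: "n > 0" "\<forall>q\<in>?S. of_nat n * q \<in> \<int>"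
      using common_denominator[OF ph_finite] by blast
    define c where "c i = (if i \<le> int n * int m then ph_nth f (of_int i / of_nat n) else 0)" for i
    obtain a where a: "\<And>q. ph_nth f q \<noteq> 0 \<Longrightarrow> a \<le> q" using ph_bounded_below by blast
    have "c i = 0" if "i < \<lfloor>of_nat n * a\<rfloor>" for i
    proof -
      have "of_int i < of_nat n * a" using that by linarith
      then have "\<not> a \<le> of_int i / of_nat n" using n(1) by (simp add: field_simps)
      then show ?thesis using a unfolding c_def by auto
    qed
    then have c: "fls_nth (Abs_fls c) i = c i" for i
      by (intro nth_Abs_fls_lower_bound[of "\<lfloor>of_nat n * a\<rfloor>"]) auto
    let ?p = "of_fls n (Abs_fls c)"
    have eq: "ph_nth f q = ph_nth ?p q" if "q < of_nat m" for q
      using n(1)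
    proof (rule rat_frac_cases[of n q])
      fix i assume i: "q = of_int i / of_nat n"
      have "(of_int i :: rat) < of_int (int n * int m)"
        using that n(1) unfolding i by (simp add: field_simps)
      then have "i \<le> int n * int m" unfolding of_int_less_iff by simp
      then show ?thesis using n(1) unfolding i by (simp add: ph_nth_of_fls(1) c c_def)
    next
      assume "of_nat n * q \<notin> \<int>"
      moreover from this have "ph_nth f q = 0" using n(2) that by fastforce
      ultimately show ?thesis by (simp add: ph_nth_of_fls(2))
    qed
    then have "ph_dist \<rho> f ?p < e"
      using m ph_dist_le_power_iff[OF assms, of f ?p m] by auto
    moreover have "?p \<in> puiseux" unfolding puiseux_def by (rule UN_I[of n]) (use n(1) in auto)
    ultimately show ?thesis by (auto simp: in_mball)
  qed
  then show ?thesis unfolding metric_closure_of by auto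
qed


section \<open>The Galois action\<close>

text \<open>
  An automorphism of the Puiseux series over \<open>k((x))\<close> is an isometry, so it extends uniquely to the
  completion.  The Galois group is therefore represented by the set of these extensions: the
  isometric field automorphisms of the completion that map the Puiseux series onto themselves and
  fix \<open>k((x))\<close> pointwise.
\<close>

definition puiseux_gal :: "('a::field puiseux_hat \<Rightarrow> 'a puiseux_hat) set" where
  "puiseux_gal = {\<sigma>. bij \<sigma> \<and>
     (\<forall>a b. \<sigma> (a + b) = \<sigma> a + \<sigma> b) \<and> (\<forall>a b. \<sigma> (a * b) = \<sigma> a * \<sigma> b) \<and>
     (\<forall>a. ph_ord (\<sigma> a) = ph_ord a) \<and>
     \<sigma> ` puiseux = puiseux \<and> (\<forall>a\<in>range (of_fls 1). \<sigma> a = a)}"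


section \<open>The Berkovich projective line\<close>

text \<open>
  A point of the affine line is a multiplicative seminorm on the polynomials in \<open>y\<close> extending the
  absolute value; the topology is that of pointwise convergence.  The projective line is the
  one-point compactification, with \<open>None\<close> for the point at infinity.
\<close>

type_synonym 'a berk = "('a puiseux_hat poly \<Rightarrow> real) option"

definition berk_seminorms :: "real \<Rightarrow> ('a::field puiseux_hat poly \<Rightarrow> real) set" where
  "berk_seminorms \<rho> = {\<nu>. (\<forall>f. 0 \<le> \<nu> f) \<and> (\<forall>f g. \<nu> (f + g) \<le> max (\<nu> f) (\<nu> g)) \<and>
     (\<forall>f g. \<nu> (f * g) = \<nu> f * \<nu> g) \<and> (\<forall>c. \<nu> [:c:] = ph_abs \<rho> c)}"

definition berk_line :: "real \<Rightarrow> 'a::field berk topology" where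
  "berk_line \<rho> = Alexandroff_compactification (subtopology (powertop_real UNIV) (berk_seminorms \<rho>))"

text \<open>\<open>disk_norm \<rho> a r\<close> is \<open>\<zeta>(a,r)\<close>.\<close>

definition disk_norm :: "real \<Rightarrow> 'a::field puiseux_hat \<Rightarrow> real \<Rightarrow> 'a berk" where
  "disk_norm \<rho> a r = Some (\<lambda>f. SUP z \<in> {z. ph_abs \<rho> (z - a) \<le> r}. ph_abs \<rho> (poly f z))"

definition type_I :: "real \<Rightarrow> 'a::field berk \<Rightarrow> bool" where
  "type_I \<rho> \<zeta> \<longleftrightarrow> \<zeta> = None \<or> (\<exists>a. \<zeta> = Some (\<lambda>f. ph_abs \<rho> (poly f a)))"

definition type_II :: "real \<Rightarrow> 'a::field berk \<Rightarrow> bool" where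
  "type_II \<rho> \<zeta> \<longleftrightarrow> (\<exists>a s. \<zeta> = disk_norm \<rho> a (\<rho> powr of_rat s))"

text \<open>The rational number \<open>log\<^bsub>|x|\<^esub> (diam \<zeta>)\<close> of a Type II point.\<close>

definition log_diam :: "real \<Rightarrow> 'a::field berk \<Rightarrow> rat" where
  "log_diam \<rho> \<zeta> = (THE s. \<exists>a. \<zeta> = disk_norm \<rho> a (\<rho> powr of_rat s))"

text \<open>The open interval \<open>(\<alpha>,\<beta>)\<close>: a path without repetitions from \<open>\<alpha>\<close> to \<open>\<beta>\<close> is unique up to
  reparametrisation.\<close>

definition berk_interval :: "real \<Rightarrow> 'a::field berk \<Rightarrow> 'a berk \<Rightarrow> 'a berk set" where
  "berk_interval \<rho> \<alpha> \<beta> = {p t |p t. pathin (berk_line \<rho>) p \<and> inj_on p {0..1} \<and>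
     p 0 = \<alpha> \<and> p 1 = \<beta> \<and> 0 < t \<and> t < 1}"

definition berk_less :: "real \<Rightarrow> 'a::field berk \<Rightarrow> 'a berk \<Rightarrow> bool" where
  "berk_less \<rho> \<zeta> \<xi> \<longleftrightarrow> \<zeta> \<noteq> None \<and> (\<xi> \<in> berk_interval \<rho> \<zeta> None \<or> \<xi> = None)"


section \<open>Multiplicities and Farey parameters\<close>

text \<open>The action on points that sends \<open>\<zeta>(a,r)\<close> to \<open>\<zeta>(\<sigma>(a),r)\<close>.\<close>

definition gal_act :: "('a::field puiseux_hat \<Rightarrow> 'a puiseux_hat) \<Rightarrow> 'a berk \<Rightarrow> 'a berk" where
  "gal_act \<sigma> = map_option (\<lambda>\<nu> f. \<nu> (map_poly (inv \<sigma>) f))"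

definition berk_mult :: "'a::field berk \<Rightarrow> enat" where
  "berk_mult \<zeta> = (let orb = {gal_act \<sigma> \<zeta> |\<sigma>. \<sigma> \<in> puiseux_gal}
     in if finite orb then enat (card orb) else \<infinity>)"

text \<open>The generic multiplicity \<open>\<gg>(\<zeta>) = \<bb>(\<zeta>)\<close>.  The multiplicity of a Type II point is finite.\<close>

definition gen_mult :: "real \<Rightarrow> 'a::field berk \<Rightarrow> enat" where
  "gen_mult \<rho> \<zeta> =
    (if type_I \<rho> \<zeta> then berk_mult \<zeta>
     else if type_II \<rho> \<zeta> then
       (case berk_mult \<zeta> of
          enat m \<Rightarrow> enat (lcm m (nat (snd (quotient_of (log_diam \<rho> \<zeta>)))))
        | \<infinity> \<Rightarrow> \<infinity>)
     else \<infinity>)"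

text \<open>The Farey parameter \<open>(\<aa>, \<bb>)\<close> of a Type II point, where \<open>\<bb>\<close> is finite.\<close>

definition farey_b :: "real \<Rightarrow> 'a::field berk \<Rightarrow> nat" where
  "farey_b \<rho> \<zeta> = the_enat (gen_mult \<rho> \<zeta>)"

definition farey_a :: "real \<Rightarrow> 'a::field berk \<Rightarrow> int" where
  "farey_a \<rho> \<zeta> = (THE a. \<exists>\<gamma>. \<zeta> = disk_norm \<rho> \<gamma> (\<rho> powr (of_int a / of_nat (farey_b \<rho> \<zeta>))))"

definition pos_span :: "nat \<Rightarrow> nat \<Rightarrow> nat set" where
  "pos_span a b = {m * a + n * b |m n. 1 \<le> m \<and> 1 \<le> n}"


section \<open>Domains of a vertex set\<close>

definition vertex_set :: "real \<Rightarrow> 'a::field berk set \<Rightarrow> bool" where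
  "vertex_set \<rho> \<Gamma> \<longleftrightarrow> finite \<Gamma> \<and> (\<forall>\<zeta>\<in>\<Gamma>. type_II \<rho> \<zeta>)"

definition berk_domains :: "real \<Rightarrow> 'a::field berk set \<Rightarrow> 'a berk set set" where
  "berk_domains \<rho> \<Gamma> =
     connected_components_of (subtopology (berk_line \<rho>) (topspace (berk_line \<rho>) - \<Gamma>))"

definition disk_domain :: "real \<Rightarrow> 'a::field berk \<Rightarrow> 'a berk set \<Rightarrow> bool" where
  "disk_domain \<rho> \<zeta> U \<longleftrightarrow> berk_line \<rho> frontier_of U = {\<zeta>}"

definition annulus_domain :: "real \<Rightarrow> 'a::field berk \<Rightarrow> 'a berk \<Rightarrow> 'a berk set \<Rightarrow> bool" where
  "annulus_domain \<rho> \<alpha> \<beta> U \<longleftrightarrow> \<alpha> \<noteq> \<beta> \<and> berk_line \<rho> frontier_of U = {\<alpha>, \<beta>}"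

text \<open>Infima of nonempty subsets of \<^typ>\<open>enat\<close> are attained, so \<open>INF\<close> is the minimum.\<close>

definition farey_domain :: "real \<Rightarrow> 'a::field berk set \<Rightarrow> bool" where
  "farey_domain \<rho> U \<longleftrightarrow>
     (\<exists>\<zeta>. disk_domain \<rho> \<zeta> U \<and> (INF \<xi>\<in>U. berk_mult \<xi>) = gen_mult \<rho> \<zeta>) \<or>
     (\<exists>\<alpha> \<beta>. annulus_domain \<rho> \<alpha> \<beta> U \<and> (\<forall>\<zeta>\<in>U. gen_mult \<rho> \<zeta> > max (gen_mult \<rho> \<alpha>) (gen_mult \<rho> \<beta>)))"

end

theory Submission
  imports Defs
begin

text \<open>
  A point of the line is studied through its distances \<open>\<nu>(y - c)\<close> to the elements \<open>c\<close> of the completed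
  field.  A seminorm whose distance to every element is at least its distance \<open>r > 0\<close> to \<open>b\<close> is \<open>\<zeta>(b,r)\<close>
  (\<open>centered_seminorm\<close>): the reduction of a polynomial on the disk is a polynomial over \<open>k\<close>, and this
  splits.  The flow towards infinity, which moves \<open>\<nu>\<close> to the Gauss norm of radius \<open>r\<close> of the expansion of
  \<open>f(y + T)\<close>, therefore carries \<open>\<nu>\<close> to \<open>\<zeta>(b,r)\<close> as soon as \<open>r\<close> reaches the distance to \<open>b\<close>.
  
  Two consequences give the topology.  The complement of \<open>\<zeta>(a,r)\<close> is the disjoint union of the complement
  of the closed disk and of open disks of radius \<open>r\<close>, all of them open, so that a connected set that avoids
  \<open>\<zeta>(a,r)\<close> lies in one of these directions (\<open>connected_in_one_direction\<close>).  Conversely the flow shows that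
  complements of finitely many closed disks, also inside an open disk, are connected.  So a disk of the
  vertex set is an open disk or contains infinity, an annulus between comparable points consists of the
  points strictly between them, and an annulus between incomparable points contains their join.
  
  An automorphism multiplies each \<open>x\<^sup>q\<close> by a root of unity, and a finite sum of monomials has as many
  conjugates as the least common denominator of its exponents (\<open>card_conjugates\<close>).  For \<open>\<zeta>(a,\<bar>x\<bar>\<^sup>s)\<close> the
  multiplicity is thus the least common denominator \<open>M\<close> of the exponents below \<open>s\<close> that occur in \<open>a\<close>, and
  the generic multiplicity is the least common multiple of \<open>M\<close> and the denominator of \<open>s\<close>, which is \<open>M\<close>
  times the denominator of \<open>M s\<close>.  An automorphism that fixes some point of an open disk fixes the terms of
  its centre up to the exponent of the radius.  Hence the multiplicity of the truncated centre divides
  that of each point of the disk; being attained in the disk, it is the minimum (\<open>disk_domain_dvd\<close>).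
  
  Let now \<open>a\<close> be the centre of an annulus with radii \<open>\<bar>x\<bar>\<^sup>s < \<bar>x\<bar>\<^sup>t\<close>, and \<open>M\<close> the multiplicity of its inner
  end.  If \<open>a\<close> has an exponent \<open>v\<close> strictly between \<open>t\<close> and \<open>s\<close>, the generic multiplicity of \<open>\<zeta>(a,\<bar>x\<bar>\<^sup>v)\<close> divides \<open>M\<close>,
  so that all conditions fail.  If there is none, the generic multiplicities in the annulus are \<open>\<infinity>\<close> or
  multiples of \<open>M\<close> times the denominator of \<open>M u\<close> with \<open>t < u < s\<close>, and the ends are related in the same way
  to \<open>M t\<close> and \<open>M s\<close>.  All conditions then amount to saying that \<open>M t\<close> and \<open>M s\<close> are neighbours in a Farey sequence:
  fractions in between have larger denominators, the determinant is 1, or denominators in between are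
  positive combinations of the outer ones (\<open>neighbours_if_denoms_larger\<close>, \<open>denom_between_neighbours\<close>).
  At the join of two incomparable ends the generic multiplicity divides that of one of them, and all
  conditions fail.
\<close>

section \<open>Multiplicative seminorms and Gauss norms\<close>

lemma map_poly_add_hom:
  assumes "\<phi> 0 = 0" "\<And>a b. \<phi> (a + b) = \<phi> a + \<phi> b"
  shows "map_poly \<phi> (p + q) = map_poly \<phi> p + map_poly \<phi> q"
  by (rule poly_eqI) (simp add: coeff_map_poly assms)

lemma map_poly_mult_hom:
  assumes "\<phi> 0 = 0" "\<And>a b. \<phi> (a + b) = \<phi> a + \<phi> b" "\<And>a b. \<phi> (a * b) = \<phi> a * \<phi> b"
  shows "map_poly \<phi> (p * q) = map_poly \<phi> p * map_poly \<phi> q"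
proof (rule poly_eqI)
  fix n
  have "\<phi> (\<Sum>i\<le>n. coeff p i * coeff q (n - i)) = (\<Sum>i\<le>n. \<phi> (coeff p i * coeff q (n - i)))"
    using sum_comp_morphism[of \<phi> "\<lambda>i. coeff p i * coeff q (n - i)" "{..n}", OF assms(1,2)]
    by (simp add: o_def)
  then show "coeff (map_poly \<phi> (p * q)) n = coeff (map_poly \<phi> p * map_poly \<phi> q) n"
    by (simp add: coeff_map_poly coeff_mult assms)
qed

locale mult_seminorm =
  fixes \<nu> :: "'a::comm_ring_1 \<Rightarrow> real"
  assumes nonneg: "0 \<le> \<nu> a"
    and ultrametric: "\<nu> (a + b) \<le> max (\<nu> a) (\<nu> b)"
    and mult: "\<nu> (a * b) = \<nu> a * \<nu> b"
    and zero [simp]: "\<nu> 0 = 0"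
    and one [simp]: "\<nu> 1 = 1"
begin

lemma uminus [simp]: "\<nu> (- a) = \<nu> a"
proof -
  have "\<nu> (- 1) * \<nu> (- 1) = 1" using mult[of "- 1" "- 1"] by simp
  then have "(\<nu> (- 1))\<^sup>2 = 1\<^sup>2" by (simp add: power2_eq_square)
  then have "\<nu> (- 1) = 1" by (rule power2_eq_imp_eq) (simp_all add: nonneg)
  then show ?thesis using mult[of "- 1" a] by simp
qed

lemma diff_le: "\<nu> (a - b) \<le> max (\<nu> a) (\<nu> b)"
  using ultrametric[of a "- b"] by simp

lemma add_dominated:
  assumes "\<nu> b < \<nu> a"
  shows "\<nu> (a + b) = \<nu> a"
  using ultrametric[of a b] diff_le[of "a + b" b] assms by auto

lemma sum_le:
  assumes "\<And>i. i \<in> S \<Longrightarrow> \<nu> (f i) \<le> M" "0 \<le> M"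
  shows "\<nu> (sum f S) \<le> M"
  using assms(1)
proof (induction S rule: infinite_finite_induct)
  case (insert x S)
  then show ?case using ultrametric[of "f x" "sum f S"] by fastforce
qed (use assms in auto)

lemma sum_less:
  assumes "\<And>i. i \<in> S \<Longrightarrow> \<nu> (f i) < M" "0 < M"
  shows "\<nu> (sum f S) < M"
  using assms(1)
proof (induction S rule: infinite_finite_induct)
  case (insert x S)
  then show ?case using ultrametric[of "f x" "sum f S"] by fastforce
qed (use assms in auto)

lemma power: "\<nu> (a ^ n) = \<nu> a ^ n"
  by (induction n) (simp_all add: mult)

end

definition gauss_norm :: "('a::zero \<Rightarrow> real) \<Rightarrow> real \<Rightarrow> 'a poly \<Rightarrow> real" where
  "gauss_norm \<nu> r F = Max ((\<lambda>i. \<nu> (coeff F i) * r ^ i) ` {..degree F})"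

context mult_seminorm
begin

lemma gauss_norm_attained: "\<exists>i. gauss_norm \<nu> r F = \<nu> (coeff F i) * r ^ i"
proof -
  have "gauss_norm \<nu> r F \<in> (\<lambda>i. \<nu> (coeff F i) * r ^ i) ` {..degree F}"
    unfolding gauss_norm_def by (rule Max_in) auto
  then show ?thesis by auto
qed

lemma gauss_norm_nonneg: "0 \<le> r \<Longrightarrow> 0 \<le> gauss_norm \<nu> r F"
  using gauss_norm_attained[of r F] nonneg by auto

lemma gauss_norm_ge:
  assumes "0 \<le> r"
  shows "\<nu> (coeff F i) * r ^ i \<le> gauss_norm \<nu> r F"
proof (cases "i \<le> degree F")
  case True
  then show ?thesis unfolding gauss_norm_def by (intro Max_ge) auto
next
  case False
  then show ?thesis using gauss_norm_nonneg[OF assms, of F] by (simp add: coeff_eq_0)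
qed

lemma gauss_norm_le_iff:
  "0 \<le> r \<Longrightarrow> gauss_norm \<nu> r F \<le> M \<longleftrightarrow> (\<forall>i. \<nu> (coeff F i) * r ^ i \<le> M)"
  using gauss_norm_attained[of r F] gauss_norm_ge[of r F] by (metis order_trans)

lemma gauss_norm_add:
  assumes "0 \<le> r"
  shows "gauss_norm \<nu> r (F + G) \<le> max (gauss_norm \<nu> r F) (gauss_norm \<nu> r G)"
  unfolding gauss_norm_le_iff[OF assms]
proof
  fix i
  have "\<nu> (coeff F i + coeff G i) * r ^ i \<le> max (\<nu> (coeff F i)) (\<nu> (coeff G i)) * r ^ i"
    using assms by (intro mult_right_mono ultrametric) auto
  also have "\<dots> = max (\<nu> (coeff F i) * r ^ i) (\<nu> (coeff G i) * r ^ i)"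
    using assms by (simp add: max_mult_distrib_right)
  also have "\<dots> \<le> max (gauss_norm \<nu> r F) (gauss_norm \<nu> r G)"
    using gauss_norm_ge[OF assms] by (meson max.mono)
  finally show "\<nu> (coeff (F + G) i) * r ^ i \<le> max (gauss_norm \<nu> r F) (gauss_norm \<nu> r G)" by simp
qed

text \<open>
  The inequality that is not formal comes from the first index at which each factor attains its
  norm: in the coefficient of the product at the sum of these indices one summand dominates.
\<close>

lemma gauss_norm_mult:
  assumes "0 \<le> r"
  shows "gauss_norm \<nu> r (F * G) = gauss_norm \<nu> r F * gauss_norm \<nu> r G"
proof (rule antisym)
  let ?F = "gauss_norm \<nu> r F" and ?G = "gauss_norm \<nu> r G"
  let ?f = "\<lambda>i. \<nu> (coeff F i) * r ^ i" and ?g = "\<lambda>i. \<nu> (coeff G i) * r ^ i"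
  note nn = gauss_norm_nonneg[OF assms]
  have trm: "\<nu> (coeff F i * coeff G (n - i)) * r ^ n = ?f i * ?g (n - i)" if "i \<le> n" for i n
    using that by (simp add: mult power_add[symmetric])
  show "gauss_norm \<nu> r (F * G) \<le> ?F * ?G"
    unfolding gauss_norm_le_iff[OF assms]
  proof
    fix n
    have "\<exists>i\<le>n. \<nu> (coeff (F * G) n) \<le> \<nu> (coeff F i * coeff G (n - i))"
    proof (rule ccontr)
      assume "\<not> ?thesis"
      then have *: "\<nu> (coeff F i * coeff G (n - i)) < \<nu> (coeff (F * G) n)" if "i \<le> n" for i
        using that by (meson not_le)
      moreover have "0 < \<nu> (coeff (F * G) n)" using * nonneg by (meson le_less_trans order_refl)
      ultimately have "\<nu> (\<Sum>i\<le>n. coeff F i * coeff G (n - i)) < \<nu> (coeff (F * G) n)"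
        by (intro sum_less) auto
      then show False by (simp add: coeff_mult)
    qed
    then obtain i where i: "i \<le> n" "\<nu> (coeff (F * G) n) \<le> \<nu> (coeff F i * coeff G (n - i))" by blast
    have "\<nu> (coeff (F * G) n) * r ^ n \<le> ?f i * ?g (n - i)"
      unfolding trm[OF i(1), symmetric] using assms by (intro mult_right_mono i) auto
    also have "\<dots> \<le> ?F * ?G"
      using assms by (intro mult_mono gauss_norm_ge nn mult_nonneg_nonneg nonneg) auto
    finally show "\<nu> (coeff (F * G) n) * r ^ n \<le> ?F * ?G" .
  qed
  show "?F * ?G \<le> gauss_norm \<nu> r (F * G)"
  proof (cases "?F = 0 \<or> ?G = 0")
    case True
    then show ?thesis using nn[of "F * G"] by auto
  next
    case False
    then have pos: "0 < ?F" "0 < ?G" using nn[of F] nn[of G] by auto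
    define i0 where "i0 = (LEAST i. ?f i = ?F)"
    define j0 where "j0 = (LEAST j. ?g j = ?G)"
    have i0: "?f i0 = ?F" and j0: "?g j0 = ?G"
      unfolding i0_def j0_def using gauss_norm_attained[of r F] gauss_norm_attained[of r G]
      by (metis (mono_tags, lifting) LeastI)+
    have lti: "?f i < ?F" if "i < i0" for i
      using gauss_norm_ge[OF assms, of F i] not_less_Least[of i "\<lambda>i. ?f i = ?F"] that
      unfolding i0_def by auto
    have ltj: "?g i < ?G" if "i < j0" for i
      using gauss_norm_ge[OF assms, of G i] not_less_Least[of i "\<lambda>i. ?g i = ?G"] that
      unfolding j0_def by auto
    let ?n = "i0 + j0"
    let ?t = "\<lambda>i. coeff F i * coeff G (?n - i)"
    have main: "\<nu> (?t i0) * r ^ ?n = ?F * ?G" using trm[of i0 ?n] i0 j0 by simp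
    have "0 < ?F * ?G" using pos by simp
    then have "0 < \<nu> (?t i0) * r ^ ?n" using main by simp
    moreover have "0 \<le> r ^ ?n" using assms by simp
    ultimately have rpos: "0 < r ^ ?n" and tpos: "0 < \<nu> (?t i0)"
      using nonneg[of "?t i0"] by (metis less_le mult_zero_right, metis less_le mult_zero_left)
    have "\<nu> (?t i) < \<nu> (?t i0)" if "i \<in> {..?n} - {i0}" for i
    proof -
      have "?f i * ?g (?n - i) < ?F * ?G"
      proof (cases "i < i0")
        case True
        have "?f i * ?g (?n - i) \<le> ?f i * ?G"
          using assms by (intro mult_left_mono gauss_norm_ge) (auto simp: nonneg)
        also have "\<dots> < ?F * ?G" using lti[OF True] pos by simp
        finally show ?thesis .
      next
        case False
        then have "?n - i < j0" using that by auto
        have "?f i * ?g (?n - i) \<le> ?F * ?g (?n - i)"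
          using assms by (intro mult_right_mono gauss_norm_ge) (auto simp: nonneg)
        also have "\<dots> < ?F * ?G" using ltj[OF \<open>?n - i < j0\<close>] pos by simp
        finally show ?thesis .
      qed
      then have "\<nu> (?t i) * r ^ ?n < \<nu> (?t i0) * r ^ ?n"
        unfolding main using trm[of i ?n] that by simp
      then show ?thesis using rpos by simp
    qed
    then have "\<nu> (\<Sum>i\<in>{..?n} - {i0}. ?t i) < \<nu> (?t i0)" using tpos by (intro sum_less)
    then have "\<nu> (?t i0 + (\<Sum>i\<in>{..?n} - {i0}. ?t i)) = \<nu> (?t i0)" by (rule add_dominated)
    also have "?t i0 + (\<Sum>i\<in>{..?n} - {i0}. ?t i) = coeff (F * G) ?n"
      unfolding coeff_mult by (rule sum.remove[symmetric]) auto
    finally show ?thesis using main gauss_norm_ge[OF assms, of "F * G" ?n] by simp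
  qed
qed

lemma continuous_gauss_norm: "continuous_on A (\<lambda>r. gauss_norm \<nu> r F)"
proof -
  have "continuous_on A (\<lambda>r. Max ((\<lambda>i. g i r) ` S))" if "finite S" "S \<noteq> {}"
    "\<And>i. continuous_on A (g i)" for S :: "nat set" and g :: "nat \<Rightarrow> real \<Rightarrow> real"
    using that(1,2)
  proof (induction S rule: finite_ne_induct)
    case (insert x F)
    then show ?case using that(3) by (simp add: continuous_on_max)
  qed (simp add: that)
  from this[of "{..degree F}" "\<lambda>i r. \<nu> (coeff F i) * r ^ i"] show ?thesis
    unfolding gauss_norm_def by (simp add: continuous_intros)
qed

end

section \<open>The flow towards infinity\<close>

text \<open>
  The expansion of \<open>f(y + T)\<close> in powers of \<open>T\<close>.
\<close>

definition taylor :: "'a::comm_ring_1 poly \<Rightarrow> 'a poly poly" where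
  "taylor f = poly (map_poly (\<lambda>c. [:[:c:]:]) f) [:[:0, 1:], 1:]"

lemma taylor_add: "taylor (f + g) = taylor f + taylor g"
  unfolding taylor_def by (subst map_poly_add_hom) auto

lemma taylor_mult: "taylor (f * g) = taylor f * taylor g"
  unfolding taylor_def by (subst map_poly_mult_hom) auto

lemma taylor_const: "taylor [:c:] = [:[:c:]:]"
  unfolding taylor_def by (simp add: map_poly_pCons)

lemma taylor_linear: "taylor [:c, 1:] = [:[:c, 1:], 1:]"
  unfolding taylor_def by (simp add: map_poly_pCons)

lemma coeff_0_taylor: "coeff (taylor f) 0 = f"
proof (induction f)
  case (pCons c p)
  then show ?case
    by (simp add: taylor_def map_poly_pCons poly_0_coeff_0[symmetric] del: mult_pCons_left)
      simp
qed (simp add: taylor_def)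

locale puiseux_radius =
  fixes \<rho> :: real
  assumes rho_pos: "0 < \<rho>" and rho_less_1: "\<rho> < 1"
begin

lemma ph_abs_0 [simp]: "ph_abs \<rho> 0 = 0"
  by (simp add: ph_abs_def)

lemma ph_abs_1 [simp]: "ph_abs \<rho> (1 :: 'a::field puiseux_hat) = 1"
proof -
  have "ph_ord (1 :: 'a puiseux_hat) = 0"
    using ph_ord_least(1)[of "1 :: 'a puiseux_hat"] by (auto simp: ph_nth_1 split: if_splits)
  then show ?thesis using rho_pos by (simp add: ph_abs_nonzero)
qed

sublocale ph: mult_seminorm "ph_abs \<rho> :: 'a::field puiseux_hat \<Rightarrow> real"
  by unfold_locales
    (use rho_pos rho_less_1 in \<open>auto simp: ph_abs_nonneg ph_abs_mult intro: ph_abs_add\<close>)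

abbreviation seminorms :: "('a::field puiseux_hat poly \<Rightarrow> real) set" where
  "seminorms \<equiv> berk_seminorms \<rho>"

lemma seminorm_const: "\<nu> \<in> seminorms \<Longrightarrow> \<nu> [:c:] = ph_abs \<rho> c"
  by (simp add: berk_seminorms_def)

lemma seminorm_mult_seminorm: "\<nu> \<in> seminorms \<Longrightarrow> mult_seminorm \<nu>"
  using seminorm_const[of \<nu> 0] seminorm_const[of \<nu> 1]
  unfolding berk_seminorms_def by unfold_locales (auto simp: one_pCons)

text \<open>
  The Gauss norm of radius \<open>r\<close> of \<open>f(y + T)\<close>, at the point \<open>\<nu>\<close>: the supremum of \<open>f\<close> over the points within
  distance \<open>r\<close> of that point.
\<close>

definition flow :: "real \<Rightarrow> ('a::field puiseux_hat poly \<Rightarrow> real) \<Rightarrow> 'a puiseux_hat poly \<Rightarrow> real" where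
  "flow r \<nu> f = gauss_norm \<nu> r (taylor f)"

definition eval_norm :: "'a::field puiseux_hat \<Rightarrow> 'a puiseux_hat poly \<Rightarrow> real" where
  "eval_norm a f = ph_abs \<rho> (poly f a)"

abbreviation disk_seminorm :: "'a::field puiseux_hat \<Rightarrow> real \<Rightarrow> 'a puiseux_hat poly \<Rightarrow> real" where
  "disk_seminorm a r \<equiv> flow r (eval_norm a)"

lemma eval_norm_seminorm [simp]: "eval_norm a \<in> seminorms"
  unfolding berk_seminorms_def eval_norm_def by (auto simp: ph.nonneg ph.ultrametric ph.mult)

lemma flow_seminorm:
  assumes "\<nu> \<in> seminorms" "0 \<le> r"
  shows "flow r \<nu> \<in> seminorms"
proof -
  interpret mult_seminorm \<nu> by (rule seminorm_mult_seminorm[OF assms(1)])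
  have "flow r \<nu> [:c:] = ph_abs \<rho> c" for c
    using assms by (simp add: flow_def taylor_const gauss_norm_def seminorm_const)
  then show ?thesis
    unfolding berk_seminorms_def
    by (simp add: flow_def gauss_norm_nonneg gauss_norm_add gauss_norm_mult assms taylor_add taylor_mult)
qed

lemma flow_0:
  assumes "\<nu> \<in> seminorms"
  shows "flow 0 \<nu> = \<nu>"
proof
  interpret mult_seminorm \<nu> by (rule seminorm_mult_seminorm[OF assms])
  fix f
  have "gauss_norm \<nu> 0 F = \<nu> (coeff F 0)" for F
    using gauss_norm_ge[of 0 F 0] gauss_norm_attained[of 0 F] nonneg
    by (auto simp: power_0_left split: if_splits intro: antisym)
  then show "flow 0 \<nu> f = \<nu> f" by (simp add: flow_def coeff_0_taylor)
qed

text \<open>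
  By \<open>centered_seminorm\<close> these values determine the flow from the moment at which it reaches a disk around
  an element of the field.
\<close>

lemma flow_linear:
  assumes "\<nu> \<in> seminorms"
  shows "flow r \<nu> [:- c, 1:] = max (\<nu> [:- c, 1:]) r"
proof -
  interpret mult_seminorm \<nu> by (rule seminorm_mult_seminorm[OF assms])
  have "{..1::nat} = {0, 1}" by auto
  then show ?thesis by (simp add: flow_def taylor_linear gauss_norm_def)
qed

lemma disk_seminorm_seminorm [simp]: "0 \<le> r \<Longrightarrow> disk_seminorm a r \<in> seminorms"
  by (simp add: flow_seminorm)

lemma disk_seminorm_linear: "disk_seminorm a r [:- c, 1:] = max (ph_abs \<rho> (a - c)) r"
  by (subst flow_linear) (auto simp: eval_norm_def)

lemma continuous_flow: "\<nu> \<in> seminorms \<Longrightarrow> continuous_on A (\<lambda>r. flow r \<nu>)"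
  unfolding flow_def
  by (intro continuous_on_coordinatewise_then_product mult_seminorm.continuous_gauss_norm
      seminorm_mult_seminorm)

end

section \<open>Monomials\<close>

lemma ph_monom_mult: "ph_monom c p * ph_monom d q = ph_monom (c * d :: 'a::field) (p + q)"
  by (rule ph_eqI) (auto simp: ph_nth_monom_mult ph_nth_monom)

lemma ph_monom_add: "ph_monom (c + d) q = ph_monom c q + ph_monom (d :: 'a::field) q"
  by (rule ph_eqI) (auto simp: ph_nth_monom)

lemma ph_monom_0 [simp]: "ph_monom (0 :: 'a::field) q = 0"
  by (rule ph_eqI) (auto simp: ph_nth_monom)

lemma ph_monom_one: "ph_monom 1 0 = (1 :: 'a::field puiseux_hat)"
  by (simp add: one_puiseux_hat_def)

context puiseux_radius
begin

section \<open>Seminorms of disks\<close>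

abbreviation radius :: "rat \<Rightarrow> real" where
  "radius s \<equiv> \<rho> powr of_rat s"

lemma rho_ne_0 [simp]: "\<rho> \<noteq> 0"
  using rho_pos by simp

lemma powr_rho_less_iff [simp]: "\<rho> powr a < \<rho> powr b \<longleftrightarrow> b < a"
proof
  have *: "c < d \<Longrightarrow> \<rho> powr d < \<rho> powr c" for c d
    using rho_pos rho_less_1 by (rule powr_less_mono')
  show "b < a" if "\<rho> powr a < \<rho> powr b"
    using that *[of a b] by (cases a b rule: linorder_cases) auto
  show "\<rho> powr a < \<rho> powr b" if "b < a" using *[OF that] .
qed

lemma powr_rho_le_iff [simp]: "\<rho> powr a \<le> \<rho> powr b \<longleftrightarrow> b \<le> a"
  using powr_rho_less_iff not_less by blast

lemma powr_rho_eq_iff [simp]: "\<rho> powr a = \<rho> powr b \<longleftrightarrow> a = b"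
  by (metis powr_rho_le_iff antisym order_refl)

lemma powr_rho_pos [simp]: "0 < \<rho> powr a"
  using rho_pos by simp

lemma ph_abs_pos: "f \<noteq> 0 \<Longrightarrow> 0 < ph_abs \<rho> f" for f :: "'a::field puiseux_hat"
  by (simp add: ph_abs_nonzero)

lemma powr_rho_surj: "0 < r \<Longrightarrow> \<exists>u. r = \<rho> powr u"
  using rho_pos rho_less_1 by (intro exI[of _ "log \<rho> r"]) simp

lemma ph_abs_less_iff:
  "ph_abs \<rho> f < radius r \<longleftrightarrow> (\<forall>q\<le>r. ph_nth (f :: 'a::field puiseux_hat) q = 0)"
proof (cases "f = 0")
  case True
  then show ?thesis by simp
next
  case False
  then have "ph_abs \<rho> f < radius r \<longleftrightarrow> r < ph_ord f"
    by (simp add: ph_abs_nonzero of_rat_less)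
  also have "\<dots> \<longleftrightarrow> (\<forall>q\<le>r. ph_nth f q = 0)"
    using ph_ord_least[OF False] by (meson less_le_trans not_less)
  finally show ?thesis .
qed

lemma ph_abs_monom: "c \<noteq> (0 :: 'a::field) \<Longrightarrow> ph_abs \<rho> (ph_monom c q) = radius q"
proof -
  assume c: "c \<noteq> 0"
  have *: "ph_nth (ph_monom c q) q \<noteq> 0" using c by (simp add: ph_nth_monom)
  then have "ph_monom c q \<noteq> 0" by auto
  moreover have "ph_ord (ph_monom c q) = q"
    using ph_ord_least[OF calculation] * by (auto simp: ph_nth_monom split: if_splits)
  ultimately show ?thesis by (simp add: ph_abs_nonzero)
qed

lemma poly_expansion:
  fixes f :: "'b::comm_ring_1 poly"
  shows "f = (\<Sum>j\<le>degree (f \<circ>\<^sub>p [:b, 1:]). [:coeff (f \<circ>\<^sub>p [:b, 1:]) j:] * [:- b, 1:] ^ j)"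
proof -
  let ?g = "f \<circ>\<^sub>p [:b, 1:]"
  have "f = ?g \<circ>\<^sub>p [:- b, 1:]" by (simp add: pcompose_assoc[symmetric] pcompose_pCons)
  also have "\<dots> = (\<Sum>j\<le>degree ?g. [:coeff ?g j:] * [:- b, 1:] ^ j)"
    unfolding pcompose_altdef[of ?g] poly_altdef
    by (simp add: coeff_map_poly degree_map_poly)
  finally show ?thesis .
qed

lemma seminorm_expansion_le:
  assumes "\<nu> \<in> seminorms" "\<nu> [:- b, 1:] \<le> r"
  shows "\<nu> f \<le> gauss_norm (ph_abs \<rho>) r (f \<circ>\<^sub>p [:b, 1:])"
proof -
  interpret mult_seminorm \<nu> by (rule seminorm_mult_seminorm[OF assms(1)])
  have r: "0 \<le> r" using assms(2) nonneg order_trans by blast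
  let ?g = "f \<circ>\<^sub>p [:b, 1:]"
  have "\<nu> ([:coeff ?g j:] * [:- b, 1:] ^ j) \<le> gauss_norm (ph_abs \<rho>) r ?g" for j
  proof -
    have "\<nu> ([:coeff ?g j:] * [:- b, 1:] ^ j) \<le> ph_abs \<rho> (coeff ?g j) * r ^ j"
      unfolding mult power seminorm_const[OF assms(1)]
      by (intro mult_left_mono power_mono assms(2) nonneg ph.nonneg)
    then show ?thesis using ph.gauss_norm_ge[OF r] order_trans by blast
  qed
  then have "\<nu> (\<Sum>j\<le>degree ?g. [:coeff ?g j:] * [:- b, 1:] ^ j) \<le> gauss_norm (ph_abs \<rho>) r ?g"
    using ph.gauss_norm_nonneg[OF r] by (intro sum_le)
  then show ?thesis using poly_expansion[of f b] by simp
qed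

text \<open>
  Substitutes \<open>(y - b) / x\<^sup>s\<close>, which maps the disk of radius \<open>\<bar>x\<bar>\<^sup>s\<close> around \<open>b\<close> to the unit disk, in a
  polynomial over \<open>k\<close>.
\<close>

definition rescale :: "'a::field puiseux_hat \<Rightarrow> rat \<Rightarrow> 'a poly \<Rightarrow> 'a puiseux_hat poly" where
  "rescale b s p = poly (map_poly (\<lambda>c. [:ph_monom c 0:]) p) ([:ph_monom 1 (- s):] * [:- b, 1:])"

lemma rescale_mult: "rescale b s (p * q) = rescale b s p * rescale b s q"
  unfolding rescale_def by (subst map_poly_mult_hom) (auto simp: ph_monom_add ph_monom_mult mult.commute)

lemma rescale_const: "rescale b s [:c:] = [:ph_monom c 0:]"
  unfolding rescale_def by (cases "c = 0") (simp_all add: map_poly_pCons)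

lemma rescale_linear:
  "rescale b s [:- u, 1:] = [:ph_monom 1 (- s):] * [:- (b + ph_monom u s), 1:]"
proof -
  have "ph_monom (- u) 0 = - ph_monom u 0" by (rule ph_eqI) (auto simp: ph_nth_monom)
  then show ?thesis
    unfolding rescale_def
    by (simp add: map_poly_pCons ph_monom_mult algebra_simps ph_monom_one)
qed

lemma rescale_monom_sum:
  "[:ph_monom 1 e:] * rescale b s (\<Sum>j\<le>n. monom (k j) j)
    = (\<Sum>j\<le>n. [:ph_monom (k j) (e - s * of_nat j):] * [:- b, 1:] ^ j)"
proof -
  have pw: "ph_monom (1::'a) (- s) ^ j = ph_monom 1 (- s * of_nat j)" for j
    by (induction j) (simp_all add: ph_monom_one ph_monom_mult algebra_simps)
  have mono: "[:ph_monom 1 e:] * rescale b s (monom c j) = [:ph_monom c (e - s * of_nat j):] * [:- b, 1:] ^ j"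
    for c j
  proof -
    have "[:a:] ^ j = [:a ^ j:]" for a :: "'a puiseux_hat"
      by (induction j) simp_all
    then have "([:ph_monom 1 (- s):] * [:- b, 1:]) ^ j = [:ph_monom 1 (- s * of_nat j):] * [:- b, 1:] ^ j"
      unfolding power_mult_distrib by (simp add: pw)
    then show ?thesis
      unfolding rescale_def
      by (simp add: map_poly_monom poly_monom ph_monom_mult algebra_simps)
  qed
  have "rescale b s (\<Sum>j\<le>n. monom (k j) j) = (\<Sum>j\<le>n. rescale b s (monom (k j) j))"
  proof (induction n)
    case (Suc n)
    have "rescale b s (p + q) = rescale b s p + rescale b s q" for p q
      unfolding rescale_def by (subst map_poly_add_hom) (auto simp: ph_monom_add)
    then show ?case using Suc by simp
  qed simp
  then show ?thesis by (simp add: sum_distrib_left mono del: mult_pCons_left)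
qed

text \<open>
  In the coefficient of \<open>(y - b)\<^sup>j\<close> only the term of exponent \<open>e - s j\<close> can contribute to the maximum \<open>\<bar>x\<bar>\<^sup>e\<close> of
  \<open>f\<close> on the disk.  These terms form a rescaled polynomial over \<open>k\<close>, and the rest is strictly smaller.
\<close>

lemma residue_polynomial:
  fixes f :: "'a::field puiseux_hat poly"
  assumes "f \<noteq> 0"
  obtains p e where "p \<noteq> 0"
    "gauss_norm (ph_abs \<rho>) (radius s) (f \<circ>\<^sub>p [:b, 1:]) = radius e"
    "\<And>\<nu>. \<nu> \<in> seminorms \<Longrightarrow> \<nu> [:- b, 1:] \<le> radius s \<Longrightarrow>
      \<nu> (f - [:ph_monom 1 e:] * rescale b s p) < radius e"
proof -
  let ?r = "radius s"
  define g where "g = f \<circ>\<^sub>p [:b, 1:]"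
  define E where "E = gauss_norm (ph_abs \<rho>) ?r g"
  have rpow: "?r ^ j = radius (s * of_nat j)" for j
    by (simp add: of_rat_mult powr_powr[symmetric] powr_realpow[symmetric])
  have le: "ph_abs \<rho> (coeff g j) * ?r ^ j \<le> E" for j
    unfolding E_def by (rule ph.gauss_norm_ge) simp
  have "g \<noteq> 0" using assms poly_expansion[of f b] unfolding g_def by auto
  then have "0 < ph_abs \<rho> (lead_coeff g) * ?r ^ degree g"
    using ph_abs_pos[of "lead_coeff g"] by simp
  then have "0 < E" using le[of "degree g"] by simp
  obtain i where i: "E = ph_abs \<rho> (coeff g i) * ?r ^ i"
    using ph.gauss_norm_attained unfolding E_def by blast
  then have ci: "coeff g i \<noteq> 0" using \<open>0 < E\<close> by auto
  define e where "e = ph_ord (coeff g i) + s * of_nat i"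
  have E: "E = radius e"
    unfolding i rpow e_def using ci by (simp add: ph_abs_nonzero of_rat_add powr_add)
  define k where "k j = ph_nth (coeff g j) (e - s * of_nat j)" for j
  define p where "p = (\<Sum>j\<le>degree g. monom (k j) j)"
  have small: "ph_abs \<rho> (coeff g j - ph_monom (k j) (e - s * of_nat j)) * ?r ^ j < E" for j
  proof -
    have "radius (e - s * of_nat j) * ?r ^ j = E"
      unfolding E rpow by (simp add: powr_add[symmetric] of_rat_add[symmetric])
    moreover have "0 < ?r ^ j" by simp
    ultimately have *: "z * ?r ^ j \<le> E \<longleftrightarrow> z \<le> radius (e - s * of_nat j)"
      "z * ?r ^ j < E \<longleftrightarrow> z < radius (e - s * of_nat j)" for z
      by (metis mult_le_cancel_right_pos, metis mult_less_cancel_right_pos)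
    have "\<forall>q<e - s * of_nat j. ph_nth (coeff g j) q = 0"
      using le[of j] unfolding * ph_abs_le_iff[OF rho_pos rho_less_1] .
    then show ?thesis unfolding * ph_abs_less_iff by (auto simp: ph_nth_monom k_def)
  qed
  show thesis
  proof
    have "coeff p j = (if j \<le> degree g then k j else 0)" for j
      unfolding p_def by (simp add: coeff_sum)
    moreover have "i \<le> degree g" using ci le_degree by blast
    moreover have "k i \<noteq> 0"
      unfolding k_def e_def using ph_ord_least(1)[OF ci] by simp
    ultimately show "p \<noteq> 0" by (metis coeff_0)
    show "gauss_norm (ph_abs \<rho>) ?r (f \<circ>\<^sub>p [:b, 1:]) = radius e"
      using E unfolding E_def g_def .
    fix \<nu> :: "'a puiseux_hat poly \<Rightarrow> real"
    assume \<nu>: "\<nu> \<in> seminorms" "\<nu> [:- b, 1:] \<le> ?r"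
    interpret mult_seminorm \<nu> by (rule seminorm_mult_seminorm[OF \<nu>(1)])
    have "f = (\<Sum>j\<le>degree g. [:coeff g j:] * [:- b, 1:] ^ j)"
      unfolding g_def by (rule poly_expansion)
    then have "f - [:ph_monom 1 e:] * rescale b s p
      = (\<Sum>j\<le>degree g. [:coeff g j:] * [:- b, 1:] ^ j)
        - (\<Sum>j\<le>degree g. [:ph_monom (k j) (e - s * of_nat j):] * [:- b, 1:] ^ j)"
      unfolding p_def rescale_monom_sum by simp
    also have "\<dots> = (\<Sum>j\<le>degree g. [:coeff g j - ph_monom (k j) (e - s * of_nat j):] * [:- b, 1:] ^ j)"
      unfolding sum_subtractf[symmetric] by (rule sum.cong) (simp_all add: smult_diff_left)
    also have "\<nu> \<dots> < E"
    proof (rule sum_less[OF _ \<open>0 < E\<close>])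
      fix j
      have "\<nu> ([:coeff g j - ph_monom (k j) (e - s * of_nat j):] * [:- b, 1:] ^ j)
        \<le> ph_abs \<rho> (coeff g j - ph_monom (k j) (e - s * of_nat j)) * ?r ^ j"
        unfolding mult power seminorm_const[OF \<nu>(1)]
        by (intro mult_left_mono power_mono \<nu>(2) nonneg ph.nonneg)
      then show "\<nu> ([:coeff g j - ph_monom (k j) (e - s * of_nat j):] * [:- b, 1:] ^ j) < E"
        using small[of j] by simp
    qed
    finally show "\<nu> (f - [:ph_monom 1 e:] * rescale b s p) < radius e" unfolding E .
  qed
qed

text \<open>
  After rescaling, a linear factor measures the distance to an element of the disk of radius \<open>\<bar>x\<bar>\<^sup>s\<close> around
  \<open>b\<close>, and this distance equals the radius.
\<close>

lemma rescale_norm_1: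
  fixes p :: "'a::alg_closed_field poly"
  assumes \<nu>: "\<nu> \<in> seminorms" and r: "\<nu> [:- b, 1:] = radius s"
    and min: "\<And>c. radius s \<le> \<nu> [:- c, 1:]" and "p \<noteq> 0"
  shows "\<nu> (rescale b s p) = 1"
  using \<open>p \<noteq> 0\<close>
proof (induction "degree p" arbitrary: p)
  case 0
  then obtain c where "p = [:c:]" "c \<noteq> 0" by (metis degree_eq_zeroE pCons_eq_0_iff)
  then show ?case by (simp add: rescale_const seminorm_const[OF \<nu>] ph_abs_monom)
next
  case (Suc n)
  interpret mult_seminorm \<nu> by (rule seminorm_mult_seminorm[OF \<nu>])
  obtain u where "poly p u = 0" using alg_closed_imp_poly_has_root[of p] Suc(2) by auto
  then obtain q where q: "p = [:- u, 1:] * q" by (auto simp: poly_eq_0_iff_dvd)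
  then have "q \<noteq> 0" "n = degree q" using Suc(2,3) by (auto simp: degree_mult_eq simp del: mult_pCons_left)
  then have IH: "\<nu> (rescale b s q) = 1" using Suc(1) by blast
  have "\<nu> [:- (b + ph_monom u s), 1:] \<le> max (\<nu> [:- b, 1:]) (\<nu> [:ph_monom u s:])"
    using diff_le[of "[:- b, 1:]" "[:ph_monom u s:]"] by simp
  also have "\<dots> \<le> radius s"
    by (cases "u = 0") (auto simp: r seminorm_const[OF \<nu>] ph_abs_monom)
  finally have "\<nu> [:- (b + ph_monom u s), 1:] = radius s" using min antisym by blast
  then have "\<nu> (rescale b s [:- u, 1:]) = radius (- s) * radius s"
    unfolding rescale_linear mult by (simp add: seminorm_const[OF \<nu>] ph_abs_monom)
  also have "\<dots> = 1" using rho_pos by (simp add: powr_add[symmetric] of_rat_minus)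
  finally show ?case by (simp add: q rescale_mult mult IH del: mult_pCons_left)
qed

text \<open>
  If \<open>r\<close> is in the value group, the residue polynomial splits over \<open>k\<close> into linear factors, each of norm 1.  Otherwise
  the terms of an expansion around \<open>b\<close> have distinct sizes, so that the largest one dominates.
\<close>

lemma centered_seminorm:
  fixes \<nu> :: "'a::alg_closed_field puiseux_hat poly \<Rightarrow> real"
  assumes \<nu>: "\<nu> \<in> seminorms" and r: "\<nu> [:- b, 1:] = r" and min: "\<And>c. r \<le> \<nu> [:- c, 1:]" and "0 < r"
  shows "\<nu> f = gauss_norm (ph_abs \<rho>) r (f \<circ>\<^sub>p [:b, 1:])"
proof (cases "f = 0")
  case True
  interpret mult_seminorm \<nu> by (rule seminorm_mult_seminorm[OF \<nu>])
  show ?thesis using True by (simp add: gauss_norm_def)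
next
  case f: False
  interpret mult_seminorm \<nu> by (rule seminorm_mult_seminorm[OF \<nu>])
  show ?thesis
  proof (cases "\<exists>s. r = radius s")
    case True
    then obtain s where s: "r = radius s" by blast
    obtain p e where p: "p \<noteq> 0" and E: "gauss_norm (ph_abs \<rho>) r (f \<circ>\<^sub>p [:b, 1:]) = radius e"
      and diff: "\<nu> (f - [:ph_monom 1 e:] * rescale b s p) < radius e"
      using residue_polynomial[OF f, of s b] \<nu> r unfolding s by (metis order_refl)
    have "\<nu> ([:ph_monom 1 e:] * rescale b s p) = radius e"
      unfolding mult seminorm_const[OF \<nu>] using rescale_norm_1[OF \<nu> _ _ p, of b s] r min s
      by (simp add: ph_abs_monom)
    then show ?thesis unfolding E using add_dominated[of "f - [:ph_monom 1 e:] * rescale b s p" "[:ph_monom 1 e:] * rescale b s p"] diff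
      by (simp del: mult_pCons_left)
  next
    case False
    define g where "g = f \<circ>\<^sub>p [:b, 1:]"
    define E where "E = gauss_norm (ph_abs \<rho>) r g"
    obtain i where i: "E = ph_abs \<rho> (coeff g i) * r ^ i"
      using ph.gauss_norm_attained unfolding E_def by blast
    have fg: "f = (\<Sum>j\<le>degree g. [:coeff g j:] * [:- b, 1:] ^ j)"
      unfolding g_def by (rule poly_expansion)
    then have "g \<noteq> 0" using f by auto
    have le: "ph_abs \<rho> (coeff g j) * r ^ j \<le> E" for j
      unfolding E_def using \<open>0 < r\<close> by (intro ph.gauss_norm_ge) simp
    have "0 < ph_abs \<rho> (lead_coeff g) * r ^ degree g"
      using ph_abs_pos[of "lead_coeff g"] \<open>g \<noteq> 0\<close> \<open>0 < r\<close> by simp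
    then have "0 < E" using le[of "degree g"] by simp
    then have ci: "coeff g i \<noteq> 0" using i by auto
    have ne: "ph_abs \<rho> (coeff g j) * r ^ j \<noteq> ph_abs \<rho> (coeff g l) * r ^ l"
      if "j < l" "coeff g j \<noteq> 0" "coeff g l \<noteq> 0" for j l
    proof
      assume eq: "ph_abs \<rho> (coeff g j) * r ^ j = ph_abs \<rho> (coeff g l) * r ^ l"
      define n where "n = l - j"
      have n: "l = j + n" "n > 0" using that(1) unfolding n_def by auto
      obtain u where u: "r = \<rho> powr u" using powr_rho_surj \<open>0 < r\<close> by blast
      have "ph_abs \<rho> (coeff g j) = ph_abs \<rho> (coeff g l) * r ^ n"
        using eq \<open>0 < r\<close> unfolding n by (simp add: power_add)
      then have "radius (ph_ord (coeff g j)) = \<rho> powr (of_rat (ph_ord (coeff g l)) + u * real n)"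
        using that(2,3) rho_pos by (simp add: ph_abs_nonzero u powr_add powr_powr[symmetric] powr_realpow)
      then have "of_rat (ph_ord (coeff g j)) = of_rat (ph_ord (coeff g l)) + u * real n" by simp
      then have "u = of_rat ((ph_ord (coeff g j) - ph_ord (coeff g l)) / of_nat n)"
        using n(2) by (simp add: of_rat_divide of_rat_diff field_simps)
      then show False using False u by blast
    qed
    have strict: "ph_abs \<rho> (coeff g j) * r ^ j < E" if "j \<noteq> i" for j
    proof (cases "coeff g j = 0")
      case False
      then show ?thesis using le[of j] ne[of i j] ne[of j i] ci that unfolding i
        by (metis less_le linorder_neqE_nat)
    qed (simp add: \<open>0 < E\<close>)
    have val: "\<nu> ([:coeff g j:] * [:- b, 1:] ^ j) = ph_abs \<rho> (coeff g j) * r ^ j" for j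
      by (simp only: mult power r seminorm_const[OF \<nu>])
    have "\<nu> (\<Sum>j\<in>{..degree g} - {i}. [:coeff g j:] * [:- b, 1:] ^ j) < E"
      by (rule sum_less) (use strict \<open>0 < E\<close> in \<open>simp_all add: val del: mult_pCons_left\<close>)
    then have "\<nu> ([:coeff g i:] * [:- b, 1:] ^ i + (\<Sum>j\<in>{..degree g} - {i}. [:coeff g j:] * [:- b, 1:] ^ j)) = E"
      by (subst add_dominated) (simp_all only: val i)
    moreover have "i \<le> degree g" using ci le_degree by blast
    then have "[:coeff g i:] * [:- b, 1:] ^ i + (\<Sum>j\<in>{..degree g} - {i}. [:coeff g j:] * [:- b, 1:] ^ j) = f"
      by (subst fg) (rule sum.remove[symmetric], auto)
    ultimately show ?thesis unfolding E_def g_def by simp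
  qed
qed

lemma disk_seminorm_eq_gauss_norm:
  "0 < r \<Longrightarrow> disk_seminorm a r f
    = gauss_norm (ph_abs \<rho>) r (f \<circ>\<^sub>p [:a, 1:])" for a :: "'a::alg_closed_field puiseux_hat"
  by (rule centered_seminorm) (auto simp: disk_seminorm_linear)

lemma centered_seminorm_eq:
  fixes \<nu> :: "'a::alg_closed_field puiseux_hat poly \<Rightarrow> real"
  assumes "\<nu> \<in> seminorms" "\<nu> [:- b, 1:] = r" "\<And>c. r \<le> \<nu> [:- c, 1:]" "0 < r"
  shows "\<nu> = disk_seminorm b r"
  by (rule ext) (simp add: centered_seminorm[OF assms] disk_seminorm_eq_gauss_norm[OF assms(4)])

lemma flow_eq_disk_seminorm:
  fixes \<nu> :: "'a::alg_closed_field puiseux_hat poly \<Rightarrow> real"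
  assumes "\<nu> \<in> seminorms" "\<nu> [:- b, 1:] \<le> r" "0 < r"
  shows "flow r \<nu> = disk_seminorm b r"
  by (rule centered_seminorm_eq) (use assms in \<open>auto simp: flow_seminorm flow_linear\<close>)

lemma disk_seminorm_eq_iff:
  fixes a :: "'a::alg_closed_field puiseux_hat"
  assumes "0 < r"
  shows "disk_seminorm a r = disk_seminorm b r' \<longleftrightarrow> r = r' \<and> ph_abs \<rho> (a - b) \<le> r"
proof
  assume eq: "disk_seminorm a r = disk_seminorm b r'"
  show "r = r' \<and> ph_abs \<rho> (a - b) \<le> r"
    using fun_cong[OF eq, of "[:- a, 1:]"] fun_cong[OF eq, of "[:- b, 1:]"] assms
    by (auto simp: disk_seminorm_linear max_def split: if_splits)
next
  assume *: "r = r' \<and> ph_abs \<rho> (a - b) \<le> r"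
  then show "disk_seminorm a r = disk_seminorm b r'"
    using assms flow_eq_disk_seminorm[of "eval_norm a" b r] ph.uminus[of "a - b"]
    by (auto simp: eval_norm_def)
qed

definition disk_point :: "'a::field puiseux_hat \<Rightarrow> real \<Rightarrow> 'a berk" where
  "disk_point a r = Some (disk_seminorm a r)"

lemma disk_point_eq_iff:
  "0 < r \<Longrightarrow> disk_point a r = disk_point b r' \<longleftrightarrow> r = r' \<and> ph_abs \<rho> (a - b) \<le> r"
  for a b :: "'a::alg_closed_field puiseux_hat"
  by (simp add: disk_point_def disk_seminorm_eq_iff)

text \<open>
  As \<open>k\<close> is infinite, it has an element \<open>u\<close> that is not a root of the residue polynomial.  The maximum is
  attained at \<open>a + u x\<^sup>s\<close>.
\<close>

lemma disk_norm_eq_disk_point: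
  fixes a :: "'a::{alg_closed_field, field_char_0} puiseux_hat"
  shows "disk_norm \<rho> a (radius s) = disk_point a (radius s)"
proof -
  let ?r = "radius s"
  have "(SUP z \<in> {z. ph_abs \<rho> (z - a) \<le> ?r}. ph_abs \<rho> (poly f z)) = disk_seminorm a ?r f" for f
  proof (rule cSup_eq_maximum)
    fix y assume "y \<in> (\<lambda>z. ph_abs \<rho> (poly f z)) ` {z. ph_abs \<rho> (z - a) \<le> ?r}"
    then obtain z where z: "ph_abs \<rho> (z - a) \<le> ?r" "y = ph_abs \<rho> (poly f z)" by auto
    then show "y \<le> disk_seminorm a ?r f"
      using seminorm_expansion_le[of "eval_norm z" a ?r f]
      by (simp add: disk_seminorm_eq_gauss_norm eval_norm_def)
  next
    show "disk_seminorm a ?r f \<in> (\<lambda>z. ph_abs \<rho> (poly f z)) ` {z. ph_abs \<rho> (z - a) \<le> ?r}"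
    proof (cases "f = 0")
      case True
      then show ?thesis
        by (intro image_eqI[of _ _ a]) (simp_all add: flow_def taylor_def gauss_norm_def eval_norm_def)
    next
      case f: False
      obtain p e where p: "p \<noteq> 0" and E: "gauss_norm (ph_abs \<rho>) ?r (f \<circ>\<^sub>p [:a, 1:]) = radius e"
        and diff: "\<And>\<nu>. \<nu> \<in> seminorms \<Longrightarrow> \<nu> [:- a, 1:] \<le> ?r \<Longrightarrow>
           \<nu> (f - [:ph_monom 1 e:] * rescale a s p) < radius e"
        using residue_polynomial[OF f, of s a] by metis
      have "finite {u. poly p u = 0}" using p by (rule poly_roots_finite)
      then obtain u where u: "poly p u \<noteq> 0"
        using infinite_UNIV_char_0[where 'a='a] by (metis (mono_tags, lifting) UNIV_eq_I mem_Collect_eq)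
      define z where "z = a + ph_monom u s"
      have z: "ph_abs \<rho> (z - a) \<le> ?r" unfolding z_def by (cases "u = 0") (simp_all add: ph_abs_monom)
      have "poly (rescale a s q) z = ph_monom (poly q u) 0" for q
      proof (induction q)
        case (pCons c q)
        have W: "poly ([:ph_monom 1 (- s):] * [:- a, 1:]) z = ph_monom u 0"
          by (simp add: z_def ph_monom_mult algebra_simps)
        have R: "rescale a s (pCons c q) =
            [:ph_monom c 0:] + ([:ph_monom 1 (- s):] * [:- a, 1:]) * rescale a s q"
          unfolding rescale_def by (simp add: map_poly_pCons)
        have "poly (rescale a s (pCons c q)) z = ph_monom c 0 + ph_monom u 0 * ph_monom (poly q u) 0"
          unfolding R poly_add poly_mult[of _ "rescale a s q"] W pCons(2) by simp
        then show ?case by (simp add: ph_monom_add ph_monom_mult)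
      qed (simp add: rescale_def)
      then have "eval_norm z ([:ph_monom 1 e:] * rescale a s p) = radius e"
        using u by (simp add: eval_norm_def ph_monom_mult ph_abs_monom)
      moreover have "eval_norm z (f - [:ph_monom 1 e:] * rescale a s p) < radius e"
        by (rule diff[OF eval_norm_seminorm]) (use z in \<open>simp add: eval_norm_def\<close>)
      ultimately have "eval_norm z f = radius e"
        using mult_seminorm.add_dominated[OF seminorm_mult_seminorm[OF eval_norm_seminorm],
          of z "f - [:ph_monom 1 e:] * rescale a s p" "[:ph_monom 1 e:] * rescale a s p"]
        by (simp del: mult_pCons_left)
      then show ?thesis
        using z E by (intro image_eqI[of _ _ z]) (auto simp: disk_seminorm_eq_gauss_norm eval_norm_def)
    qed
  qed
  then show ?thesis by (auto simp: disk_norm_def disk_point_def)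
qed

lemma type_II_iff:
  "type_II \<rho> \<zeta> \<longleftrightarrow> (\<exists>a s. \<zeta> = disk_point a (radius s))"
  for \<zeta> :: "'a::{alg_closed_field, field_char_0} berk"
  by (simp add: type_II_def disk_norm_eq_disk_point)

lemma type_I_iff: "type_I \<rho> \<zeta> \<longleftrightarrow> \<zeta> = None \<or> (\<exists>a. \<zeta> = Some (eval_norm a))"
  by (simp add: type_I_def eval_norm_def[abs_def])

lemma eval_norm_ne_disk_seminorm: "0 < r \<Longrightarrow> eval_norm a \<noteq> disk_seminorm b r"
proof
  assume "0 < r" "eval_norm a = disk_seminorm b r"
  then have "eval_norm a [:- a, 1:] = max (ph_abs \<rho> (b - a)) r" by (simp add: disk_seminorm_linear)
  then show False using \<open>0 < r\<close> by (simp add: eval_norm_def)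
qed

lemma log_diam_disk_point:
  fixes a :: "'a::{alg_closed_field, field_char_0} puiseux_hat"
  shows "log_diam \<rho> (disk_point a (radius s)) = s"
  unfolding log_diam_def disk_norm_eq_disk_point
  by (rule the_equality) (auto simp: disk_point_eq_iff intro!: exI[of _ a])

section \<open>The topology of the line\<close>

abbreviation line :: "'a::field berk topology" where
  "line \<equiv> berk_line \<rho>"

lemma berk_line_eq: "line = Alexandroff_compactification (top_of_set seminorms)"
  by (simp add: berk_line_def euclidean_product_topology)

lemma topspace_line: "topspace line = insert None (Some ` seminorms)"
  by (simp add: berk_line_eq)

lemma closed_seminorms: "closed (seminorms :: ('a::field puiseux_hat poly \<Rightarrow> real) set)"
proof -
  have "seminorms = {\<nu>. \<forall>f. 0 \<le> \<nu> f} \<inter> {\<nu>. \<forall>f g. \<nu> (f + g) \<le> max (\<nu> f) (\<nu> g)}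
     \<inter> {\<nu>. \<forall>f g. \<nu> (f * g) = \<nu> f * \<nu> g} \<inter> {\<nu>. \<forall>c. \<nu> [:c :: 'a puiseux_hat:] = ph_abs \<rho> c}"
    unfolding berk_seminorms_def by auto
  then show ?thesis
    by (simp only:)
      (intro closed_Int closed_Collect_all closed_Collect_le closed_Collect_eq continuous_intros
        continuous_on_product_coordinates)
qed

definition open_disk :: "'a::field puiseux_hat \<Rightarrow> real \<Rightarrow> 'a berk set" where
  "open_disk c r = Some ` {\<nu> \<in> seminorms. \<nu> [:- c, 1:] < r}"

definition beyond :: "'a::field puiseux_hat \<Rightarrow> real \<Rightarrow> 'a berk set" where
  "beyond c r = insert None (Some ` {\<nu> \<in> seminorms. r < \<nu> [:- c, 1:]})"

lemma in_open_disk [simp]: "Some \<nu> \<in> open_disk c r \<longleftrightarrow> \<nu> \<in> seminorms \<and> \<nu> [:- c, 1:] < r"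
  "None \<notin> open_disk c r"
  by (auto simp: open_disk_def)

lemma in_beyond [simp]: "Some \<nu> \<in> beyond c r \<longleftrightarrow> \<nu> \<in> seminorms \<and> r < \<nu> [:- c, 1:]"
  "None \<in> beyond c r"
  by (auto simp: beyond_def)

lemma Some_in_line [simp]: "Some \<nu> \<in> topspace line \<longleftrightarrow> \<nu> \<in> seminorms" "None \<in> topspace line"
  by (auto simp: topspace_line)

lemma openin_open_disk: "openin line (open_disk c r)"
proof -
  have "open {\<nu> :: 'a puiseux_hat poly \<Rightarrow> real. \<nu> [:- c, 1:] < r}"
    by (intro open_Collect_less continuous_intros continuous_on_product_coordinates)
  then have "openin (top_of_set seminorms) (seminorms \<inter> {\<nu>. \<nu> [:- c, 1:] < r})"
    by (rule openin_open_Int)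
  moreover have "seminorms \<inter> {\<nu>. \<nu> [:- c, 1:] < r} = {\<nu> \<in> seminorms. \<nu> [:- c, 1:] < r}" by auto
  ultimately show ?thesis unfolding berk_line_eq open_disk_def by simp
qed

lemma closed_closed_disk: "closed {\<nu> \<in> seminorms. \<nu> [:- c, 1:] \<le> r}"
proof -
  have "closed {\<nu> :: 'a puiseux_hat poly \<Rightarrow> real. \<nu> [:- c, 1:] \<le> r}"
    by (intro closed_Collect_le continuous_intros continuous_on_product_coordinates)
  then have "closed (seminorms \<inter> {\<nu>. \<nu> [:- c, 1:] \<le> r})"
    using closed_seminorms by blast
  then show ?thesis by (simp add: Int_def)
qed

text \<open>
  The norm of the disk bounds the values of all its points, so that the disk is a closed subset of a
  product of compact intervals.
\<close>

lemma compact_closed_disk: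
  "compact {\<nu> \<in> seminorms. \<nu> [:- c, 1:] \<le> r}" (is "compact ?K")
proof -
  let ?B = "\<lambda>f. gauss_norm (ph_abs \<rho>) r (f \<circ>\<^sub>p [:c, 1:])"
  let ?P = "PiE UNIV (\<lambda>f. {0..?B f})"
  have "compactin (product_topology (\<lambda>f. euclidean) UNIV) ?P"
    by (simp add: compactin_PiE)
  then have "compact ?P" by (simp add: euclidean_product_topology)
  then have "compact (?P \<inter> ?K)" using closed_closed_disk by (rule compact_Int_closed)
  moreover have "?K \<subseteq> ?P"
    using seminorm_expansion_le mult_seminorm.nonneg[OF seminorm_mult_seminorm]
    by (auto simp: PiE_iff)
  then have "?P \<inter> ?K = ?K" by auto
  ultimately show ?thesis by simp
qed

lemma openin_beyond: "openin line (beyond c r)"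
proof -
  let ?K = "{\<nu> \<in> seminorms. \<nu> [:- c, 1:] \<le> r}"
  have "compactin (top_of_set seminorms) ?K"
    using compact_closed_disk[of c r] by (auto simp: compactin_subtopology)
  moreover have "closedin (top_of_set seminorms) ?K"
    by (rule closed_subset[OF _ closed_closed_disk]) auto
  moreover have "beyond c r = insert None (Some ` (topspace (top_of_set seminorms) - ?K))"
    unfolding beyond_def by auto
  ultimately show ?thesis
    unfolding berk_line_eq openin_Alexandroff_compactification by blast
qed

text \<open>
  The complement of a neighbourhood of infinity is compact, so that the distance to \<open>c\<close> is bounded on it.
\<close>

lemma neighbourhood_of_infinity:
  assumes "openin line V" "None \<in> V"
  obtains R where "beyond c R \<subseteq> V"
proof -
  obtain K where K: "compactin (top_of_set seminorms) K" "V = insert None (Some ` (seminorms - K))"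
    using assms unfolding berk_line_eq openin_Alexandroff_compactification by auto
  then have "compact K" by (simp add: compactin_subtopology)
  then have "compact ((\<lambda>\<nu>. \<nu> [:- c, 1:]) ` K)"
    by (intro compact_continuous_image continuous_on_subset[OF continuous_on_product_coordinates]) auto
  then have "bdd_above ((\<lambda>\<nu>. \<nu> [:- c, 1:]) ` K)"
    by (intro bounded_imp_bdd_above compact_imp_bounded)
  then obtain R where "\<And>\<nu>. \<nu> \<in> K \<Longrightarrow> \<nu> [:- c, 1:] \<le> R"
    unfolding bdd_above_def by auto
  then have "beyond c R \<subseteq> V" unfolding K(2) beyond_def by force
  then show thesis by (rule that)
qed

lemma flow_continuous_map:
  assumes "\<nu> \<in> seminorms" "T \<subseteq> {0..}"
  shows "continuous_map (top_of_set T) line (\<lambda>t. Some (flow t \<nu>))"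
proof -
  have "continuous_map (top_of_set T) (top_of_set seminorms) (\<lambda>t. flow t \<nu>)"
    using assms continuous_flow[OF assms(1), of T] flow_seminorm[OF assms(1)] by auto
  from continuous_map_compose[OF this continuous_map_Some] show ?thesis
    by (simp add: o_def berk_line_eq)
qed

lemma connectedin_flow:
  assumes "\<nu> \<in> seminorms" "T \<subseteq> {0..}" "connected T"
  shows "connectedin line ((\<lambda>t. Some (flow t \<nu>)) ` T)"
  using assms
  by (intro connectedin_continuous_map_image[OF flow_continuous_map[OF assms(1,2)]])
    (simp add: connectedin_subtopology)

text \<open>
  Infinity is in the closure of a flow line, along which the distance to 0 is unbounded.
\<close>

lemma connectedin_ray:
  fixes \<nu> :: "'a::field puiseux_hat poly \<Rightarrow> real"
  assumes "\<nu> \<in> seminorms"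
  shows "connectedin line (insert None ((\<lambda>t. Some (flow t \<nu>)) ` {0..}))" (is "connectedin _ (insert _ ?R)")
proof (rule connectedin_intermediate_closure_of)
  show conn: "connectedin line ?R"
    using assms by (intro connectedin_flow) (auto intro: convex_connected)
  have "None \<in> line closure_of ?R"
    unfolding in_closure_of
  proof (intro conjI allI impI)
    fix V :: "'a berk set" assume "None \<in> V \<and> openin line V"
    then obtain R where R: "beyond 0 R \<subseteq> V" using neighbourhood_of_infinity by blast
    let ?t = "max 0 (R + 1)"
    have "Some (flow ?t \<nu>) \<in> beyond 0 R"
      using assms flow_linear[OF assms, of ?t 0] by (simp add: flow_seminorm)
    then show "\<exists>y. y \<in> ?R \<and> y \<in> V" using R by (intro exI[of _ "Some (flow ?t \<nu>)"]) auto
  qed simp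
  then show "insert None ?R \<subseteq> line closure_of ?R"
    using closure_of_subset[OF connectedin_subset_topspace[OF conn]] by auto
qed auto

definition beyond_all :: "('a::field puiseux_hat \<times> real) set \<Rightarrow> 'a berk set" where
  "beyond_all S = topspace line \<inter> (\<Inter>(c, r)\<in>S. beyond c r)"

lemma in_beyond_all [simp]:
  "Some \<nu> \<in> beyond_all S \<longleftrightarrow> \<nu> \<in> seminorms \<and> (\<forall>(c, r)\<in>S. r < \<nu> [:- c, 1:])"
  "None \<in> beyond_all S"
  by (auto simp: beyond_all_def)

lemma openin_beyond_all: "finite S \<Longrightarrow> openin line (beyond_all S)"
proof (induction S rule: finite_induct)
  case (insert p S)
  have "beyond_all (insert p S) = beyond (fst p) (snd p) \<inter> beyond_all S"
    by (auto simp: beyond_all_def split: prod.splits)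
  then show ?case using insert openin_beyond[of "fst p" "snd p"] by (simp add: openin_Int)
qed (simp add: beyond_all_def)

lemma flow_beyond_all: "Some \<nu> \<in> beyond_all S \<Longrightarrow> 0 \<le> t \<Longrightarrow> Some (flow t \<nu>) \<in> beyond_all S"
  by (auto simp: flow_seminorm flow_linear less_max_iff_disj split: prod.splits)

text \<open>
  The flow carries every point to infinity, and it never decreases the distance to a centre.
\<close>

lemma connectedin_beyond_all: "connectedin line (beyond_all S)"
proof -
  let ?ray = "\<lambda>\<nu>. insert None ((\<lambda>t. Some (flow t \<nu>)) ` {0..})"
  let ?\<U> = "insert {None} (?ray ` {\<nu>. Some \<nu> \<in> beyond_all S})"
  have "connectedin line (\<Union>?\<U>)"
    by (rule connectedin_Union) (auto intro!: connectedin_ray)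
  also have "\<Union>?\<U> = beyond_all S"
  proof
    show "\<Union>?\<U> \<subseteq> beyond_all S" using flow_beyond_all by (auto simp del: in_beyond_all(1))
    show "beyond_all S \<subseteq> \<Union>?\<U>"
    proof
      fix \<zeta> assume \<zeta>: "\<zeta> \<in> beyond_all S"
      show "\<zeta> \<in> \<Union>?\<U>"
      proof (cases \<zeta>)
        case (Some \<nu>)
        then have "\<zeta> = Some (flow 0 \<nu>)" using \<zeta> by (simp add: flow_0)
        then have "\<zeta> \<in> ?ray \<nu>" by auto
        then show ?thesis using \<zeta> Some by auto
      qed simp
    qed
  qed
  finally show ?thesis .
qed

text \<open>
  Before the flow leaves the open disk, it has brought any two points of the disk to the same \<open>\<zeta>(c,t)\<close>.
\<close>

lemma connectedin_beyond_all_Int_open_disk: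
  fixes c :: "'a::alg_closed_field puiseux_hat"
  shows "connectedin line (beyond_all S \<inter> open_disk c r)" (is "connectedin _ ?W")
proof (cases "?W = {}")
  case False
  then obtain \<nu> where \<nu>: "Some \<nu> \<in> ?W" by (metis all_not_in_conv IntE in_open_disk(2) not_None_eq)
  let ?seg = "\<lambda>\<nu>. (\<lambda>t. Some (flow t \<nu>)) ` {0..<r}"
  have mem: "\<mu> \<in> seminorms" "\<mu> [:- c, 1:] < r" "0 \<le> \<mu> [:- c, 1:]" if "Some \<mu> \<in> ?W" for \<mu>
    using that mult_seminorm.nonneg[OF seminorm_mult_seminorm] by auto
  have conn: "connectedin line (?seg \<mu>)" if "Some \<mu> \<in> ?W" for \<mu>
    using mem[OF that] by (intro connectedin_flow) (auto intro: convex_connected)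
  have start: "Some \<mu> \<in> ?seg \<mu>" if "Some \<mu> \<in> ?W" for \<mu>
    using mem[OF that] by (intro image_eqI[of _ _ 0]) (auto simp: flow_0)
  have sub: "?seg \<mu> \<subseteq> ?W" if "Some \<mu> \<in> ?W" for \<mu>
    using that mem[OF that] flow_beyond_all[of \<mu> S] by (auto simp: flow_seminorm flow_linear)
  have meet: "?seg \<mu> \<inter> ?seg \<nu> \<noteq> {}" if \<mu>: "Some \<mu> \<in> ?W" for \<mu>
  proof -
    define t where "t = (r + max (\<mu> [:- c, 1:]) (\<nu> [:- c, 1:])) / 2"
    have t: "\<mu> [:- c, 1:] \<le> t" "\<nu> [:- c, 1:] \<le> t" "0 < t" "t < r"
      using mem[OF \<mu>] mem[OF \<nu>] unfolding t_def by auto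
    then have "flow t \<mu> = flow t \<nu>"
      using mem(1)[OF \<mu>] mem(1)[OF \<nu>] by (simp add: flow_eq_disk_seminorm)
    moreover have "t \<in> {0..<r}" using t by simp
    ultimately have "Some (flow t \<mu>) \<in> ?seg \<mu> \<inter> ?seg \<nu>" by (metis IntI imageI)
    then show ?thesis by blast
  qed
  let ?\<U> = "(\<lambda>\<mu>. ?seg \<mu> \<union> ?seg \<nu>) ` {\<mu>. Some \<mu> \<in> ?W}"
  have "connectedin line (\<Union>?\<U>)"
  proof (rule connectedin_Union)
    show "\<Inter>?\<U> \<noteq> {}" using start[OF \<nu>] by blast
  qed (use conn \<nu> meet in \<open>auto intro!: connectedin_Un\<close>)
  also have "\<Union>?\<U> = ?W"
  proof
    show "\<Union>?\<U> \<subseteq> ?W" using sub \<nu> by blast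
    show "?W \<subseteq> \<Union>?\<U>"
    proof
      fix \<zeta> assume \<zeta>: "\<zeta> \<in> ?W"
      then obtain \<mu> where "\<zeta> = Some \<mu>" by (metis IntE in_open_disk(2) not_None_eq)
      then show "\<zeta> \<in> \<Union>?\<U>" using \<zeta> start by blast
    qed
  qed
  finally show ?thesis .
qed auto

lemma connectedin_open_disk: "connectedin line (open_disk c r)"
  for c :: "'a::alg_closed_field puiseux_hat"
  using connectedin_beyond_all_Int_open_disk[of "{}" c r] openin_subset[OF openin_open_disk[of c r]]
  by (simp add: beyond_all_def Int_absorb1)

lemma seminorm_center_le:
  assumes "\<nu> \<in> seminorms"
  shows "\<nu> [:- c, 1:] \<le> max (\<nu> [:- d, 1:]) (ph_abs \<rho> (c - d))"
    "ph_abs \<rho> (c - d) \<le> max (\<nu> [:- c, 1:]) (\<nu> [:- d, 1:])"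
proof -
  interpret mult_seminorm \<nu> by (rule seminorm_mult_seminorm[OF assms])
  show "\<nu> [:- c, 1:] \<le> max (\<nu> [:- d, 1:]) (ph_abs \<rho> (c - d))"
    using diff_le[of "[:- d, 1:]" "[:c - d:]"] by (simp add: seminorm_const[OF assms])
  show "ph_abs \<rho> (c - d) \<le> max (\<nu> [:- c, 1:]) (\<nu> [:- d, 1:])"
    using diff_le[of "[:- d, 1:]" "[:- c, 1:]"] by (simp add: seminorm_const[OF assms] max.commute)
qed

lemma ph_abs_commute: "ph_abs \<rho> (c - d) = ph_abs \<rho> (d - c)" for c :: "'a::field puiseux_hat"
  using ph.uminus[of "c - d"] by simp

lemma open_disk_mono:
  assumes "ph_abs \<rho> (c - d) < R" "r \<le> R"
  shows "open_disk c r \<subseteq> open_disk d R"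
proof
  fix \<zeta> assume \<zeta>: "\<zeta> \<in> open_disk c r"
  then obtain \<nu> where \<nu>: "\<zeta> = Some \<nu>" "\<nu> \<in> seminorms" "\<nu> [:- c, 1:] < r" by (cases \<zeta>) auto
  then show "\<zeta> \<in> open_disk d R"
    using seminorm_center_le(1)[OF \<nu>(2), of d c] assms ph_abs_commute[of c d] by simp
qed

lemma open_disk_nested:
  assumes "\<zeta> \<in> open_disk c r" "\<zeta> \<in> open_disk d R" "r \<le> R"
  shows "open_disk c r \<subseteq> open_disk d R"
proof -
  obtain \<nu> where \<nu>: "\<nu> \<in> seminorms" "\<nu> [:- c, 1:] < r" "\<nu> [:- d, 1:] < R"
    using assms by (cases \<zeta>) auto
  then show ?thesis
    using seminorm_center_le(2)[OF \<nu>(1), of c d] assms(3) by (intro open_disk_mono) auto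
qed

text \<open>
  A point in none of the directions at \<open>\<zeta>(a,r)\<close> has distance \<open>r\<close> to \<open>a\<close> and at least \<open>r\<close> to every element of
  the field, so that it is \<open>\<zeta>(a,r)\<close> itself.
\<close>

lemma directions_at_disk_point:
  fixes a :: "'a::alg_closed_field puiseux_hat"
  assumes "0 < r" "\<zeta> \<in> topspace line" "\<zeta> \<noteq> disk_point a r"
  shows "\<zeta> \<in> beyond a r \<or> (\<exists>c. ph_abs \<rho> (c - a) \<le> r \<and> \<zeta> \<in> open_disk c r)"
proof (rule ccontr)
  assume not: "\<not> ?thesis"
  then obtain \<nu> where \<zeta>: "\<zeta> = Some \<nu>" by (cases \<zeta>) auto
  then have \<nu>: "\<nu> \<in> seminorms" using assms(2) by simp
  then have le: "\<nu> [:- a, 1:] \<le> r" and ge: "r \<le> \<nu> [:- c, 1:]" if "ph_abs \<rho> (c - a) \<le> r" for c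
    using not that by (auto simp: \<zeta>)
  have "\<nu> [:- a, 1:] = r" using le[of a] ge[of a] \<open>0 < r\<close> by simp
  moreover have "r \<le> \<nu> [:- c, 1:]" for c
    using ge[of c] seminorm_center_le(2)[OF \<nu>, of c a] \<open>\<nu> [:- a, 1:] = r\<close> by fastforce
  ultimately have "\<nu> = disk_seminorm a r" using \<nu> assms(1) by (intro centered_seminorm_eq)
  then show False using assms(3) by (simp add: \<zeta> disk_point_def)
qed

lemma beyond_disjoint_open_disk:
  assumes "ph_abs \<rho> (c - a) \<le> r"
  shows "beyond a r \<inter> open_disk c r = {}"
proof -
  have False if "\<nu> \<in> seminorms" "r < \<nu> [:- a, 1:]" "\<nu> [:- c, 1:] < r" for \<nu>
    using seminorm_center_le(1)[OF that(1), of a c] that assms ph_abs_commute[of c a] by simp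
  then show ?thesis by (fastforce simp: beyond_def open_disk_def)
qed

text \<open>
  The directions at \<open>\<zeta>(a,r)\<close> are open and pairwise disjoint.
\<close>

lemma connected_in_one_direction:
  fixes a :: "'a::alg_closed_field puiseux_hat"
  assumes "0 < r" "connectedin line C" "disk_point a r \<notin> C"
  obtains "C \<subseteq> beyond a r" | c where "ph_abs \<rho> (c - a) \<le> r" "C \<subseteq> open_disk c r"
proof -
  have C: "C \<subseteq> topspace line" by (rule connectedin_subset_topspace[OF assms(2)])
  have dir: "\<zeta> \<in> beyond a r \<or> (\<exists>c. ph_abs \<rho> (c - a) \<le> r \<and> \<zeta> \<in> open_disk c r)" if "\<zeta> \<in> C" for \<zeta>
    by (rule directions_at_disk_point[OF assms(1)]) (use that assms(3) C in auto)
  define D where "D = (\<lambda>c. open_disk c r) ` {c. ph_abs \<rho> (c - a) \<le> r}"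
  have split: "C \<subseteq> E1 \<or> C \<inter> E1 = {}"
    if "openin line E1" "openin line E2" "C \<subseteq> E1 \<union> E2" "E1 \<inter> E2 = {}" for E1 E2
    using assms(2) that unfolding connectedin by blast
  have "C \<subseteq> beyond a r \<or> C \<inter> beyond a r = {}"
  proof (rule split)
    show "openin line (\<Union>D)" unfolding D_def by (auto intro!: openin_Union openin_open_disk)
    show "C \<subseteq> beyond a r \<union> \<Union>D" using dir unfolding D_def by blast
    show "beyond a r \<inter> \<Union>D = {}" unfolding D_def using beyond_disjoint_open_disk by blast
  qed (rule openin_beyond)
  moreover have "C \<subseteq> beyond a r" if "C = {}" using that by simp
  moreover have "\<exists>c. ph_abs \<rho> (c - a) \<le> r \<and> C \<subseteq> open_disk c r"
    if \<zeta>: "\<zeta> \<in> C" and C0: "C \<inter> beyond a r = {}" for \<zeta>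
  proof -
    obtain c where c: "ph_abs \<rho> (c - a) \<le> r" "\<zeta> \<in> open_disk c r" using dir[OF \<zeta>] \<zeta> C0 by blast
    let ?E = "\<Union>(D - {open_disk c r})"
    have "C \<subseteq> open_disk c r \<or> C \<inter> open_disk c r = {}"
    proof (rule split)
      show "openin line ?E" unfolding D_def by (auto intro!: openin_Union openin_open_disk)
      show "C \<subseteq> open_disk c r \<union> ?E" using dir C0 unfolding D_def by blast
      show "open_disk c r \<inter> ?E = {}" unfolding D_def using open_disk_nested by fast
    qed (rule openin_open_disk)
    then show ?thesis using c \<zeta> by blast
  qed
  ultimately show thesis using that by blast
qed

section \<open>Domains of a vertex set\<close>

text \<open>
  Among the directions at the points of \<open>\<Gamma>\<close> that contain \<open>\<xi>\<close>, the open disks are nested.  Therefore the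
  intersection of these directions has one of the two shapes that are known to be connected.
\<close>

lemma connected_neighbourhood:
  fixes \<Gamma> :: "'a::alg_closed_field berk set"
  assumes "finite \<Gamma>" "\<And>\<gamma>. \<gamma> \<in> \<Gamma> \<Longrightarrow> \<exists>a r. 0 < r \<and> \<gamma> = disk_point a r" "\<xi> \<in> topspace line" "\<xi> \<notin> \<Gamma>"
  shows "\<exists>N. openin line N \<and> connectedin line N \<and> \<xi> \<in> N \<and> N \<inter> \<Gamma> = {}"
proof -
  have "\<exists>S. finite S \<and> (\<exists>N. (N = beyond_all S \<or> (\<exists>c R. N = beyond_all S \<inter> open_disk c R)) \<and> \<xi> \<in> N \<and> N \<inter> \<Gamma> = {})"
    using assms
  proof (induction \<Gamma> rule: finite_induct)
    case empty
    then show ?case by (intro exI[of _ "{}"]) (auto simp: beyond_all_def)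
  next
    case (insert \<gamma> \<Gamma>)
    then obtain S N where S: "finite S" and N: "N = beyond_all S \<or> (\<exists>c R. N = beyond_all S \<inter> open_disk c R)"
      and \<xi>: "\<xi> \<in> N" and disj: "N \<inter> \<Gamma> = {}" by auto
    obtain a r where r: "0 < r" and \<gamma>: "\<gamma> = disk_point a r" using insert.prems(1) by blast
    have "\<xi> \<in> beyond a r \<or> (\<exists>c. ph_abs \<rho> (c - a) \<le> r \<and> \<xi> \<in> open_disk c r)"
      by (rule directions_at_disk_point[OF r]) (use insert.prems \<gamma> in auto)
    then show ?case
    proof (elim disjE exE conjE)
      assume out: "\<xi> \<in> beyond a r"
      have eq: "beyond_all (insert (a, r) S) = beyond a r \<inter> beyond_all S"
        by (auto simp: beyond_all_def)
      have "\<gamma> \<notin> beyond a r" using r by (simp add: \<gamma> disk_point_def disk_seminorm_linear)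
      then have "\<xi> \<in> beyond a r \<inter> N" "(beyond a r \<inter> N) \<inter> insert \<gamma> \<Gamma> = {}" using out \<xi> disj by auto
      moreover have "beyond a r \<inter> N = beyond_all (insert (a, r) S) \<or>
          (\<exists>c R. beyond a r \<inter> N = beyond_all (insert (a, r) S) \<inter> open_disk c R)"
        using N unfolding eq by blast
      ultimately show ?thesis using S by (intro exI[of _ "insert (a, r) S"]) blast
    next
      fix c assume c: "ph_abs \<rho> (c - a) \<le> r" "\<xi> \<in> open_disk c r"
      have \<gamma>c: "\<gamma> \<notin> open_disk c r" by (simp add: \<gamma> disk_point_def disk_seminorm_linear)
      show ?thesis using N
      proof (elim disjE exE)
        assume N: "N = beyond_all S"
        show ?thesis using S N \<xi> disj c \<gamma>c
          by (intro exI[of _ S] conjI exI[of _ "beyond_all S \<inter> open_disk c r"]) auto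
      next
        fix d R assume N: "N = beyond_all S \<inter> open_disk d R"
        show ?thesis
        proof (cases "r \<le> R")
          case True
          then have "open_disk c r \<subseteq> open_disk d R" using c \<xi> N open_disk_nested by blast
          then have "(beyond_all S \<inter> open_disk c r) \<inter> insert \<gamma> \<Gamma> = {}" using disj N \<gamma>c by blast
          then show ?thesis using S N \<xi> c
            by (intro exI[of _ S] conjI exI[of _ "beyond_all S \<inter> open_disk c r"]) auto
        next
          case False
          then have "open_disk d R \<subseteq> open_disk c r" using c \<xi> N open_disk_nested[of \<xi> d R c r] by auto
          then have "N \<inter> insert \<gamma> \<Gamma> = {}" using disj N \<gamma>c by blast
          then show ?thesis using S N \<xi> by blast
        qed
      qed
    qed
  qed
  then show ?thesis
    using connectedin_beyond_all connectedin_beyond_all_Int_open_disk openin_beyond_all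
      openin_open_disk openin_Int by metis
qed

lemma vertex_set_disk_points:
  fixes \<Gamma> :: "'a::{alg_closed_field, field_char_0} berk set"
  assumes "vertex_set \<rho> \<Gamma>" "\<gamma> \<in> \<Gamma>"
  obtains a s where "\<gamma> = disk_point a (radius s)"
  using assms unfolding vertex_set_def type_II_iff by blast

text \<open>
  Connected neighbourhoods make the components of the complement of \<open>\<Gamma>\<close> open, so that no point off \<open>\<Gamma>\<close> is
  in the frontier of a component.
\<close>

lemma berk_domain_properties:
  fixes \<Gamma> :: "'a::{alg_closed_field, field_char_0} berk set"
  assumes \<Gamma>: "vertex_set \<rho> \<Gamma>" and U: "U \<in> berk_domains \<rho> \<Gamma>"
  shows "connectedin line U" "U \<noteq> {}" "U \<inter> \<Gamma> = {}" "line frontier_of U \<subseteq> \<Gamma>"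
proof -
  let ?Y = "subtopology line (topspace line - \<Gamma>)"
  have U: "U \<in> connected_components_of ?Y" using U by (simp add: berk_domains_def)
  have "connectedin ?Y U" using U by (rule connectedin_connected_components_of)
  then show conn: "connectedin line U" and disj: "U \<inter> \<Gamma> = {}" by (auto simp: connectedin_subtopology)
  show "U \<noteq> {}" using U by (rule nonempty_connected_components_of)
  have dp: "\<exists>a r. 0 < r \<and> \<gamma> = disk_point a r" if "\<gamma> \<in> \<Gamma>" for \<gamma>
    using vertex_set_disk_points[OF \<Gamma> that] by (metis powr_rho_pos)
  have nb: "\<exists>N. openin line N \<and> connectedin line N \<and> \<xi> \<in> N \<and> N \<inter> \<Gamma> = {}"
    if "\<xi> \<in> topspace line" "\<xi> \<notin> \<Gamma>" for \<xi>
    using \<Gamma> dp that by (intro connected_neighbourhood) (auto simp: vertex_set_def)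
  have absorb: "N \<subseteq> U" if "connectedin line N" "N \<inter> \<Gamma> = {}" "N \<inter> U \<noteq> {}" for N
  proof (rule connected_components_of_maximal[OF U])
    show "connectedin ?Y N"
      using that connectedin_subset_topspace[OF that(1)] by (auto simp: connectedin_subtopology)
    show "\<not> disjnt U N" using that(3) by (auto simp: disjnt_def)
  qed
  show "line frontier_of U \<subseteq> \<Gamma>"
  proof
    fix \<xi> assume \<xi>: "\<xi> \<in> line frontier_of U"
    show "\<xi> \<in> \<Gamma>"
    proof (rule ccontr)
      assume "\<xi> \<notin> \<Gamma>"
      moreover have "\<xi> \<in> topspace line" by (rule subsetD[OF frontier_of_subset_topspace \<xi>])
      ultimately obtain N where N: "openin line N" "connectedin line N" "\<xi> \<in> N" "N \<inter> \<Gamma> = {}"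
        using nb by blast
      have "\<xi> \<in> line closure_of U" using \<xi> by (simp add: frontier_of_def)
      then have "N \<inter> U \<noteq> {}" using N(1,3) unfolding in_closure_of by blast
      then have "N \<subseteq> U" using absorb N by blast
      then have "\<xi> \<in> line interior_of U" using N interior_of_maximal by blast
      then show False using \<xi> by (simp add: frontier_of_def)
    qed
  qed
qed

lemma connected_subset_of_domain:
  assumes "connectedin line C" "C \<inter> line frontier_of U = {}" "C \<inter> U \<noteq> {}"
  shows "C \<subseteq> U"
  using connectedin_Int_frontier_of[OF assms(1,3)] assms(2) by blast

end

section \<open>Denominators\<close>

definition denom :: "rat \<Rightarrow> nat" where
  "denom q = nat (snd (quotient_of q))"

lemma denom_pos [simp]: "0 < denom q"
  using quotient_of_denom_pos'[of q] by (simp add: denom_def)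

lemma Ints_mult_iff_denom_dvd: "of_nat n * q \<in> \<int> \<longleftrightarrow> denom q dvd n"
proof -
  obtain a b where ab: "quotient_of q = (a, b)" by (cases "quotient_of q")
  have b: "0 < b" using quotient_of_denom_pos[OF ab] .
  have q: "q = of_int a / of_int b" using quotient_of_div[OF ab] .
  have d: "int (denom q) = b" using ab b by (simp add: denom_def)
  have "of_nat n * q \<in> \<int> \<longleftrightarrow> (\<exists>k. of_int (int n * a) = (of_int (k * b) :: rat))"
    using b unfolding q by (auto simp: Ints_def field_simps)
  also have "\<dots> \<longleftrightarrow> b dvd int n * a" by (simp only: of_int_eq_iff dvd_def mult.commute)
  also have "\<dots> \<longleftrightarrow> b dvd int n"
    using quotient_of_coprime[OF ab] by (simp add: coprime_commute coprime_dvd_mult_left_iff)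
  finally show ?thesis unfolding d[symmetric] by (simp only: int_dvd_int_iff)
qed

lemma denom_dvdE:
  assumes "denom q dvd n" "0 < n"
  obtains i where "q = of_int i / of_nat n"
  using assms rat_frac_cases[of n q] Ints_mult_iff_denom_dvd by metis

lemma denom_of_int_div_dvd: "0 < n \<Longrightarrow> denom (of_int i / of_nat n) dvd n"
  by (simp add: Ints_mult_iff_denom_dvd[symmetric])


section \<open>The Galois group\<close>

lemma puiseux_galD:
  assumes "\<sigma> \<in> puiseux_gal"
  shows "bij \<sigma>" "\<sigma> (a + b) = \<sigma> a + \<sigma> b" "\<sigma> (a * b) = \<sigma> a * \<sigma> b" "ph_ord (\<sigma> a) = ph_ord a"
    "\<sigma> ` puiseux = puiseux" "\<sigma> (of_fls 1 F) = of_fls 1 F" "\<sigma> 0 = 0" "\<sigma> (- a) = - \<sigma> a"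
    "\<sigma> (a - b) = \<sigma> a - \<sigma> b" "\<sigma> a = 0 \<longleftrightarrow> a = 0"
proof -
  show bij: "bij \<sigma>" and add: "\<And>a b. \<sigma> (a + b) = \<sigma> a + \<sigma> b" "\<sigma> (a * b) = \<sigma> a * \<sigma> b" "ph_ord (\<sigma> a) = ph_ord a"
    "\<sigma> ` puiseux = puiseux" "\<sigma> (of_fls 1 F) = of_fls 1 F"
    using assms unfolding puiseux_gal_def by auto
  show z: "\<sigma> 0 = 0" using add(1)[of 0 0] by (metis add.right_neutral add_left_cancel)
  show m: "\<sigma> (- a) = - \<sigma> a" for a using add(1)[of a "- a"] z by (simp add: eq_neg_iff_add_eq_0 add.commute)
  show "\<sigma> (a - b) = \<sigma> a - \<sigma> b" using add(1)[of a "- b"] m[of b] by simp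
  show "\<sigma> a = 0 \<longleftrightarrow> a = 0" using z bij_is_inj[OF bij] by (metis injD)
qed

lemma id_puiseux_gal [simp]: "id \<in> puiseux_gal"
  by (simp add: puiseux_gal_def)

lemma comp_puiseux_gal:
  assumes "\<sigma> \<in> puiseux_gal" "\<tau> \<in> puiseux_gal"
  shows "\<sigma> \<circ> \<tau> \<in> puiseux_gal"
proof -
  have "(\<sigma> \<circ> \<tau>) ` puiseux = puiseux"
    by (simp only: image_comp[symmetric] puiseux_galD(5)[OF assms(1)] puiseux_galD(5)[OF assms(2)])
  then show ?thesis
    using puiseux_galD(1-4,6)[OF assms(1)] puiseux_galD(1-4,6)[OF assms(2)]
    unfolding puiseux_gal_def by (auto simp: bij_comp simp del: One_nat_def)
qed

lemma inv_puiseux_gal: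
  assumes "\<sigma> \<in> puiseux_gal"
  shows "inv \<sigma> \<in> puiseux_gal"
proof -
  note bij = puiseux_galD(1)[OF assms]
  have s: "\<sigma> (inv \<sigma> a) = a" and l: "inv \<sigma> (\<sigma> a) = a" for a
    using bij by (simp_all add: bij_is_surj surj_f_inv_f bij_is_inj)
  have "inv \<sigma> (a + b) = inv \<sigma> a + inv \<sigma> b" "inv \<sigma> (a * b) = inv \<sigma> a * inv \<sigma> b" for a b
    using puiseux_galD(2,3)[OF assms, of "inv \<sigma> a" "inv \<sigma> b"] s l by metis+
  moreover have "ph_ord (inv \<sigma> a) = ph_ord a" for a
    using puiseux_galD(4)[OF assms, of "inv \<sigma> a"] s by simp
  moreover have "inv \<sigma> ` puiseux = puiseux"
    using puiseux_galD(5)[OF assms] bij by (metis bij_is_inj image_inv_f_f)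
  moreover have "inv \<sigma> a = a" if "a \<in> range (of_fls 1)" for a
    using puiseux_galD(6)[OF assms] that l by (metis imageE)
  ultimately show ?thesis using bij by (simp add: puiseux_gal_def bij_imp_bij_inv)
qed

lemma puiseux_gal_inv [simp]:
  assumes "\<sigma> \<in> puiseux_gal"
  shows "\<sigma> (inv \<sigma> a) = a" "inv \<sigma> (\<sigma> a) = a"
  using puiseux_galD(1)[OF assms] by (simp_all add: bij_is_surj surj_f_inv_f bij_is_inj)

lemma puiseux_iff: "f \<in> puiseux \<longleftrightarrow> (\<exists>n>0. \<forall>q. ph_nth f q \<noteq> 0 \<longrightarrow> of_nat n * q \<in> \<int>)"
proof
  assume "f \<in> puiseux"
  then obtain n F where "n \<ge> 1" "f = of_fls n F" unfolding puiseux_def by auto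
  then show "\<exists>n>0. \<forall>q. ph_nth f q \<noteq> 0 \<longrightarrow> of_nat n * q \<in> \<int>"
    using ph_nth_of_fls(2) by (intro exI[of _ n]) auto
next
  assume "\<exists>n>0. \<forall>q. ph_nth f q \<noteq> 0 \<longrightarrow> of_nat n * q \<in> \<int>"
  then obtain n where n: "n > 0" "\<And>q. ph_nth f q \<noteq> 0 \<Longrightarrow> of_nat n * q \<in> \<int>" by blast
  obtain a where a: "\<And>q. ph_nth f q \<noteq> 0 \<Longrightarrow> a \<le> q" using ph_bounded_below by blast
  let ?c = "\<lambda>i. ph_nth f (of_int i / of_nat n)"
  have "?c i = 0" if "i < \<lfloor>of_nat n * a\<rfloor>" for i
  proof -
    have "of_int i < of_nat n * a" using that by linarith
    then have "\<not> a \<le> of_int i / of_nat n" using n(1) by (simp add: field_simps)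
    then show ?thesis using a by auto
  qed
  then have "fls_nth (Abs_fls ?c) i = ?c i" for i
    by (intro nth_Abs_fls_lower_bound[of "\<lfloor>of_nat n * a\<rfloor>"]) auto
  then have "of_fls n (Abs_fls ?c) = f" using n by (intro of_fls_eqI) auto
  moreover have "n \<in> {1..}" using n(1) by simp
  ultimately show "f \<in> puiseux" unfolding puiseux_def by (metis UN_I rangeI)
qed

text \<open>
  The automorphism \<open>x\<^sup>q \<mapsto> \<psi>(q) x\<^sup>q\<close>, for a character \<open>\<psi>\<close> of the rational numbers that is trivial on the
  integers.
\<close>

lift_definition ph_twist :: "(rat \<Rightarrow> 'a::field) \<Rightarrow> 'a puiseux_hat \<Rightarrow> 'a puiseux_hat"
  is "\<lambda>\<psi> f q. \<psi> q * f q"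
proof -
  fix \<psi> f :: "rat \<Rightarrow> 'a" and r
  assume "\<And>r. finite {q. q \<le> r \<and> f q \<noteq> 0}"
  then show "finite {q. q \<le> r \<and> \<psi> q * f q \<noteq> 0}"
    by (rule finite_subset[rotated]) auto
qed

lemma ph_nth_twist: "ph_nth (ph_twist \<psi> f) q = \<psi> q * ph_nth f q"
  by transfer simp

lemma ph_twist_puiseux_gal:
  assumes add: "\<And>p q. \<psi> (p + q) = \<psi> p * \<psi> q" and int: "\<And>i. \<psi> (of_int i) = 1"
  shows "ph_twist \<psi> \<in> puiseux_gal"
proof -
  have nz: "\<psi> q \<noteq> 0" for q
    using add[of q "- q"] int[of 0] by auto
  let ?i = "ph_twist (\<lambda>q. inverse (\<psi> q))"
  have inv1: "ph_twist \<psi> (?i f) = f" and inv2: "?i (ph_twist \<psi> f) = f" for f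
    by (rule ph_eqI; simp add: ph_nth_twist nz)+
  have supp: "ph_nth (ph_twist \<psi> f) q \<noteq> 0 \<longleftrightarrow> ph_nth f q \<noteq> 0"
    "ph_nth (?i f) q \<noteq> 0 \<longleftrightarrow> ph_nth f q \<noteq> 0" for f q
    by (simp_all add: ph_nth_twist nz)
  have "bij (ph_twist \<psi>)" by (rule bijI'[OF _ _]) (metis inv2, metis inv1)
  moreover have "ph_twist \<psi> (f * g) = ph_twist \<psi> f * ph_twist \<psi> g" for f g
  proof (rule ph_eqI)
    fix q
    have "ph_nth (ph_twist \<psi> f * ph_twist \<psi> g) q
      = (\<Sum>s | ph_nth f s \<noteq> 0 \<and> ph_nth g (q - s) \<noteq> 0. \<psi> s * ph_nth f s * (\<psi> (q - s) * ph_nth g (q - s)))"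
      unfolding ph_nth_mult supp by (simp add: ph_nth_twist)
    also have "\<dots> = (\<Sum>s | ph_nth f s \<noteq> 0 \<and> ph_nth g (q - s) \<noteq> 0. \<psi> q * (ph_nth f s * ph_nth g (q - s)))"
    proof (rule sum.cong[OF refl])
      fix s
      show "\<psi> s * ph_nth f s * (\<psi> (q - s) * ph_nth g (q - s)) = \<psi> q * (ph_nth f s * ph_nth g (q - s))"
        using add[of s "q - s"] by simp
    qed
    finally show "ph_nth (ph_twist \<psi> (f * g)) q = ph_nth (ph_twist \<psi> f * ph_twist \<psi> g) q"
      unfolding ph_nth_twist ph_nth_mult by (simp add: sum_distrib_left)
  qed
  moreover have "ph_twist \<psi> (f + g) = ph_twist \<psi> f + ph_twist \<psi> g" for f g
    by (rule ph_eqI) (simp add: ph_nth_twist algebra_simps)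
  moreover have "ph_ord (ph_twist \<psi> f) = ph_ord f" for f
    unfolding ph_ord_def supp ..
  moreover have "ph_twist \<psi> ` puiseux = puiseux"
  proof
    show "ph_twist \<psi> ` puiseux \<subseteq> puiseux" by (auto simp: puiseux_iff supp)
    have "?i f \<in> puiseux" if "f \<in> puiseux" for f
      using that unfolding puiseux_iff supp .
    then show "puiseux \<subseteq> ph_twist \<psi> ` puiseux" using inv1 by (metis image_eqI subsetI)
  qed
  moreover have "ph_twist \<psi> (of_fls 1 F) = of_fls 1 F" for F
  proof (rule ph_eqI)
    fix q
    have "ph_nth (of_fls 1 F) q = 0" if "q \<notin> \<int>" using that ph_nth_of_fls(2)[of 1 q F] by simp
    then show "ph_nth (ph_twist \<psi> (of_fls 1 F)) q = ph_nth (of_fls 1 F) q"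
      by (cases "q \<in> \<int>") (auto simp: ph_nth_twist int elim: Ints_cases)
  qed
  ultimately show ?thesis by (auto simp: puiseux_gal_def)
qed

text \<open>
  Successive roots of \<open>\<omega>\<close> of orders \<open>1, 2, 3, \<dots>\<close> serve as values at \<open>1/(N n!)\<close>.  They are compatible, and
  each rational number is an integer multiple of almost all of these fractions.
\<close>

lemma character_exists:
  fixes \<omega> :: "'a::alg_closed_field"
  assumes "\<omega> ^ N = 1" "0 < N"
  shows "\<exists>\<psi> :: rat \<Rightarrow> 'a. (\<forall>p q. \<psi> (p + q) = \<psi> p * \<psi> q) \<and> (\<forall>i. \<psi> (of_int i) = 1) \<and> \<psi> (1 / of_nat N) = \<omega>"
proof -
  have \<omega>0: "\<omega> \<noteq> 0" using assms by (auto simp: power_0_left)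
  have "\<exists>u. \<forall>n::nat. ((u n :: 'a) \<noteq> 0 \<and> (n = 0 \<longrightarrow> u n = \<omega>)) \<and> u (Suc n) ^ Suc n = u n"
  proof (rule dependent_nat_choice)
    fix x :: 'a and n :: nat assume x: "x \<noteq> 0 \<and> (n = 0 \<longrightarrow> x = \<omega>)"
    obtain y where "y ^ Suc n = x" using nth_root_exists[of "Suc n" x] by auto
    then show "\<exists>y. (y \<noteq> 0 \<and> (Suc n = 0 \<longrightarrow> y = \<omega>)) \<and> y ^ Suc n = x" using x by (intro exI[of _ y]) auto
  qed (use \<omega>0 in auto)
  then obtain u where u: "\<And>n. u n \<noteq> (0 :: 'a)" "u 0 = \<omega>" "\<And>n. u (Suc n) ^ Suc n = u n" by metis
  define D where "D n = N * fact n" for n :: nat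
  define v where "v n q = u n powi \<lfloor>of_nat (D n) * (q :: rat)\<rfloor>" for n q
  have D: "of_nat (D n) * q \<in> \<int>" if "denom q \<le> n" for n q
    unfolding Ints_mult_iff_denom_dvd D_def using that dvd_fact[of "denom q" n] denom_pos[of q]
    by (metis One_nat_def Suc_leI dvd_mult)
  have step: "v (Suc n) q = v n q" if "of_nat (D n) * q \<in> \<int>" for n q
  proof -
    obtain i where i: "of_nat (D n) * q = of_int i" using \<open>of_nat (D n) * q \<in> \<int>\<close> by (rule Ints_cases)
    have "of_nat (D (Suc n)) * q = of_nat (Suc n) * (of_nat (D n) * q)"
      by (simp add: D_def algebra_simps)
    also have "\<dots> = of_int (int (Suc n) * i)" unfolding i by simp
    finally have "v (Suc n) q = u (Suc n) powi (int (Suc n) * i)" unfolding v_def by (simp only: floor_of_int)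
    also have "\<dots> = (u (Suc n) ^ Suc n) powi i" by (simp only: power_int_mult power_int_of_nat)
    finally show ?thesis unfolding u v_def i by simp
  qed
  have stable: "v m q = v n q" if "of_nat (D n) * q \<in> \<int>" "n \<le> m" for m n q
    using that(2)
  proof (induction m rule: dec_induct)
    case (step m)
    have "D n dvd D m" unfolding D_def using step(1) by (intro mult_dvd_mono fact_dvd) auto
    then have "of_nat (D m) * q \<in> \<int>"
      using that(1) unfolding Ints_mult_iff_denom_dvd using dvd_trans by blast
    then show ?case using \<open>\<And>n q. of_nat (D n) * q \<in> \<int> \<Longrightarrow> v (Suc n) q = v n q\<close> step by simp
  qed simp
  define \<psi> where "\<psi> q = v (denom q) q" for q
  have \<psi>: "\<psi> q = v n q" if "denom q \<le> n" for n q
    unfolding \<psi>_def using stable[OF D that] by simp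
  have v_add: "v n (p + q) = v n p * v n q" if pq: "of_nat (D n) * p \<in> \<int>" "of_nat (D n) * q \<in> \<int>" for n p q
  proof -
    obtain i where i: "of_nat (D n) * p = of_int i" using pq(1) by (rule Ints_cases)
    obtain j where j: "of_nat (D n) * q = of_int j" using pq(2) by (rule Ints_cases)
    have "of_nat (D n) * (p + q) = of_int (i + j)" by (simp add: distrib_left i j)
    then show ?thesis unfolding v_def i j by (simp only: floor_of_int) (simp add: power_int_add u)
  qed
  show ?thesis
  proof (intro exI[of _ \<psi>] conjI allI)
    fix p q
    let ?n = "max (denom (p + q)) (max (denom p) (denom q))"
    have "\<psi> (p + q) = v ?n (p + q)" "\<psi> p = v ?n p" "\<psi> q = v ?n q" by (rule \<psi>, simp)+
    then show "\<psi> (p + q) = \<psi> p * \<psi> q" using v_add[OF D D, of p ?n q] by simp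
  next
    fix i
    have "of_nat (D 0) * (of_int i :: rat) = of_int (int N * i)" by (simp add: D_def)
    then have "v 0 (of_int i) = u 0 powi (int N * i)" unfolding v_def by (simp only: floor_of_int)
    also have "\<dots> = 1" by (simp only: power_int_mult power_int_of_nat u assms) simp
    finally have v0: "v 0 (of_int i) = 1" .
    have "of_nat (D 0) * (of_int i :: rat) \<in> \<int>" by simp
    then have "\<psi> (of_int i) = v 0 (of_int i)" unfolding \<psi>_def by (rule stable) simp
    then show "\<psi> (of_int i) = 1" using v0 by simp
  next
    have "of_nat (D 0) * (1 / of_nat N) = (1 :: rat)" using assms(2) by (simp add: D_def)
    then have v0: "v 0 (1 / of_nat N) = \<omega>" and "of_nat (D 0) * (1 / of_nat N :: rat) \<in> \<int>"
      unfolding v_def by (simp_all add: u)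
    from this(2) have "\<psi> (1 / of_nat N) = v 0 (1 / of_nat N)" unfolding \<psi>_def by (rule stable) simp
    then show "\<psi> (1 / of_nat N) = \<omega>" using v0 by simp
  qed
qed

text \<open>
  If a root is split off, it is not a root of the remaining factor, whose roots are again simple.
\<close>

lemma card_simple_roots:
  fixes p :: "'a::alg_closed_field poly"
  assumes "p \<noteq> 0" "\<And>a. \<not> (poly p a = 0 \<and> poly (pderiv p) a = 0)"
  shows "card {a. poly p a = 0} = degree p"
  using assms
proof (induction "degree p" arbitrary: p)
  case 0
  then obtain c where "p = [:c:]" "c \<noteq> 0" by (metis degree_eq_zeroE pCons_eq_0_iff)
  then show ?case by simp
next
  case (Suc n)
  obtain x where x: "poly p x = 0" using alg_closed_imp_poly_has_root[of p] Suc(2) by auto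
  then obtain q where q: "p = [:- x, 1:] * q" by (auto simp: poly_eq_0_iff_dvd)
  have q0: "q \<noteq> 0" using Suc(3) q by auto
  have n: "n = degree q" using Suc(2) q0 by (simp add: q degree_mult_eq del: mult_pCons_left)
  have deriv: "poly (pderiv p) a = poly q a + (a - x) * poly (pderiv q) a" for a
    unfolding q pderiv_mult by (simp add: pderiv_pCons del: mult_pCons_left)
  have val: "poly p a = (a - x) * poly q a" for a
    unfolding q poly_mult by simp
  have "card {a. poly q a = 0} = n"
    using Suc(1)[OF n q0] Suc(4) n unfolding deriv val by (metis add_0 mult_zero_right)
  moreover have "poly q x \<noteq> 0" using Suc(4)[of x] unfolding deriv val by auto
  moreover have "{a. poly p a = 0} = insert x {a. poly q a = 0}" by (auto simp: val)
  ultimately show ?case using Suc(2) poly_roots_finite[OF q0] by simp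
qed

lemma card_roots_of_unity:
  assumes "0 < N"
  shows "card {\<omega> :: 'a::{alg_closed_field, field_char_0}. \<omega> ^ N = 1} = N"
proof -
  let ?p = "monom 1 N - 1 :: 'a poly"
  have deg: "degree ?p = N"
    using assms degree_add_eq_left[of "- 1" "monom (1::'a) N"] by (simp add: degree_monom_eq)
  then have "?p \<noteq> 0" using assms by auto
  moreover have "\<not> (poly ?p a = 0 \<and> poly (pderiv ?p) a = 0)" for a
    using assms by (auto simp: pderiv_diff pderiv_monom poly_monom power_0_left)
  ultimately have "card {a. poly ?p a = 0} = N" using card_simple_roots deg by metis
  then show ?thesis by (simp add: poly_monom)
qed

lemma ph_monom_power: "ph_monom c q ^ n = ph_monom (c ^ n) (of_nat n * q)"
  for c :: "'a::field"
proof (induction n)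
  case (Suc n)
  have "q + q * of_nat n = of_nat (Suc n) * q" by (simp add: algebra_simps)
  then show ?case by (simp add: Suc ph_monom_mult mult.commute)
qed (simp add: one_puiseux_hat_def)

text \<open>
  A polynomial of degree \<open>N\<close> has at most \<open>N\<close> roots, and there are \<open>N\<close> constant ones.
\<close>

lemma root_of_unity_constant:
  fixes z :: "'a::{alg_closed_field, field_char_0} puiseux_hat"
  assumes "z ^ N = 1" "0 < N"
  obtains \<omega> where "z = ph_monom \<omega> 0" "\<omega> ^ N = 1"
proof -
  let ?p = "monom 1 N - 1 :: 'a puiseux_hat poly"
  let ?\<Omega> = "{\<omega> :: 'a. \<omega> ^ N = 1}"
  have deg: "degree ?p = N"
    using assms degree_add_eq_left[of "- 1" "monom (1::'a puiseux_hat) N"] by (simp add: degree_monom_eq)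
  then have p0: "?p \<noteq> 0" using assms by auto
  have "inj_on (\<lambda>\<omega>. ph_monom \<omega> 0) ?\<Omega>"
    by (rule inj_onI) (metis ph_nth_monom)
  then have c: "card ((\<lambda>\<omega>. ph_monom \<omega> 0) ` ?\<Omega>) = N"
    by (simp add: card_image card_roots_of_unity assms)
  have "card {a. poly ?p a = 0} \<le> N" using card_poly_roots_bound[OF p0] deg by simp
  moreover have "finite {a. poly ?p a = 0}" using p0 by (rule poly_roots_finite)
  moreover have "(\<lambda>\<omega>. ph_monom \<omega> 0) ` ?\<Omega> \<subseteq> {a. poly ?p a = 0}"
    by (auto simp: poly_monom ph_monom_power one_puiseux_hat_def)
  ultimately have "(\<lambda>\<omega>. ph_monom \<omega> 0) ` ?\<Omega> = {a. poly ?p a = 0}"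
    using c by (intro card_seteq) auto
  moreover have "z \<in> {a. poly ?p a = 0}" using assms by (simp add: poly_monom)
  ultimately show thesis using that by auto
qed

text \<open>
  If \<open>x\<^bsup>1/N\<^esup>\<close> is multiplied by an \<open>N\<close>-th root of unity \<open>\<omega>\<close>, then \<open>x\<^sup>q\<close> is multiplied by \<open>\<omega>\<close> to the integer
  \<open>N q\<close>.  The residue modulo \<open>N\<close> makes this exponent a natural number.
\<close>

definition root_weight :: "nat \<Rightarrow> rat \<Rightarrow> nat" where
  "root_weight N q = nat (\<lfloor>of_nat N * q\<rfloor> mod int N)"

lemma of_fls_monom: "of_fls 1 (fls_const c * fls_X_intpow j) = ph_monom (c :: 'a::field) (of_int j)"
proof (rule of_fls_eqI)
  show "ph_nth (ph_monom c (of_int j)) q = 0" if "of_nat 1 * q \<notin> \<int>" for q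
    using that by (auto simp: ph_nth_monom)
qed (auto simp: ph_nth_monom)

text \<open>
  The first factor is a Laurent series in \<open>x\<close>, which automorphisms fix.
\<close>

lemma monom_factor:
  assumes "0 < N" "denom q dvd N"
  shows "ph_monom (c :: 'a::field) q
    = of_fls 1 (fls_const c * fls_X_intpow (\<lfloor>of_nat N * q\<rfloor> div int N)) * ph_monom 1 (1 / of_nat N) ^ root_weight N q"
proof -
  obtain i where i: "q = of_int i / of_nat N" using denom_dvdE[OF assms(2,1)] .
  have fl: "\<lfloor>of_nat N * q\<rfloor> = i" using assms(1) by (simp add: i)
  have "ph_monom c (of_int (i div int N)) * ph_monom 1 (of_nat (nat (i mod int N)) * (1 / of_nat N)) = ph_monom c q"
  proof (rule ph_eqI)
    fix r
    have "of_int (i div int N) + of_nat (nat (i mod int N)) * (1 / of_nat N) = q"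
    proof -
      have "of_nat (nat (i mod int N)) = (of_int (i mod int N) :: rat)" using assms(1) by simp
      moreover have "(of_int i :: rat) = of_int (int N * (i div int N) + i mod int N)" by simp
      then have "(of_int i :: rat) = of_nat N * of_int (i div int N) + of_int (i mod int N)"
        by (simp only: of_int_add of_int_mult of_int_of_nat_eq)
      ultimately show ?thesis using assms(1) by (simp add: i field_simps)
    qed
    then show "ph_nth (ph_monom c (of_int (i div int N)) * ph_monom 1 (of_nat (nat (i mod int N)) * (1 / of_nat N))) r
      = ph_nth (ph_monom c q) r"
      by (auto simp: ph_nth_monom_mult ph_nth_monom)
  qed
  then show ?thesis unfolding of_fls_monom root_weight_def fl ph_monom_power by simp
qed

lemma puiseux_gal_monom_if_root:
  fixes \<sigma> :: "'a::{alg_closed_field, field_char_0} puiseux_hat \<Rightarrow> 'a puiseux_hat"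
  assumes \<sigma>: "\<sigma> \<in> puiseux_gal" and N: "0 < N" "denom q dvd N"
    and root: "\<sigma> (ph_monom 1 (1 / of_nat N)) = ph_monom \<omega> 0 * ph_monom 1 (1 / of_nat N)"
  shows "\<sigma> (ph_monom c q) = ph_monom (\<omega> ^ root_weight N q * c) q"
proof -
  have "\<sigma> 1 = 1" using puiseux_galD(6)[OF \<sigma>, of 1] by (simp add: of_fls_1)
  then have pw: "\<sigma> (a ^ n) = \<sigma> a ^ n" for a n by (induction n) (simp_all add: puiseux_galD[OF \<sigma>])
  have "\<sigma> (ph_monom c q) = ph_monom (\<omega> ^ root_weight N q) 0 * ph_monom c q"
    unfolding monom_factor[OF N, of c] puiseux_galD(3,6)[OF \<sigma>] pw root power_mult_distrib
    by (simp add: ph_monom_power ac_simps)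
  then show ?thesis by (simp only: ph_monom_mult add_0)
qed

text \<open>
  The image of \<open>x\<^bsup>1/N\<^esup>\<close> is another \<open>N\<close>-th root of \<open>x\<close>.
\<close>

lemma puiseux_gal_monom:
  fixes \<sigma> :: "'a::{alg_closed_field, field_char_0} puiseux_hat \<Rightarrow> 'a puiseux_hat"
  assumes "\<sigma> \<in> puiseux_gal" "0 < N"
  obtains \<omega> where "\<omega> ^ N = 1" "\<And>c q. denom q dvd N \<Longrightarrow> \<sigma> (ph_monom c q) = ph_monom (\<omega> ^ root_weight N q * c) q"
proof -
  note \<sigma> = puiseux_galD[OF assms(1)]
  let ?t = "ph_monom (1 :: 'a) (1 / of_nat N)" and ?t' = "ph_monom (1 :: 'a) (- 1 / of_nat N)"
  have "\<sigma> 1 = 1" using \<sigma>(6)[of 1] by (simp add: of_fls_1)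
  then have pw: "\<sigma> (a ^ n) = \<sigma> a ^ n" for a n by (induction n) (simp_all add: \<sigma>)
  have tN: "?t ^ N = of_fls 1 (fls_const 1 * fls_X_intpow 1)"
    using assms(2) of_fls_monom[of "1 :: 'a" 1] by (simp add: ph_monom_power)
  have inv: "?t * ?t' = 1"
    by (rule ph_eqI) (auto simp: ph_nth_monom_mult ph_nth_monom ph_nth_1)
  have "(\<sigma> ?t * ?t') ^ N = (?t * ?t') ^ N"
    unfolding power_mult_distrib pw[symmetric] tN \<sigma>(6) ..
  then have "(\<sigma> ?t * ?t') ^ N = 1" unfolding inv by simp
  from root_of_unity_constant[OF this assms(2)]
  obtain \<omega> where \<omega>: "\<sigma> ?t * ?t' = ph_monom \<omega> 0" "\<omega> ^ N = 1" .
  have "\<sigma> ?t = \<sigma> ?t * (?t * ?t')" unfolding inv by simp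
  also have "\<dots> = (\<sigma> ?t * ?t') * ?t" by (simp only: ac_simps)
  finally have "\<sigma> ?t = ph_monom \<omega> 0 * ?t" unfolding \<omega>(1) .
  then show thesis by (intro that[OF \<omega>(2)] puiseux_gal_monom_if_root[OF assms])
qed

lemma puiseux_gal_monom_exists:
  fixes \<omega> :: "'a::{alg_closed_field, field_char_0}"
  assumes "\<omega> ^ N = 1" "0 < N"
  obtains \<sigma> where "\<sigma> \<in> puiseux_gal" "\<And>c q. denom q dvd N \<Longrightarrow> \<sigma> (ph_monom c q) = ph_monom (\<omega> ^ root_weight N q * c) q"
proof -
  obtain \<psi> :: "rat \<Rightarrow> 'a"
    where \<psi>: "\<And>p q. \<psi> (p + q) = \<psi> p * \<psi> q" "\<And>i. \<psi> (of_int i) = 1" "\<psi> (1 / of_nat N) = \<omega>"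
    using character_exists[OF assms] by metis
  note gal = ph_twist_puiseux_gal[OF \<psi>(1,2)]
  let ?t = "ph_monom (1 :: 'a) (1 / of_nat N)"
  have "ph_twist \<psi> ?t = ph_monom \<omega> 0 * ?t"
    by (rule ph_eqI) (auto simp: ph_nth_twist ph_nth_monom_mult ph_nth_monom \<psi>)
  then show thesis by (intro that[OF gal] puiseux_gal_monom_if_root[OF gal assms(2)])
qed

section \<open>Multiplicities\<close>

abbreviation support :: "'a::zero puiseux_hat \<Rightarrow> rat set" where
  "support f \<equiv> {q. ph_nth f q \<noteq> 0}"

lemma finite_support_expansion:
  fixes f :: "'a::field puiseux_hat"
  assumes "finite (support f)"
  shows "f = (\<Sum>q\<in>support f. ph_monom (ph_nth f q) q)"
  by (rule ph_eqI) (simp add: ph_nth_sum ph_nth_monom sum.delta'[OF assms])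

lemma ph_nth_puiseux_gal:
  assumes \<sigma>: "\<sigma> \<in> puiseux_gal" and f: "finite (support f)" "\<And>q. q \<in> support f \<Longrightarrow> denom q dvd N"
    and \<omega>: "\<And>c q. denom q dvd N \<Longrightarrow> \<sigma> (ph_monom c q) = ph_monom (\<omega> ^ root_weight N q * c) q"
  shows "ph_nth (\<sigma> f) q = \<omega> ^ root_weight N q * ph_nth f q"
proof -
  have "\<sigma> (\<Sum>q\<in>S. g q) = (\<Sum>q\<in>S. \<sigma> (g q))" for g :: "rat \<Rightarrow> 'a puiseux_hat" and S
    by (induction S rule: infinite_finite_induct) (simp_all add: puiseux_galD[OF \<sigma>])
  then have "\<sigma> f = (\<Sum>q\<in>support f. \<sigma> (ph_monom (ph_nth f q) q))"
    by (subst finite_support_expansion[OF f(1)]) simp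
  also have "\<dots> = (\<Sum>q\<in>support f. ph_monom (\<omega> ^ root_weight N q * ph_nth f q) q)"
    by (intro sum.cong refl \<omega> f(2))
  finally show ?thesis by (simp add: ph_nth_sum ph_nth_monom sum.delta'[OF f(1)])
qed

text \<open>
  For \<open>A = {..<s}\<close> this is the multiplicity of \<open>\<zeta>(f,\<bar>x\<bar>\<^sup>s)\<close>, see \<open>berk_mult_disk_point\<close>.
\<close>

definition support_lcm :: "'a::zero puiseux_hat \<Rightarrow> rat set \<Rightarrow> nat" where
  "support_lcm f A = Lcm (denom ` (support f \<inter> A))"

lemma support_lcm_dvd: "q \<in> A \<Longrightarrow> ph_nth f q \<noteq> 0 \<Longrightarrow> denom q dvd support_lcm f A"
  unfolding support_lcm_def by (intro dvd_Lcm) auto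

lemma support_lcm_cong:
  "(\<And>q. ph_nth f q \<noteq> 0 \<Longrightarrow> q \<in> A \<longleftrightarrow> q \<in> B) \<Longrightarrow> support_lcm f A = support_lcm f B"
  unfolding support_lcm_def by (rule arg_cong[of _ _ "\<lambda>S. Lcm (denom ` S)"]) auto

lemma support_lcm_dvd_iff:
  "support_lcm f A dvd n \<longleftrightarrow> (\<forall>q\<in>A. ph_nth f q \<noteq> 0 \<longrightarrow> denom q dvd n)"
  unfolding support_lcm_def Lcm_dvd_iff by auto

lemma support_lcm_mono: "A \<subseteq> B \<Longrightarrow> support_lcm f A dvd support_lcm f B"
  unfolding support_lcm_dvd_iff by (auto intro: support_lcm_dvd)

lemma Lcm_denom_pos: "finite S \<Longrightarrow> 0 < Lcm (denom ` S)"
  by (induction S rule: finite_induct) (simp_all add: lcm_pos_nat)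

lemma support_lcm_pos:
  assumes "A \<subseteq> {..s}"
  shows "0 < support_lcm f A"
proof -
  have "finite (support f \<inter> A)"
    by (rule finite_subset[OF _ ph_finite[of s f]]) (use assms in auto)
  then show ?thesis unfolding support_lcm_def by (rule Lcm_denom_pos)
qed

text \<open>
  The order \<open>d\<close> of \<open>w\<close> divides \<open>N\<close> and the integers \<open>N q\<close>, so that \<open>N/d\<close> is a common denominator as well.
  As \<open>N\<close> is the least one, \<open>d = 1\<close>.
\<close>

lemma root_of_unity_eq_1:
  fixes w :: "'a::field"
  assumes N: "N = Lcm (denom ` S)" "0 < N" and w: "w ^ N = 1" "\<And>q. q \<in> S \<Longrightarrow> w ^ root_weight N q = 1"
  shows "w = 1"
proof -
  define d where "d = (LEAST d. 0 < d \<and> w ^ d = 1)"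
  have d: "0 < d" "w ^ d = 1" unfolding d_def using LeastI[of "\<lambda>d. 0 < d \<and> w ^ d = 1" N] N w by auto
  have dvd: "d dvd j" if "w ^ j = 1" for j
  proof -
    have "w ^ j = (w ^ d) ^ (j div d) * w ^ (j mod d)" by (simp add: power_mult[symmetric] power_add[symmetric])
    then have "w ^ (j mod d) = 1" using d(2) that by simp
    then have "\<not> 0 < j mod d" using not_less_Least[of "j mod d" "\<lambda>d. 0 < d \<and> w ^ d = 1"] d(1)
      unfolding d_def[symmetric] by auto
    then show ?thesis by (simp add: mod_eq_0_iff_dvd)
  qed
  then obtain e where e: "N = d * e" using w(1) by blast
  have "denom q dvd e" if q: "q \<in> S" for q
  proof -
    have "denom q dvd N" unfolding N by (rule dvd_Lcm) (use q in simp)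
    then obtain i where i: "of_nat N * q = of_int i"
      using Ints_mult_iff_denom_dvd[of N q] by (auto elim: Ints_cases)
    have "int d dvd int (root_weight N q)" using dvd[OF w(2)[OF q]] by simp
    then have "int d dvd i mod int N" unfolding root_weight_def i using N(2) by simp
    then have "int d dvd i" unfolding e by (simp add: dvd_mod_iff)
    then obtain j where j: "i = int d * j" by blast
    have "of_nat d * (of_nat e * q) = of_nat d * of_int j" using i unfolding e j by (simp add: mult.assoc)
    then have "of_nat e * q = of_int j" using d(1) by simp
    then show ?thesis by (metis Ints_of_int Ints_mult_iff_denom_dvd)
  qed
  then have "N dvd e" unfolding N by (auto intro: Lcm_least)
  then obtain k where "e = N * k" by blast
  then have "e * (d * k) = e * 1" unfolding e by (simp add: ac_simps)
  moreover have "e \<noteq> 0" using e N(2) by auto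
  ultimately have "d = 1" by (simp only: mult_cancel1) simp
  then show ?thesis using d(2) by simp
qed

text \<open>
  Let \<open>N\<close> be the least common denominator.  A conjugate determines the \<open>N\<close>-th root of unity by which
  \<open>x\<^bsup>1/N\<^esup>\<close> is multiplied (\<open>root_of_unity_eq_1\<close>), and every \<open>N\<close>-th root of unity occurs.
\<close>

lemma card_conjugates:
  fixes f :: "'a::{alg_closed_field, field_char_0} puiseux_hat"
  assumes f: "finite (support f)"
  shows "card ((\<lambda>\<sigma>. \<sigma> f) ` puiseux_gal) = support_lcm f UNIV" (is "card ?O = _")
proof -
  let ?N = "support_lcm f UNIV"
  let ?\<Omega> = "{\<omega> :: 'a. \<omega> ^ ?N = 1}"
  have N: "0 < ?N" unfolding support_lcm_def using f by (intro Lcm_denom_pos) simp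
  have dvd: "denom q dvd ?N" if "q \<in> support f" for q using that by (auto intro: support_lcm_dvd)
  have "\<forall>\<omega>\<in>?\<Omega>. \<exists>\<sigma>\<in>puiseux_gal. \<forall>q. ph_nth (\<sigma> f) q = \<omega> ^ root_weight ?N q * ph_nth f q"
  proof
    fix \<omega> assume "\<omega> \<in> ?\<Omega>"
    then have "\<omega> ^ ?N = 1" by simp
    then obtain \<sigma> where \<sigma>: "\<sigma> \<in> puiseux_gal"
      "\<And>c q. denom q dvd ?N \<Longrightarrow> \<sigma> (ph_monom c q) = ph_monom (\<omega> ^ root_weight ?N q * c) q"
      using puiseux_gal_monom_exists[OF _ N, of \<omega>] by metis
    show "\<exists>\<sigma>\<in>puiseux_gal. \<forall>q. ph_nth (\<sigma> f) q = \<omega> ^ root_weight ?N q * ph_nth f q"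
      using ph_nth_puiseux_gal[OF \<sigma>(1) f dvd \<sigma>(2)] \<sigma>(1) by auto
  qed
  then obtain s where s: "\<And>\<omega>. \<omega> \<in> ?\<Omega> \<Longrightarrow> s \<omega> \<in> puiseux_gal"
    "\<And>\<omega> q. \<omega> \<in> ?\<Omega> \<Longrightarrow> ph_nth (s \<omega> f) q = \<omega> ^ root_weight ?N q * ph_nth f q" by metis
  have "inj_on (\<lambda>\<omega>. s \<omega> f) ?\<Omega>"
  proof (rule inj_onI)
    fix \<omega> \<omega>' assume o: "\<omega> \<in> ?\<Omega>" "\<omega>' \<in> ?\<Omega>" and eq: "s \<omega> f = s \<omega>' f"
    then have nz: "\<omega>' \<noteq> 0" using N by (auto simp: power_0_left)
    have "\<omega> ^ root_weight ?N q = \<omega>' ^ root_weight ?N q" if "q \<in> support f" for q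
      using s(2)[OF o(1), of q] s(2)[OF o(2), of q] eq that by simp
    then have 1: "(\<omega> / \<omega>') ^ root_weight ?N q = 1" if "q \<in> support f" for q
      using that nz by (simp add: power_divide)
    have 2: "(\<omega> / \<omega>') ^ ?N = 1" using o by (simp add: power_divide)
    have "\<omega> / \<omega>' = 1"
    proof (rule root_of_unity_eq_1[OF _ N 2])
      show "?N = Lcm (denom ` support f)" by (simp add: support_lcm_def)
    qed (rule 1)
    then show "\<omega> = \<omega>'" using nz by simp
  qed
  then have "card ((\<lambda>\<omega>. s \<omega> f) ` ?\<Omega>) = ?N" by (simp add: card_image card_roots_of_unity[OF N])
  moreover have "(\<lambda>\<omega>. s \<omega> f) ` ?\<Omega> = ?O"
  proof
    show "(\<lambda>\<omega>. s \<omega> f) ` ?\<Omega> \<subseteq> ?O" using s(1) by blast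
    show "?O \<subseteq> (\<lambda>\<omega>. s \<omega> f) ` ?\<Omega>"
    proof clarify
      fix \<sigma> :: "'a puiseux_hat \<Rightarrow> 'a puiseux_hat" assume \<sigma>: "\<sigma> \<in> puiseux_gal"
      obtain \<omega> where \<omega>: "\<omega> ^ ?N = 1"
        "\<And>c q. denom q dvd ?N \<Longrightarrow> \<sigma> (ph_monom c q) = ph_monom (\<omega> ^ root_weight ?N q * c) q"
        using puiseux_gal_monom[OF \<sigma> N] by metis
      have "ph_nth (\<sigma> f) q = \<omega> ^ root_weight ?N q * ph_nth f q" for q
        by (rule ph_nth_puiseux_gal[OF \<sigma> f dvd \<omega>(2)])
      then have "\<sigma> f = s \<omega> f" by (intro ph_eqI) (simp add: s(2) \<omega>(1))
      then show "\<sigma> f \<in> (\<lambda>\<omega>. s \<omega> f) ` ?\<Omega>" using \<omega>(1) by blast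
    qed
  qed
  ultimately show ?thesis by simp
qed

lemma card_conjugates_finite:
  fixes f :: "'a::{alg_closed_field, field_char_0} puiseux_hat"
  assumes "finite (support f)"
  shows "finite ((\<lambda>\<sigma>. \<sigma> f) ` puiseux_gal)"
proof -
  have "0 < support_lcm f UNIV" unfolding support_lcm_def using assms by (intro Lcm_denom_pos) simp
  then show ?thesis using card_conjugates[OF assms] by (metis card_gt_0_iff)
qed

lemma puiseux_gal_nth_eq_0_iff:
  fixes f :: "'a::{alg_closed_field, field_char_0} puiseux_hat"
  assumes "\<sigma> \<in> puiseux_gal" "finite (support f)"
  shows "ph_nth (\<sigma> f) q = 0 \<longleftrightarrow> ph_nth f q = 0"
proof -
  obtain N where N: "N > 0" "\<forall>q\<in>support f. denom q dvd N"
    using common_denominator[OF assms(2)] by (auto simp: Ints_mult_iff_denom_dvd)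
  obtain \<omega> where \<omega>: "\<omega> ^ N = 1"
    "\<And>c q. denom q dvd N \<Longrightarrow> \<sigma> (ph_monom c q) = ph_monom (\<omega> ^ root_weight N q * c) q"
    using puiseux_gal_monom[OF assms(1) N(1)] by metis
  have "\<omega> \<noteq> 0" using \<omega>(1) N(1) by (auto simp: power_0_left)
  moreover have "denom q dvd N" if "q \<in> support f" for q using N(2) that by blast
  then have "ph_nth (\<sigma> f) q = \<omega> ^ root_weight N q * ph_nth f q"
    by (rule ph_nth_puiseux_gal[OF assms(1,2) _ \<omega>(2)])
  ultimately show ?thesis by simp
qed

text \<open>
  The orbit of the point with the smaller stabiliser maps onto the other orbit, and automorphisms
  permute the fibres transitively.
\<close>

lemma card_orbit_dvd:
  fixes X :: "('a::field puiseux_hat \<Rightarrow> 'a puiseux_hat) \<Rightarrow> 'x" and Y :: "_ \<Rightarrow> 'y"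
  assumes X: "\<And>\<sigma> \<tau> \<upsilon>. \<sigma> \<in> puiseux_gal \<Longrightarrow> \<tau> \<in> puiseux_gal \<Longrightarrow> \<upsilon> \<in> puiseux_gal \<Longrightarrow>
      X \<sigma> = X \<tau> \<Longrightarrow> X (\<upsilon> \<circ> \<sigma>) = X (\<upsilon> \<circ> \<tau>)"
    and Y: "\<And>\<sigma> \<tau> \<upsilon>. \<sigma> \<in> puiseux_gal \<Longrightarrow> \<tau> \<in> puiseux_gal \<Longrightarrow> \<upsilon> \<in> puiseux_gal \<Longrightarrow>
      Y \<sigma> = Y \<tau> \<Longrightarrow> Y (\<upsilon> \<circ> \<sigma>) = Y (\<upsilon> \<circ> \<tau>)"
    and stab: "\<And>\<sigma>. \<sigma> \<in> puiseux_gal \<Longrightarrow> X \<sigma> = X id \<Longrightarrow> Y \<sigma> = Y id"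
    and fin: "finite (X ` puiseux_gal)"
  shows "card (Y ` puiseux_gal) dvd card (X ` puiseux_gal)"
proof -
  note gal = id_puiseux_gal comp_puiseux_gal inv_puiseux_gal
  have cancel: "inv \<sigma> \<circ> \<sigma> = id" "\<sigma> \<circ> inv \<sigma> = id" if "\<sigma> \<in> puiseux_gal" for \<sigma> :: "'a puiseux_hat \<Rightarrow> 'a puiseux_hat"
    using that by (auto simp: fun_eq_iff)
  have XY: "Y \<sigma> = Y \<tau>" if \<sigma>: "\<sigma> \<in> puiseux_gal" and \<tau>: "\<tau> \<in> puiseux_gal" and eq: "X \<sigma> = X \<tau>" for \<sigma> \<tau>
  proof -
    have "X (inv \<tau> \<circ> \<sigma>) = X id" using X[OF \<sigma> \<tau> gal(3)[OF \<tau>] eq] cancel[OF \<tau>] by simp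
    then have "Y (inv \<tau> \<circ> \<sigma>) = Y id" using stab gal \<sigma> \<tau> by blast
    then have "Y (\<tau> \<circ> (inv \<tau> \<circ> \<sigma>)) = Y (\<tau> \<circ> id)" by (rule Y[rotated 3]) (use gal \<sigma> \<tau> in auto)
    then show ?thesis using cancel[OF \<tau>] by (simp add: o_assoc)
  qed
  define rep where "rep x = (SOME \<sigma>. \<sigma> \<in> puiseux_gal \<and> X \<sigma> = x)" for x
  have rep: "rep (X \<sigma>) \<in> puiseux_gal" "X (rep (X \<sigma>)) = X \<sigma>" if "\<sigma> \<in> puiseux_gal" for \<sigma>
    unfolding rep_def using someI[of "\<lambda>\<tau>. \<tau> \<in> puiseux_gal \<and> X \<tau> = X \<sigma>" \<sigma>] that by auto
  define p where "p x = Y (rep x)" for x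
  have p: "p (X \<sigma>) = Y \<sigma>" if "\<sigma> \<in> puiseux_gal" for \<sigma>
    unfolding p_def using rep[OF that] that XY by blast
  define m where "m \<upsilon> x = X (\<upsilon> \<circ> rep x)" for \<upsilon> x
  have m: "m \<upsilon> (X \<sigma>) = X (\<upsilon> \<circ> \<sigma>)" if "\<upsilon> \<in> puiseux_gal" "\<sigma> \<in> puiseux_gal" for \<upsilon> \<sigma>
    unfolding m_def using rep[OF that(2)] that by (intro X) auto
  let ?F = "\<lambda>y. {x \<in> X ` puiseux_gal. p x = y}"
  have fibre: "card (?F (Y \<sigma>)) = card (?F (Y id))" if \<sigma>: "\<sigma> \<in> puiseux_gal" for \<sigma>
  proof -
    have "bij_betw (m (inv \<sigma>)) (?F (Y \<sigma>)) (?F (Y id))"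
    proof (rule bij_betw_byWitness[where f' = "m \<sigma>"])
      show "\<forall>x\<in>?F (Y \<sigma>). m \<sigma> (m (inv \<sigma>) x) = x"
        using \<sigma> cancel[OF \<sigma>] by (auto simp: m gal o_assoc)
      show "\<forall>x\<in>?F (Y id). m (inv \<sigma>) (m \<sigma> x) = x"
        using \<sigma> cancel[OF \<sigma>] by (auto simp: m gal o_assoc)
      show "m (inv \<sigma>) ` ?F (Y \<sigma>) \<subseteq> ?F (Y id)"
      proof clarify
        fix \<tau> assume \<tau>: "\<tau> \<in> puiseux_gal" "p (X \<tau>) = Y \<sigma>"
        then have "Y (inv \<sigma> \<circ> \<tau>) = Y (inv \<sigma> \<circ> \<sigma>)" using \<sigma> gal by (intro Y) (auto simp: p)
        then show "m (inv \<sigma>) (X \<tau>) \<in> X ` puiseux_gal \<and> p (m (inv \<sigma>) (X \<tau>)) = Y id"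
          using \<sigma> \<tau> cancel[OF \<sigma>] by (auto simp: m p gal)
      qed
      show "m \<sigma> ` ?F (Y id) \<subseteq> ?F (Y \<sigma>)"
      proof clarify
        fix \<tau> assume \<tau>: "\<tau> \<in> puiseux_gal" "p (X \<tau>) = Y id"
        then have "Y (\<sigma> \<circ> \<tau>) = Y (\<sigma> \<circ> id)" using \<sigma> gal by (intro Y) (auto simp: p)
        then show "m \<sigma> (X \<tau>) \<in> X ` puiseux_gal \<and> p (m \<sigma> (X \<tau>)) = Y \<sigma>"
          using \<sigma> \<tau> by (auto simp: m p gal)
      qed
    qed
    then show ?thesis by (rule bij_betw_same_card)
  qed
  have "card (X ` puiseux_gal) = (\<Sum>y\<in>p ` X ` puiseux_gal. card (?F y))"
    using sum.image_gen[OF fin, of "\<lambda>_. 1::nat" p] by simp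
  also have "p ` X ` puiseux_gal = Y ` puiseux_gal" by (auto simp: image_image p)
  also have "(\<Sum>y\<in>Y ` puiseux_gal. card (?F y)) = (\<Sum>y\<in>Y ` puiseux_gal. card (?F (Y id)))"
  proof (rule sum.cong[OF refl])
    fix y assume "y \<in> Y ` puiseux_gal"
    then obtain \<sigma> where "\<sigma> \<in> puiseux_gal" "y = Y \<sigma>" by blast
    then show "card (?F y) = card (?F (Y id))" using fibre by blast
  qed
  finally show ?thesis by simp
qed

lift_definition ph_restrict :: "rat set \<Rightarrow> 'a::zero puiseux_hat \<Rightarrow> 'a puiseux_hat"
  is "\<lambda>A f q. if q \<in> A then f q else 0"
proof -
  fix A and f :: "rat \<Rightarrow> 'a" and r
  assume "\<And>r. finite {q. q \<le> r \<and> f q \<noteq> 0}"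
  then show "finite {q. q \<le> r \<and> (if q \<in> A then f q else 0) \<noteq> 0}"
    by (rule finite_subset[rotated]) auto
qed

lemma ph_nth_restrict: "ph_nth (ph_restrict A f) q = (if q \<in> A then ph_nth f q else 0)"
  by transfer simp

lemma finite_support_restrict: "A \<subseteq> {..s} \<Longrightarrow> finite (support (ph_restrict A f))"
  by (rule finite_subset[OF _ ph_finite[of s f]]) (auto simp: ph_nth_restrict)

lemma support_lcm_restrict: "support_lcm (ph_restrict A f) UNIV = support_lcm f A"
  unfolding support_lcm_def by (rule arg_cong[of _ _ "\<lambda>S. Lcm (denom ` S)"]) (auto simp: ph_nth_restrict)

lemma berk_mult_eq: "berk_mult \<zeta> =
    (if finite ((\<lambda>\<sigma>. gal_act \<sigma> \<zeta>) ` puiseux_gal) then enat (card ((\<lambda>\<sigma>. gal_act \<sigma> \<zeta>) ` puiseux_gal)) else \<infinity>)"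
proof -
  have "{gal_act \<sigma> \<zeta> |\<sigma>. \<sigma> \<in> puiseux_gal} = (\<lambda>\<sigma>. gal_act \<sigma> \<zeta>) ` puiseux_gal" by auto
  then show ?thesis by (simp add: berk_mult_def Let_def)
qed

lemma berk_mult_None [simp]: "berk_mult None = 1"
proof -
  have orbit: "(\<lambda>\<sigma>. gal_act \<sigma> None) ` puiseux_gal = {None}" by (auto simp: gal_act_def intro: image_eqI[of _ _ id])
  show ?thesis unfolding berk_mult_eq orbit by (simp add: one_enat_def)
qed

lemma gal_act_comp:
  assumes "\<sigma> \<in> puiseux_gal" "\<tau> \<in> puiseux_gal"
  shows "gal_act (\<sigma> \<circ> \<tau>) \<zeta> = gal_act \<sigma> (gal_act \<tau> \<zeta>)"
proof -
  have "inv (\<sigma> \<circ> \<tau>) = inv \<tau> \<circ> inv \<sigma>"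
    using puiseux_galD(1)[OF assms(1)] puiseux_galD(1)[OF assms(2)] by (rule o_inv_distrib)
  moreover have "inv \<tau> 0 = 0" "inv \<sigma> 0 = 0" by (simp_all add: puiseux_galD inv_puiseux_gal assms)
  ultimately show ?thesis by (cases \<zeta>) (simp_all add: gal_act_def map_poly_map_poly)
qed

lemma gal_act_id [simp]: "gal_act id \<zeta> = \<zeta>"
  by (cases \<zeta>) (simp_all add: gal_act_def)

lemma enat_dvd_enat_iff: "enat a dvd enat b \<longleftrightarrow> a dvd b"
proof
  assume "enat a dvd enat b"
  then obtain k where k: "enat b = enat a * k" by (auto simp: dvd_def)
  show "a dvd b"
  proof (cases k)
    case (enat n)
    then show ?thesis using k by simp
  next
    case infinity
    then show ?thesis using k by (cases "a = 0") (auto simp: enat_0 enat_0_iff)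
  qed
next
  assume "a dvd b"
  then obtain k where "b = a * k" by blast
  then have "enat b = enat a * enat k" by simp
  then show "enat a dvd enat b" by (metis dvd_triv_left)
qed

lemma dvd_infinity: "n \<noteq> 0 \<Longrightarrow> n dvd (\<infinity> :: enat)"
  by (metis dvd_triv_left enat_0_iff(1) imult_is_infinity not_infinity_eq zero_enat_def)

lemma map_poly_puiseux_gal:
  fixes f g :: "'a::field puiseux_hat poly"
  assumes "\<sigma> \<in> puiseux_gal"
  shows "map_poly \<sigma> (f + g) = map_poly \<sigma> f + map_poly \<sigma> g" "map_poly \<sigma> (f * g) = map_poly \<sigma> f * map_poly \<sigma> g"
    "\<sigma> (poly f a) = poly (map_poly \<sigma> f) (\<sigma> a)" "map_poly \<sigma> [:- c, 1:] = [:- \<sigma> c, 1:]"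
    "map_poly \<sigma> [:c:] = [:\<sigma> c:]"
proof -
  note \<sigma> = puiseux_galD[OF assms]
  show "map_poly \<sigma> (f + g) = map_poly \<sigma> f + map_poly \<sigma> g" by (rule map_poly_add_hom) (simp_all add: \<sigma>)
  show "map_poly \<sigma> (f * g) = map_poly \<sigma> f * map_poly \<sigma> g" by (rule map_poly_mult_hom) (simp_all add: \<sigma>)
  show "\<sigma> (poly f a) = poly (map_poly \<sigma> f) (\<sigma> a)"
    by (induction f) (simp_all add: \<sigma> map_poly_pCons)
  have "\<sigma> 1 = 1" using \<sigma>(6)[of 1] by (simp add: of_fls_1)
  then show "map_poly \<sigma> [:- c, 1:] = [:- \<sigma> c, 1:]" by (simp add: map_poly_pCons \<sigma>)
  show "map_poly \<sigma> [:c:] = [:\<sigma> c:]" by (simp add: map_poly_pCons \<sigma>)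
qed

context puiseux_radius
begin

lemma ph_abs_puiseux_gal: "\<sigma> \<in> puiseux_gal \<Longrightarrow> ph_abs \<rho> (\<sigma> a) = ph_abs \<rho> a"
  for a :: "'a::field puiseux_hat"
  by (cases "a = 0") (simp_all add: ph_abs_nonzero puiseux_galD)

definition gal_seminorm :: "('a::field puiseux_hat \<Rightarrow> 'a puiseux_hat) \<Rightarrow> ('a puiseux_hat poly \<Rightarrow> real) \<Rightarrow> 'a puiseux_hat poly \<Rightarrow> real" where
  "gal_seminorm \<sigma> \<nu> f = \<nu> (map_poly (inv \<sigma>) f)"

lemma gal_act_Some: "gal_act \<sigma> (Some \<nu>) = Some (gal_seminorm \<sigma> \<nu>)"
  by (simp add: gal_act_def gal_seminorm_def[abs_def])

lemma gal_seminorm_linear: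
  "\<sigma> \<in> puiseux_gal \<Longrightarrow> gal_seminorm \<sigma> \<nu> [:- c, 1:] = \<nu> [:- inv \<sigma> c, 1:]"
  by (simp add: gal_seminorm_def map_poly_puiseux_gal inv_puiseux_gal)

lemma gal_seminorm_seminorm:
  assumes "\<sigma> \<in> puiseux_gal" "\<nu> \<in> seminorms"
  shows "gal_seminorm \<sigma> \<nu> \<in> seminorms"
  using assms(2) map_poly_puiseux_gal[OF inv_puiseux_gal[OF assms(1)]]
    ph_abs_puiseux_gal[OF inv_puiseux_gal[OF assms(1)]]
  unfolding berk_seminorms_def gal_seminorm_def by auto

lemma gal_seminorm_eval_norm:
  assumes "\<sigma> \<in> puiseux_gal"
  shows "gal_seminorm \<sigma> (eval_norm a) = eval_norm (\<sigma> a)"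
proof
  fix f
  have "ph_abs \<rho> (poly (map_poly (inv \<sigma>) f) a) = ph_abs \<rho> (inv \<sigma> (poly f (\<sigma> a)))"
    using map_poly_puiseux_gal(3)[OF inv_puiseux_gal[OF assms], of f "\<sigma> a"] assms by simp
  then show "gal_seminorm \<sigma> (eval_norm a) f = eval_norm (\<sigma> a) f"
    by (simp add: gal_seminorm_def eval_norm_def ph_abs_puiseux_gal inv_puiseux_gal assms)
qed

lemma gal_act_disk_point:
  fixes a :: "'a::alg_closed_field puiseux_hat"
  assumes "\<sigma> \<in> puiseux_gal" "0 < r"
  shows "gal_act \<sigma> (disk_point a r) = disk_point (\<sigma> a) r"
proof -
  have "gal_seminorm \<sigma> (disk_seminorm a r) = disk_seminorm (\<sigma> a) r"
    by (rule centered_seminorm_eq)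
      (use assms in \<open>simp_all add: gal_seminorm_seminorm gal_seminorm_linear disk_seminorm_linear\<close>)
  then show ?thesis by (simp add: disk_point_def gal_act_Some)
qed

lemma berk_mult_eval_norm:
  fixes f :: "'a::{alg_closed_field, field_char_0} puiseux_hat"
  assumes "finite (support f)"
  shows "berk_mult (Some (eval_norm f)) = enat (support_lcm f UNIV)"
proof -
  have "inj (\<lambda>g :: 'a puiseux_hat. Some (eval_norm g))"
  proof (rule injI)
    fix g h :: "'a puiseux_hat" assume "Some (eval_norm g) = Some (eval_norm h)"
    then have "eval_norm g [:- h, 1:] = eval_norm h [:- h, 1:]" by simp
    then show "g = h" using ph_abs_eq_0_iff[OF rho_pos, of "g - h"] by (simp add: eval_norm_def)
  qed
  then have "inj_on (\<lambda>g. Some (eval_norm g)) ((\<lambda>\<sigma>. \<sigma> f) ` puiseux_gal)" by (rule inj_on_subset) simp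
  moreover have "(\<lambda>\<sigma>. gal_act \<sigma> (Some (eval_norm f))) ` puiseux_gal
      = (\<lambda>g. Some (eval_norm g)) ` (\<lambda>\<sigma>. \<sigma> f) ` puiseux_gal"
    by (auto simp: gal_act_Some gal_seminorm_eval_norm image_image)
  ultimately show ?thesis
    by (simp add: berk_mult_eq card_image card_conjugates card_conjugates_finite assms)
qed

lemma disk_point_restrict:
  fixes a :: "'a::alg_closed_field puiseux_hat"
  shows "disk_point a (radius s) = disk_point (ph_restrict {..<s} a) (radius s)"
  by (simp add: disk_point_eq_iff ph_abs_le_iff[OF rho_pos rho_less_1] ph_nth_restrict)

text \<open>
  The disk depends only on the terms of \<open>a\<close> of exponent below \<open>s\<close>, and distinct conjugates of their sum
  define distinct disks.
\<close>

lemma berk_mult_disk_point: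
  fixes a :: "'a::{alg_closed_field, field_char_0} puiseux_hat"
  shows "berk_mult (disk_point a (radius s)) = enat (support_lcm a {..<s})"
proof -
  let ?c = "ph_restrict {..<s} a" and ?r = "radius s"
  have fin: "finite (support ?c)" by (rule finite_support_restrict[of _ s]) auto
  have zero: "ph_nth (\<sigma> ?c) q = 0" if "\<sigma> \<in> puiseux_gal" "s \<le> q" for \<sigma> q
    using puiseux_gal_nth_eq_0_iff[OF that(1) fin] that(2) by (simp add: ph_nth_restrict)
  have "inj_on (\<lambda>g. disk_point g ?r) ((\<lambda>\<sigma>. \<sigma> ?c) ` puiseux_gal)"
  proof (rule inj_onI, clarify)
    fix \<sigma> \<tau> :: "'a puiseux_hat \<Rightarrow> 'a puiseux_hat"
    assume gal: "\<sigma> \<in> puiseux_gal" "\<tau> \<in> puiseux_gal" and "disk_point (\<sigma> ?c) ?r = disk_point (\<tau> ?c) ?r"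
    then have "\<forall>q<s. ph_nth (\<sigma> ?c) q = ph_nth (\<tau> ?c) q"
      by (simp add: disk_point_eq_iff ph_abs_le_iff[OF rho_pos rho_less_1])
    moreover have "ph_nth (\<sigma> ?c) q = ph_nth (\<tau> ?c) q" if "\<not> q < s" for q
      using zero[OF gal(1)] zero[OF gal(2)] that by simp
    ultimately show "\<sigma> ?c = \<tau> ?c" by (intro ph_eqI) blast
  qed
  moreover have "(\<lambda>\<sigma>. gal_act \<sigma> (disk_point a ?r)) ` puiseux_gal = (\<lambda>g. disk_point g ?r) ` (\<lambda>\<sigma>. \<sigma> ?c) ` puiseux_gal"
    unfolding disk_point_restrict[of a s] by (auto simp: gal_act_disk_point image_image)
  ultimately show ?thesis
    by (simp add: berk_mult_eq card_image card_conjugates card_conjugates_finite fin support_lcm_restrict)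
qed

text \<open>
  An automorphism that fixes a point of an open disk of radius \<open>\<bar>x\<bar>\<^sup>s\<close> fixes the disk, that is, the
  terms of exponent at most \<open>s\<close> of its centre.
\<close>

lemma support_lcm_dvd_berk_mult:
  fixes b :: "'a::{alg_closed_field, field_char_0} puiseux_hat"
  assumes "\<zeta> \<in> open_disk b (radius s)"
  shows "enat (support_lcm b {..s}) dvd berk_mult \<zeta>"
proof (cases "finite ((\<lambda>\<sigma>. gal_act \<sigma> \<zeta>) ` puiseux_gal)")
  case True
  obtain \<nu> where \<zeta>: "\<zeta> = Some \<nu>" and \<nu>: "\<nu> \<in> seminorms" "\<nu> [:- b, 1:] < radius s"
    using assms by (cases \<zeta>) auto
  let ?c = "ph_restrict {..s} b"
  have fin: "finite (support ?c)" by (rule finite_support_restrict[of _ s]) auto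
  have "card ((\<lambda>\<sigma>. \<sigma> ?c) ` puiseux_gal) dvd card ((\<lambda>\<sigma>. gal_act \<sigma> \<zeta>) ` puiseux_gal)"
  proof (rule card_orbit_dvd)
    fix \<sigma> :: "'a puiseux_hat \<Rightarrow> 'a puiseux_hat" assume \<sigma>: "\<sigma> \<in> puiseux_gal" "gal_act \<sigma> \<zeta> = gal_act id \<zeta>"
    then have "gal_seminorm \<sigma> \<nu> = \<nu>" by (simp add: \<zeta> gal_act_Some del: gal_act_id) (simp add: gal_seminorm_def[abs_def])
    then have "\<nu> [:- inv \<sigma> b, 1:] = \<nu> [:- b, 1:]" using gal_seminorm_linear[OF \<sigma>(1), of \<nu> b] by simp
    then have "ph_abs \<rho> (inv \<sigma> b - b) < radius s"
      using seminorm_center_le(2)[OF \<nu>(1), of "inv \<sigma> b" b] \<nu>(2) by simp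
    moreover have "\<sigma> (inv \<sigma> b - b) = b - \<sigma> b" using \<sigma>(1) by (simp add: puiseux_galD)
    ultimately have "ph_abs \<rho> (b - \<sigma> b) < radius s" using ph_abs_puiseux_gal[OF \<sigma>(1)] by metis
    then have 1: "ph_nth b q = ph_nth (\<sigma> b) q" if "q \<le> s" for q
      using that unfolding ph_abs_less_iff by simp
    have "ph_abs \<rho> (b - ?c) < radius s" unfolding ph_abs_less_iff by (simp add: ph_nth_restrict)
    then have "ph_abs \<rho> (\<sigma> b - \<sigma> ?c) < radius s"
      using ph_abs_puiseux_gal[OF \<sigma>(1), of "b - ?c"] puiseux_galD(9)[OF \<sigma>(1)] by simp
    then have 2: "ph_nth (\<sigma> b) q = ph_nth (\<sigma> ?c) q" if "q \<le> s" for q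
      using that unfolding ph_abs_less_iff by simp
    have "ph_nth (\<sigma> ?c) q = ph_nth ?c q" for q
    proof (cases "q \<le> s")
      case True
      then show ?thesis using 1[OF True] 2[OF True] by (simp add: ph_nth_restrict)
    next
      case False
      then show ?thesis using puiseux_gal_nth_eq_0_iff[OF \<sigma>(1) fin, of q] by (simp add: ph_nth_restrict)
    qed
    then show "\<sigma> ?c = id ?c" by (simp add: ph_eqI)
  qed (use True in \<open>simp_all add: gal_act_comp\<close>)
  then show ?thesis
    using True by (simp add: berk_mult_eq card_conjugates[OF fin] support_lcm_restrict enat_dvd_enat_iff)
next
  case False
  have "support_lcm b {..s} \<noteq> 0" using support_lcm_pos[of "{..s}" s b] by simp
  then show ?thesis using False by (simp only: berk_mult_eq if_False) (simp add: dvd_infinity zero_enat_def)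
qed

lemma berk_mult_nonzero: "berk_mult \<zeta> \<noteq> 0"
proof -
  have "(\<lambda>\<sigma>. gal_act \<sigma> \<zeta>) ` puiseux_gal \<noteq> {}" using id_puiseux_gal by blast
  then show ?thesis by (auto simp: berk_mult_eq zero_enat_def card_eq_0_iff)
qed

lemma berk_mult_dvd_gen_mult: "berk_mult \<zeta> dvd gen_mult \<rho> \<zeta>"
  using berk_mult_nonzero[of \<zeta>]
  by (auto simp: gen_mult_def dvd_infinity enat_dvd_enat_iff split: enat.splits)

lemma gen_mult_nonzero: "gen_mult \<rho> \<zeta> \<noteq> 0"
  using berk_mult_nonzero[of \<zeta>] denom_pos[of "log_diam \<rho> \<zeta>"]
  by (auto simp: gen_mult_def zero_enat_def denom_def lcm_eq_0_iff split: enat.splits)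

lemma gen_mult_disk_point:
  fixes a :: "'a::{alg_closed_field, field_char_0} puiseux_hat"
  shows "gen_mult \<rho> (disk_point a (radius s)) = enat (lcm (support_lcm a {..<s}) (denom s))"
proof -
  let ?\<zeta> = "disk_point a (radius s)"
  have "\<not> type_I \<rho> ?\<zeta>"
    unfolding type_I_iff disk_point_def using eval_norm_ne_disk_seminorm[of "radius s"]
    by (metis option.inject option.distinct(1) powr_rho_pos)
  moreover have "type_II \<rho> ?\<zeta>" unfolding type_II_iff by blast
  ultimately show ?thesis
    by (simp add: gen_mult_def berk_mult_disk_point log_diam_disk_point denom_def)
qed

lemma gen_mult_disk_point_irrational:
  fixes a :: "'a::{alg_closed_field, field_char_0} puiseux_hat"
  assumes "0 < r" "\<And>s. r \<noteq> radius s"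
  shows "gen_mult \<rho> (disk_point a r) = \<infinity>"
proof -
  have "\<not> type_I \<rho> (disk_point a r)"
    unfolding type_I_iff disk_point_def using eval_norm_ne_disk_seminorm[OF assms(1)]
    by (metis option.inject option.distinct(1))
  moreover have "\<not> type_II \<rho> (disk_point a r)"
    unfolding type_II_iff using assms by (auto simp: disk_point_eq_iff)
  ultimately show ?thesis by (simp add: gen_mult_def)
qed

lemma farey_b_disk_point:
  fixes a :: "'a::{alg_closed_field, field_char_0} puiseux_hat"
  shows "farey_b \<rho> (disk_point a (radius s)) = lcm (support_lcm a {..<s}) (denom s)"
  by (simp add: farey_b_def gen_mult_disk_point)

lemma farey_a_disk_point:
  fixes a :: "'a::{alg_closed_field, field_char_0} puiseux_hat" and s :: rat
  defines "\<zeta> \<equiv> disk_point a (radius s)"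
  shows "of_int (farey_a \<rho> \<zeta>) = of_nat (farey_b \<rho> \<zeta>) * s"
proof -
  let ?b = "farey_b \<rho> \<zeta>"
  have b: "0 < ?b"
    unfolding \<zeta>_def farey_b_disk_point by (intro lcm_pos_nat support_lcm_pos[of _ s]) auto
  have "denom s dvd ?b" unfolding \<zeta>_def farey_b_disk_point by simp
  then obtain i where i: "s = of_int i / of_nat ?b" using denom_dvdE b by blast
  have conv: "disk_norm \<rho> \<gamma> (\<rho> powr (of_int j / of_nat ?b)) = disk_point \<gamma> (radius (of_int j / of_nat ?b))"
    for \<gamma> :: "'a puiseux_hat" and j
    using disk_norm_eq_disk_point[of \<gamma> "of_int j / of_nat ?b"] by (simp add: of_rat_divide)
  have "farey_a \<rho> \<zeta> = i"
    unfolding farey_a_def conv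
  proof (rule the_equality)
    show "\<exists>\<gamma>. \<zeta> = disk_point \<gamma> (radius (of_int i / of_nat ?b))"
      using i unfolding \<zeta>_def by metis
    fix j assume "\<exists>\<gamma>. \<zeta> = disk_point \<gamma> (radius (of_int j / of_nat ?b))"
    then have "s = of_int j / of_nat ?b" unfolding \<zeta>_def by (auto simp: disk_point_eq_iff)
    then show "j = i" using i b by simp
  qed
  then show ?thesis using i b by (simp add: field_simps)
qed

section \<open>Paths and intervals\<close>

lemma disk_point_in_line [simp]: "0 < r \<Longrightarrow> disk_point a r \<in> topspace line"
  by (simp add: disk_point_def)

lemma disk_point_in_beyond: "0 < r \<Longrightarrow> disk_point b r \<in> beyond a R \<longleftrightarrow> R < max (ph_abs \<rho> (b - a)) r"
  by (simp add: disk_point_def disk_seminorm_linear)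

lemma disk_point_in_open_disk: "0 < r \<Longrightarrow> disk_point b r \<in> open_disk a R \<longleftrightarrow> max (ph_abs \<rho> (b - a)) r < R"
  by (simp add: disk_point_def disk_seminorm_linear)

lemma continuous_disk_points:
  assumes "continuous_on T g" "\<And>t. t \<in> T \<Longrightarrow> 0 \<le> g t"
  shows "continuous_map (top_of_set T) line (\<lambda>t. disk_point a (g t))"
proof -
  have "continuous_map (top_of_set T) (top_of_set {0..}) g" using assms by auto
  from continuous_map_compose[OF this flow_continuous_map[OF eval_norm_seminorm, of "{0..}" a]]
  show ?thesis by (simp add: o_def disk_point_def)
qed

lemma berk_interval_commute: "berk_interval \<rho> \<alpha> \<beta> = berk_interval \<rho> \<beta> \<alpha>"
proof -
  have "berk_interval \<rho> \<alpha> \<beta> \<subseteq> berk_interval \<rho> \<beta> \<alpha>" for \<alpha> \<beta> :: "'a berk"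
  proof
    fix \<zeta> assume "\<zeta> \<in> berk_interval \<rho> \<alpha> \<beta>"
    then obtain p t where p: "pathin line p" "inj_on p {0..1}" "p 0 = \<alpha>" "p 1 = \<beta>" "0 < t" "t < 1" "\<zeta> = p t"
      unfolding berk_interval_def by blast
    have "continuous_map (top_of_set {0..1}) (top_of_set {0..1}) (\<lambda>t::real. 1 - t)"
      by (auto intro!: continuous_intros)
    from continuous_map_compose[OF this p(1)[unfolded pathin_def]]
    have "pathin line (\<lambda>t. p (1 - t))" by (simp add: pathin_def o_def)
    moreover have "inj_on (\<lambda>t. p (1 - t)) {0..1}"
      by (rule inj_onI) (use inj_onD[OF p(2)] in force)
    ultimately show "\<zeta> \<in> berk_interval \<rho> \<beta> \<alpha>"
      unfolding berk_interval_def using p(3-7)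
      by (intro CollectI exI[of _ "\<lambda>t. p (1 - t)"] exI[of _ "1 - t"]) simp
  qed
  then show ?thesis by blast
qed

lemma disk_point_in_interval:
  fixes a :: "'a::alg_closed_field puiseux_hat"
  assumes "0 < r0" "r0 < r" "r < r1"
  shows "disk_point a r \<in> berk_interval \<rho> (disk_point a r0) (disk_point a r1)"
proof -
  define g where "g t = r0 + t * (r1 - r0)" for t
  define p where "p t = disk_point a (g t)" for t
  have pos: "0 < g t" if "0 \<le> t" for t unfolding g_def using assms that by (simp add: add_pos_nonneg)
  have "pathin line p"
    unfolding pathin_def p_def
    by (rule continuous_disk_points) (auto simp: g_def intro!: continuous_intros add_nonneg_nonneg less_imp_le[OF pos[unfolded g_def]])
  moreover have "inj_on p {0..1}"
    using assms pos by (auto intro!: inj_onI simp: p_def disk_point_eq_iff g_def)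
  moreover have "p 0 = disk_point a r0" "p 1 = disk_point a r1" by (simp_all add: p_def g_def)
  moreover have "disk_point a r = p ((r - r0) / (r1 - r0))" using assms by (simp add: p_def g_def)
  moreover have "0 < (r - r0) / (r1 - r0)" "(r - r0) / (r1 - r0) < 1" using assms by auto
  ultimately show ?thesis unfolding berk_interval_def by blast
qed

text \<open>
  The path through the points \<open>\<zeta>(a,r0/(1-t))\<close> has infinity as its limit for \<open>t \<longrightarrow> 1\<close>.
\<close>

lemma disk_point_in_interval_to_infinity:
  fixes a :: "'a::alg_closed_field puiseux_hat"
  assumes "0 < r0" "r0 < r"
  shows "disk_point a r \<in> berk_interval \<rho> (disk_point a r0) None"
proof -
  define p where "p t = (if t < 1 then disk_point a (r0 / (1 - t)) else None)" for t
  have cont: "continuous_map (top_of_set {0..<1}) line (\<lambda>t. disk_point a (r0 / (1 - t)))"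
    using assms by (intro continuous_disk_points) (auto intro!: continuous_intros)
  have "pathin line p"
    unfolding pathin_def continuous_map_def
  proof (intro conjI allI impI)
    show "p \<in> topspace (top_of_set {0..1}) \<rightarrow> topspace line"
      using assms by (auto simp: p_def)
    fix V :: "'a berk set" assume V: "openin line V"
    let ?A = "{t \<in> {0..<1}. disk_point a (r0 / (1 - t)) \<in> V}"
    have "openin (top_of_set {0..<1}) ?A"
      using cont V unfolding continuous_map_def by auto
    moreover have "openin (top_of_set {0..1}) {0..<1::real}"
      using openin_open_Int[of "{..<1::real}" "{0..1}"] by (simp add: Int_def atLeastLessThan_def conj_commute)
        (metis (no_types, lifting) Collect_cong atLeastAtMost_iff atLeastLessThan_iff less_imp_le mem_Collect_eq set_eq_iff)
    ultimately have A: "openin (top_of_set {0..1}) ?A" by (rule openin_trans)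
    show "openin (top_of_set {0..1}) {t \<in> topspace (top_of_set {0..1}). p t \<in> V}"
    proof (cases "None \<in> V")
      case False
      then have "{t \<in> topspace (top_of_set {0..1}). p t \<in> V} = ?A" by (auto simp: p_def split: if_splits)
      then show ?thesis using A by simp
    next
      case True
      then obtain R where R: "beyond a R \<subseteq> V" using neighbourhood_of_infinity V by metis
      \<comment> \<open>The radius \<open>r0 / (1 - t)\<close> exceeds \<open>R\<close> as soon as \<open>t\<close> is closer than \<open>d\<close> to 1.\<close>
      define d where "d = r0 / (max R 0 + r0)"
      have d: "0 < d" using assms by (simp add: d_def)
      have "{t \<in> topspace (top_of_set {0..1}). p t \<in> V} = ?A \<union> ({0..1} \<inter> {1 - d<..})"
      proof (intro set_eqI iffI)
        fix t assume "t \<in> {t \<in> topspace (top_of_set {0..1}). p t \<in> V}"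
        then show "t \<in> ?A \<union> ({0..1} \<inter> {1 - d<..})" using d by (auto simp: p_def split: if_splits)
      next
        fix t assume t: "t \<in> ?A \<union> ({0..1} \<inter> {1 - d<..})"
        have "p t \<in> V" if t: "0 \<le> t" "t < 1" "1 - d < t"
        proof -
          have "(1 - t) * (max R 0 + r0) < r0"
            using t(3) assms by (simp add: d_def field_simps)
          then have "max R 0 + r0 < r0 / (1 - t)" using t by (simp add: field_simps)
          then have "R < r0 / (1 - t)" using assms by simp
          moreover have "0 < r0 / (1 - t)" using assms t by simp
          ultimately have "disk_point a (r0 / (1 - t)) \<in> beyond a R" by (simp add: disk_point_in_beyond)
          then show ?thesis using R t by (auto simp: p_def)
        qed
        then show "t \<in> {t \<in> topspace (top_of_set {0..1}). p t \<in> V}"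
          using t True by (cases "t < 1") (auto simp: p_def)
      qed
      moreover have "openin (top_of_set {0..1}) ({0..1} \<inter> {1 - d<..})" by (rule openin_open_Int) simp
      ultimately show ?thesis using A by (simp add: openin_Un)
    qed
  qed
  moreover have "inj_on p {0..1}"
  proof (rule inj_onI)
    fix s t assume st: "s \<in> {0..1}" "t \<in> {0..1}" "p s = p t"
    have "0 < r0 / (1 - u)" if "u < 1" for u using that assms by simp
    then show "s = t"
      using st assms by (auto simp: p_def disk_point_eq_iff disk_point_def[of _ "r0 / _"] split: if_splits)
        (auto simp: disk_seminorm_eq_iff field_simps)
  qed
  moreover have "p 0 = disk_point a r0" "p 1 = None" by (simp_all add: p_def)
  moreover have "disk_point a r = p (1 - r0 / r)" using assms by (simp add: p_def)
  moreover have "0 < 1 - r0 / r" "1 - r0 / r < 1" using assms by auto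
  ultimately show ?thesis unfolding berk_interval_def by blast
qed

text \<open>
  The path goes up from \<open>\<zeta>(a,r0)\<close> with centre \<open>a\<close>, and down to \<open>\<zeta>(b,r1)\<close> with centre \<open>b\<close>.
\<close>

lemma join_in_interval:
  fixes a b :: "'a::alg_closed_field puiseux_hat"
  assumes r: "0 < r0" "0 < r1" "r0 < ph_abs \<rho> (a - b)" "r1 < ph_abs \<rho> (a - b)"
  shows "disk_point a (ph_abs \<rho> (a - b)) \<in> berk_interval \<rho> (disk_point a r0) (disk_point b r1)"
proof -
  define R where "R = ph_abs \<rho> (a - b)"
  note r = r[folded R_def]
  define g where "g t = r0 + 2 * t * (R - r0)" for t
  define h where "h t = R - (2 * t - 1) * (R - r1)" for t
  define p where "p t = (if t \<le> 1 / 2 then disk_point a (g t) else disk_point b (h t))" for t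
  have g: "0 < g t" "g t \<le> R" if "0 \<le> t" "t \<le> 1 / 2" for t
  proof -
    have "2 * t * (R - r0) \<le> 1 * (R - r0)" using that r by (intro mult_right_mono) auto
    then show "g t \<le> R" by (simp add: g_def)
    show "0 < g t" using that r by (simp add: g_def add_pos_nonneg)
  qed
  have h: "0 < h t" "h t \<le> R" "1 / 2 < t \<Longrightarrow> h t < R" if "1 / 2 \<le> t" "t \<le> 1" for t
  proof -
    have "(2 * t - 1) * (R - r1) \<le> 1 * (R - r1)" using that r by (intro mult_right_mono) auto
    also have "\<dots> < R" using r by simp
    finally show "0 < h t" unfolding h_def by (rule diff_gt_0_iff_gt[THEN iffD2])
    show "h t \<le> R" using that r by (simp add: h_def)
    show "h t < R" if "1 / 2 < t" using that r by (simp add: h_def)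
  qed
  have mid: "disk_point a R = disk_point b R" using r by (simp add: disk_point_eq_iff R_def)
  have "pathin line p"
    unfolding pathin_def p_def
  proof (rule continuous_map_cases_le)
    show "continuous_map (subtopology (top_of_set {0..1}) {x \<in> topspace (top_of_set {0..1}). x \<le> 1 / 2}) line (\<lambda>t. disk_point a (g t))"
      unfolding subtopology_subtopology
    proof (rule continuous_disk_points)
      show "continuous_on ({0..1} \<inter> {x \<in> topspace (top_of_set {0..1}). x \<le> 1 / 2}) g"
        unfolding g_def by (intro continuous_intros)
    qed (use g in \<open>auto intro: less_imp_le\<close>)
    show "continuous_map (subtopology (top_of_set {0..1}) {x \<in> topspace (top_of_set {0..1}). 1 / 2 \<le> x}) line (\<lambda>t. disk_point b (h t))"
      unfolding subtopology_subtopology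
    proof (rule continuous_disk_points)
      show "continuous_on ({0..1} \<inter> {x \<in> topspace (top_of_set {0..1}). 1 / 2 \<le> x}) h"
        unfolding h_def by (intro continuous_intros)
    qed (use h in \<open>auto intro: less_imp_le\<close>)
    show "disk_point a (g x) = disk_point b (h x)" if "x = 1 / 2" for x
      using mid by (simp add: that g_def h_def)
  qed auto
  moreover have "inj_on p {0..1}"
  proof (rule inj_onI)
    fix s t assume st: "s \<in> {0..1}" "t \<in> {0..1}" "p s = p t"
    have cross: "disk_point a (g u) \<noteq> disk_point b (h v)" if "0 \<le> u" "u \<le> 1 / 2" "1 / 2 < v" "v \<le> 1" for u v
      using g[of u] h[of v] that by (auto simp: disk_point_eq_iff R_def)
    show "s = t"
    proof (cases "s \<le> 1 / 2"; cases "t \<le> 1 / 2")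
      assume "s \<le> 1 / 2" "t \<le> 1 / 2"
      then have "g s = g t" using st g[of s] by (auto simp: p_def disk_point_eq_iff)
      then show ?thesis using r by (simp add: g_def)
    next
      assume "\<not> s \<le> 1 / 2" "\<not> t \<le> 1 / 2"
      then have "h s = h t" using st h[of s] by (auto simp: p_def disk_point_eq_iff)
      then show ?thesis using r by (simp add: h_def)
    next
      assume "s \<le> 1 / 2" "\<not> t \<le> 1 / 2"
      then show ?thesis using cross[of s t] st by (auto simp: p_def)
    next
      assume "\<not> s \<le> 1 / 2" "t \<le> 1 / 2"
      then show ?thesis using cross[of t s] st by (auto simp: p_def)
    qed
  qed
  moreover have "p 0 = disk_point a r0" "p 1 = disk_point b r1" "p (1 / 2) = disk_point a R"
    by (simp_all add: p_def g_def h_def)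
  ultimately show ?thesis
    unfolding berk_interval_def R_def[symmetric]
    by (intro CollectI exI[of _ p] exI[of _ "1 / 2"]) auto
qed

lemma connectedin_path_image: "pathin line p \<Longrightarrow> T \<subseteq> {0..1} \<Longrightarrow> connected T \<Longrightarrow> connectedin line (p ` T)"
  unfolding pathin_def by (rule connectedin_continuous_map_image) (auto simp: connectedin_subtopology)

text \<open>
  The path without its ends is a connected set that abuts on both ends, just as an annulus does.  Hence
  \<open>open_annulus_bound\<close> applies to both.
\<close>

lemma interval_in_connected:
  assumes "\<zeta> \<in> berk_interval \<rho> \<alpha> \<beta>"
  obtains C where "connectedin line C" "\<zeta> \<in> C" "\<alpha> \<notin> C" "\<beta> \<notin> C" "\<alpha> \<in> line closure_of C" "\<beta> \<in> line closure_of C"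
proof -
  obtain p t where p: "pathin line p" "inj_on p {0..1}" "p 0 = \<alpha>" "p 1 = \<beta>" "0 < t" "t < 1" "\<zeta> = p t"
    using assms unfolding berk_interval_def by blast
  let ?C = "p ` {0<..<1}"
  have "connectedin line ?C" using p(1) by (rule connectedin_path_image) auto
  moreover have "\<zeta> \<in> ?C" using p by auto
  moreover have "\<alpha> \<notin> ?C" "\<beta> \<notin> ?C" using p(3,4) inj_onD[OF p(2)] by force+
  moreover have "p ` {0..1} \<subseteq> line closure_of ?C"
  proof -
    have "{0..1} \<inter> {0<..<1::real} = {0<..<1}" by auto
    then have "(top_of_set {0..1}) closure_of {0<..<1::real} = {0..1}"
      by (simp add: closure_of_subtopology)
    then show ?thesis
      using continuous_map_image_closure_subset[OF p(1)[unfolded pathin_def], of "{0<..<1}"] by simp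
  qed
  ultimately show thesis using that p(3,4) by (metis atLeastAtMost_iff image_subset_iff order_refl zero_le_one)
qed

lemma disjoint_neighbourhood_of_closure:
  assumes "\<alpha> \<in> line closure_of C" "openin line V" "\<alpha> \<in> V" "C \<subseteq> W" "V \<inter> W = {}"
  shows False
  using assms unfolding in_closure_of by blast

text \<open>
  In each direction at one end that does not lead to the other end, a set could not abut on the latter.
\<close>

lemma open_annulus_bound:
  fixes a :: "'a::alg_closed_field puiseux_hat"
  assumes r: "0 < r0" "r0 < r1" and C: "connectedin line C"
    and notin: "disk_point a r0 \<notin> C" "disk_point a r1 \<notin> C"
    and cl: "disk_point a r0 \<in> line closure_of C" "disk_point a r1 \<in> line closure_of C"
  shows "C \<subseteq> beyond a r0 \<inter> open_disk a r1"
proof -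
  have "C \<subseteq> beyond a r0"
  proof (rule connected_in_one_direction[OF r(1) C notin(1)])
    fix c assume c: "ph_abs \<rho> (c - a) \<le> r0" "C \<subseteq> open_disk c r0"
    have "disk_point a r1 \<in> beyond a r0" using r by (simp add: disk_point_in_beyond)
    then show ?thesis
      using disjoint_neighbourhood_of_closure[OF cl(2) openin_beyond _ c(2)] beyond_disjoint_open_disk[OF c(1)]
      by blast
  qed
  moreover have "C \<subseteq> open_disk a r1"
  proof (rule connected_in_one_direction[OF _ C notin(2)])
    have in_disk: "disk_point a r0 \<in> open_disk a r1" using r by (simp add: disk_point_in_open_disk)
    have disj: "open_disk a r1 \<inter> beyond a r1 = {}" using beyond_disjoint_open_disk[of a a r1] r by auto
    show ?thesis if "C \<subseteq> beyond a r1"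
      using disjoint_neighbourhood_of_closure[OF cl(1) openin_open_disk in_disk that disj] by blast
    fix c assume c: "ph_abs \<rho> (c - a) \<le> r1" "C \<subseteq> open_disk c r1"
    have "open_disk a r1 \<inter> open_disk c r1 \<noteq> {}"
      using disjoint_neighbourhood_of_closure[OF cl(1) openin_open_disk in_disk c(2)] by blast
    then show ?thesis using c(2) open_disk_nested[of _ c r1 a r1] by blast
  qed (use r in simp)
  ultimately show ?thesis by blast
qed

lemma beyond_bound:
  fixes a b :: "'a::alg_closed_field puiseux_hat"
  assumes r: "0 < r0" "0 < r1" "r0 < ph_abs \<rho> (a - b)" and C: "connectedin line C"
    and notin: "disk_point a r0 \<notin> C" and cl: "disk_point b r1 \<in> line closure_of C"
  shows "C \<subseteq> beyond a r0"
proof (rule connected_in_one_direction[OF r(1) C notin])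
  fix c assume c: "ph_abs \<rho> (c - a) \<le> r0" "C \<subseteq> open_disk c r0"
  have "disk_point b r1 \<in> beyond a r0" using r by (simp add: disk_point_in_beyond ph_abs_commute)
  then show ?thesis
    using disjoint_neighbourhood_of_closure[OF cl openin_beyond _ c(2)] beyond_disjoint_open_disk[OF c(1)]
    by blast
qed

lemma berk_less_disk_points_iff:
  fixes a b :: "'a::alg_closed_field puiseux_hat"
  assumes r: "0 < r0" "0 < r1"
  shows "berk_less \<rho> (disk_point a r0) (disk_point b r1) \<longleftrightarrow> r0 < r1 \<and> ph_abs \<rho> (a - b) \<le> r1"
proof
  assume "r0 < r1 \<and> ph_abs \<rho> (a - b) \<le> r1"
  moreover from this have "disk_point b r1 = disk_point a r1"
    using r by (simp add: disk_point_eq_iff ph_abs_commute)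
  ultimately show "berk_less \<rho> (disk_point a r0) (disk_point b r1)"
    using disk_point_in_interval_to_infinity[of r0 r1 a] r by (simp add: berk_less_def disk_point_def)
next
  assume "berk_less \<rho> (disk_point a r0) (disk_point b r1)"
  then obtain p t where p: "pathin line p" "inj_on p {0..1}" "p 0 = disk_point a r0" "p 1 = None"
      "0 < t" "t < 1" "disk_point b r1 = p t"
    unfolding berk_less_def berk_interval_def by (auto simp: disk_point_def)
  have "disk_point b r1 \<in> beyond a r0"
  proof (rule connected_in_one_direction[OF r(1), of "p ` {0<..1}" a])
    show "connectedin line (p ` {0<..1})" using p(1) by (rule connectedin_path_image) auto
    show "disk_point a r0 \<notin> p ` {0<..1}" using p(3) inj_onD[OF p(2)] by force
    have mem: "None \<in> p ` {0<..1}" by (rule image_eqI[of _ _ 1]) (simp_all add: p(4))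
    show "disk_point b r1 \<in> beyond a r0" if "p ` {0<..1} \<subseteq> beyond a r0" using that p(5-7) by auto
    show "disk_point b r1 \<in> beyond a r0" if "p ` {0<..1} \<subseteq> open_disk c r0" for c using subsetD[OF that mem] by simp
  qed
  then have lt: "r0 < max (ph_abs \<rho> (b - a)) r1" using r by (simp add: disk_point_in_beyond)
  have "ph_abs \<rho> (a - b) \<le> r1"
  proof (rule ccontr)
    assume far: "\<not> ph_abs \<rho> (a - b) \<le> r1"
    define R where "R = ph_abs \<rho> (a - b)"
    \<comment> \<open>A path from the first point over the second to infinity would pass twice through their join.\<close>
    let ?J = "disk_point a R"
    have R: "r1 < R" "r0 < R" "0 < R"
      using far lt r ph_abs_commute[of a b] unfolding R_def by auto
    have "?J \<in> p ` {0..t}"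
    proof (rule ccontr)
      assume J: "?J \<notin> p ` {0..t}"
      have mem: "disk_point a r0 \<in> p ` {0..t}" "disk_point b r1 \<in> p ` {0..t}"
        by (rule image_eqI[of _ _ 0], simp_all add: p(3,5) less_imp_le)
          (rule image_eqI[of _ _ t], simp_all add: p(5,7) less_imp_le)
      show False
      proof (rule connected_in_one_direction[OF R(3) _ J])
        show "connectedin line (p ` {0..t})" using p by (intro connectedin_path_image) auto
        show False if "p ` {0..t} \<subseteq> beyond a R"
          using subsetD[OF that mem(1)] R r by (simp add: disk_point_in_beyond)
        show False if "p ` {0..t} \<subseteq> open_disk c R" for c
        proof -
          have "ph_abs \<rho> (a - c) < R" "ph_abs \<rho> (b - c) < R"
            using subsetD[OF that mem(1)] subsetD[OF that mem(2)] r by (simp_all add: disk_point_in_open_disk)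
          moreover have "ph_abs \<rho> (a - b) \<le> max (ph_abs \<rho> (a - c)) (ph_abs \<rho> (b - c))"
            using ph.diff_le[of "a - c" "b - c"] by simp
          ultimately show False unfolding R_def by auto
        qed
      qed
    qed
    moreover have "?J \<in> p ` {t..1}"
    proof (rule ccontr)
      assume J: "?J \<notin> p ` {t..1}"
      have mem: "None \<in> p ` {t..1}" "disk_point b r1 \<in> p ` {t..1}"
        by (rule image_eqI[of _ _ 1], simp_all add: p(4,6) less_imp_le)
          (rule image_eqI[of _ _ t], simp_all add: p(6,7) less_imp_le)
      show False
      proof (rule connected_in_one_direction[OF R(3) _ J])
        show "connectedin line (p ` {t..1})" using p by (intro connectedin_path_image) auto
        show False if "p ` {t..1} \<subseteq> beyond a R"
          using subsetD[OF that mem(2)] R r by (simp add: disk_point_in_beyond R_def ph_abs_commute)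
        show False if "p ` {t..1} \<subseteq> open_disk c R" for c
          using subsetD[OF that mem(1)] by simp
      qed
    qed
    ultimately obtain t1 t2 where "t1 \<in> {0..t}" "t2 \<in> {t..1}" "p t1 = ?J" "p t2 = ?J" by auto
    then have "p t = ?J" using inj_onD[OF p(2), of t1 t2] p(5,6) by force
    then have "disk_point b r1 = ?J" using p(7) by simp
    then show False using R r by (simp add: disk_point_eq_iff)
  qed
  then show "r0 < r1 \<and> ph_abs \<rho> (a - b) \<le> r1" using lt ph_abs_commute[of a b] by auto
qed

end

section \<open>Farey neighbours\<close>

lemma denom_fraction:
  obtains p where "of_nat (denom q) * q = of_int p" "q = of_int p / of_nat (denom q)" "coprime p (int (denom q))"
proof -
  obtain a b where ab: "quotient_of q = (a, b)" by (cases "quotient_of q")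
  then have b: "int (denom q) = b" using quotient_of_denom_pos[OF ab] by (simp add: denom_def)
  then have q: "q = of_int a / of_nat (denom q)" using quotient_of_div[OF ab] by (metis of_int_of_nat_eq)
  then have "of_nat (denom q) * q = of_int a" using denom_pos[of q] by (simp add: field_simps)
  then show thesis using q quotient_of_coprime[OF ab] b by (intro that[of a]) auto
qed

lemma lcm_denom:
  assumes "0 < M"
  shows "lcm M (denom u) = M * denom (of_nat M * u)"
proof -
  have "lcm M (denom u) dvd n \<longleftrightarrow> M * denom (of_nat M * u) dvd n" for n
  proof (cases "M dvd n")
    case True
    then obtain k where k: "n = M * k" by blast
    have "denom u dvd n \<longleftrightarrow> of_nat k * (of_nat M * u) \<in> \<int>"
      unfolding Ints_mult_iff_denom_dvd[symmetric] k by (simp add: ac_simps)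
    also have "\<dots> \<longleftrightarrow> M * denom (of_nat M * u) dvd n"
      unfolding Ints_mult_iff_denom_dvd k using assms by simp
    finally show ?thesis using True by simp
  next
    case False
    then show ?thesis using dvd_mult_left by auto
  qed
  then show ?thesis by (metis dvd_antisym dvd_refl)
qed

text \<open>
  By Cramer's rule \<open>m\<close> and \<open>n\<close> are the determinants of \<open>u\<close> with the two ends, which are positive.
\<close>

lemma denom_between_neighbours:
  assumes det: "of_nat (denom s * denom t) * (s - t) = (1 :: rat)" and u: "t < u" "u < s"
  obtains m n where "1 \<le> m" "1 \<le> n" "denom u = m * denom s + n * denom t"
proof -
  let ?A = "denom s" and ?B = "denom t" and ?q = "denom u"
  obtain P Q p where As: "of_nat ?A * s = of_int P" "of_nat ?B * t = of_int Q" "of_nat ?q * u = of_int p"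
    by (metis denom_fraction)
  have "(of_int (P * int ?B - Q * int ?A) :: rat) = of_nat (?A * ?B) * (s - t)"
    by (simp add: As[symmetric] algebra_simps)
  then have det': "P * int ?B - Q * int ?A = 1" unfolding det by (metis of_int_1 of_int_eq_iff)
  have "(of_int (p * int ?B - int ?q * Q) :: rat) = of_nat (?q * ?B) * (u - t)"
    by (simp add: As[symmetric] algebra_simps)
  moreover have "0 < of_nat (?q * ?B) * (u - t)" using u by simp
  ultimately have m: "0 < p * int ?B - int ?q * Q" by (metis of_int_0_less_iff)
  have "(of_int (int ?q * P - p * int ?A) :: rat) = of_nat (?q * ?A) * (s - u)"
    by (simp add: As[symmetric] algebra_simps)
  moreover have "0 < of_nat (?q * ?A) * (s - u)" using u by simp
  ultimately have n: "0 < int ?q * P - p * int ?A" by (metis of_int_0_less_iff)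
  have "int ?q = int ?q * (P * int ?B - Q * int ?A)" using det' by simp
  also have "\<dots> = (p * int ?B - int ?q * Q) * int ?A + (int ?q * P - p * int ?A) * int ?B"
    by (simp add: algebra_simps)
  also have "\<dots> = int (nat (p * int ?B - int ?q * Q) * ?A + nat (int ?q * P - p * int ?A) * ?B)"
    using m n by simp
  finally have "?q = nat (p * int ?B - int ?q * Q) * ?A + nat (int ?q * P - p * int ?A) * ?B"
    by (simp only: of_nat_eq_iff)
  then show thesis using that[of "nat (p * int ?B - int ?q * Q)" "nat (int ?q * P - p * int ?A)"] m n by simp
qed

lemma coprime_neighbours:
  assumes "of_nat (denom s * denom t) * (s - t) = (1 :: rat)"
  shows "coprime (denom s) (denom t)"
proof (rule coprimeI)
  fix d assume d: "d dvd denom s" "d dvd denom t"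
  obtain P Q where "of_nat (denom s) * s = of_int P" "of_nat (denom t) * t = of_int Q"
    by (metis denom_fraction)
  then have "(of_int (P * int (denom t) - Q * int (denom s)) :: rat) = of_nat (denom s * denom t) * (s - t)"
    by (simp add: algebra_simps flip: \<open>of_nat (denom s) * s = of_int P\<close> \<open>of_nat (denom t) * t = of_int Q\<close>)
  then have "P * int (denom t) - Q * int (denom s) = 1" unfolding assms by (metis of_int_1 of_int_eq_iff)
  moreover have "int d dvd P * int (denom t) - Q * int (denom s)" using d by (intro dvd_diff dvd_mult) auto
  ultimately show "is_unit d" by simp
qed

text \<open>
  Let the ends be \<open>P/A\<close> and \<open>Q/B\<close> with \<open>D = P B - Q A > 1\<close>.  The parallelogram spanned by the lattice vectors
  \<open>(A,P)\<close> and \<open>(B,Q)\<close> has area \<open>D\<close> and contains a lattice point \<open>(y,x)\<close> that is the sum of \<open>1/D\<close> times the second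
  vector and \<open>l/D\<close> times the first, where \<open>0 < l < D\<close>.  Then \<open>x/y\<close> is strictly between the ends, and
  \<open>y = (l A + B)/D\<close> is at most \<open>max A B\<close>.
\<close>

lemma neighbours_if_denoms_larger:
  assumes "t < s" and larger: "\<And>u. t < u \<Longrightarrow> u < s \<Longrightarrow> max (denom s) (denom t) < denom u"
  shows "of_nat (denom s * denom t) * (s - t) = (1 :: rat)"
proof (rule ccontr)
  assume no: "\<not> ?thesis"
  obtain P where P: "of_nat (denom s) * s = of_int P" "s = of_int P / of_nat (denom s)" "coprime P (int (denom s))"
    by (rule denom_fraction)
  obtain Q where Q: "of_nat (denom t) * t = of_int Q" "t = of_int Q / of_nat (denom t)" "coprime Q (int (denom t))"
    by (rule denom_fraction)
  define A B where "A = int (denom s)" and "B = int (denom t)"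
  have A: "0 < A" and B: "0 < B" unfolding A_def B_def by simp_all
  have s: "s = of_int P / of_int A" and t: "t = of_int Q / of_int B" using P(2) Q(2) by (simp_all add: A_def B_def)
  define D where "D = P * B - Q * A"
  have D: "of_int D = of_nat (denom s * denom t) * (s - t)"
    by (simp add: D_def A_def B_def algebra_simps flip: P(1) Q(1))
  have "0 < of_nat (denom s * denom t) * (s - t)" using assms(1) by simp
  then have "0 < D" unfolding D[symmetric] by simp
  moreover have "D \<noteq> 1" using no unfolding D[symmetric] by simp
  ultimately have "1 < D" by simp
  obtain y0 x0 where b0: "P * y0 + A * x0 = 1"
    using P(3) bezout_int[of P A] by (auto simp: A_def mult.commute)
  define k where "k = (B * (- x0) - Q * y0) div D"
  define x where "x = - x0 - k * P"
  define y where "y = y0 - k * A"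
  define l where "l = B * x - Q * y"
  have bez: "P * y - A * x = 1" using b0 by (simp add: x_def y_def algebra_simps)
  have "l = (B * (- x0) - Q * y0) - k * D" by (simp add: l_def x_def y_def D_def algebra_simps)
  also have "\<dots> = (B * (- x0) - Q * y0) mod D" unfolding k_def by (simp add: minus_div_mult_eq_mod)
  finally have l: "0 \<le> l" "l < D" using \<open>0 < D\<close> by simp_all
  have yD: "y * D = A * l + B * (P * y - A * x)" by (simp add: l_def D_def algebra_simps)
  then have yD: "y * D = A * l + B" unfolding bez by simp
  have "l \<noteq> 0"
  proof
    assume "l = 0"
    then have "B = y * D" "B * x = Q * y" using yD by (simp_all add: l_def)
    moreover have "y \<noteq> 0" using \<open>B = y * D\<close> B by auto
    ultimately have "Q = D * x" by (simp add: mult.commute)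
    then have "D dvd Q" "D dvd B" using \<open>B = y * D\<close> by auto
    then have "D dvd 1" using Q(3) unfolding B_def by (metis coprime_common_divisor)
    then show False using \<open>1 < D\<close> by simp
  qed
  then have "0 < l" using l by simp
  have "0 < y * D" unfolding yD using A B \<open>0 < l\<close> by (simp add: add_pos_pos)
  then have "0 < y" using \<open>0 < D\<close> by (simp add: zero_less_mult_iff)
  have "A * l + B \<le> max A B * (D - 1) + max A B"
    using l A B by (intro add_mono mult_mono) auto
  then have "y * D \<le> max A B * D" unfolding yD by (simp add: algebra_simps)
  then have "y \<le> max A B" using \<open>0 < D\<close> by simp
  define u :: rat where "u = of_int x / of_int y"
  have "(of_int (Q * y) :: rat) < of_int (B * x)" using \<open>0 < l\<close> unfolding l_def of_int_less_iff by simp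
  then have "t < u" unfolding t u_def using B \<open>0 < y\<close> by (simp add: field_simps)
  moreover have "(of_int (A * x) :: rat) < of_int (P * y)" using bez unfolding of_int_less_iff by simp
  then have "u < s" unfolding s u_def using A \<open>0 < y\<close> by (simp add: field_simps)
  ultimately have "max (denom s) (denom t) < denom u" by (rule larger)
  moreover have "denom u \<le> nat y"
  proof -
    have "denom (of_int x / of_nat (nat y)) dvd nat y" using \<open>0 < y\<close> by (intro denom_of_int_div_dvd) simp
    then show ?thesis using \<open>0 < y\<close> unfolding u_def by (auto dest: dvd_imp_le)
  qed
  ultimately show False using \<open>y \<le> max A B\<close> \<open>0 < y\<close> unfolding A_def B_def by linarith
qed

lemma pos_span_commute: "pos_span a b = pos_span b a"
  unfolding pos_span_def by (auto simp: add.commute) (metis add.commute)+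

lemma pos_span_greater: "0 < a \<Longrightarrow> 0 < b \<Longrightarrow> x \<in> pos_span a b \<Longrightarrow> max a b < x"
proof -
  assume ab: "0 < a" "0 < b" and "x \<in> pos_span a b"
  then obtain m n where x: "x = m * a + n * b" "1 \<le> m" "1 \<le> n" unfolding pos_span_def by blast
  have "1 * a \<le> m * a" "1 * b \<le> n * b" using x by (auto intro!: mult_le_mono1)
  then have "a < m * a + n * b" "b < m * a + n * b" using ab by linarith+
  then show ?thesis by (simp add: x(1))
qed

lemma pos_span_multiple: "x \<in> pos_span a b \<Longrightarrow> 0 < k \<Longrightarrow> x * k \<in> pos_span a b"
proof -
  assume "x \<in> pos_span a b" and k: "0 < k"
  then obtain m n where x: "x = m * a + n * b" "1 \<le> m" "1 \<le> n" unfolding pos_span_def by blast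
  have "x * k = (m * k) * a + (n * k) * b" by (simp add: x algebra_simps)
  moreover have "1 \<le> m * k" "1 \<le> n * k" using x k by simp_all
  ultimately show ?thesis unfolding pos_span_def by blast
qed

lemma enat_INF_attained:
  fixes f :: "'x \<Rightarrow> enat"
  assumes "U \<noteq> {}"
  obtains \<xi> where "\<xi> \<in> U" "(INF \<xi>\<in>U. f \<xi>) = f \<xi>"
proof -
  have "f ` U \<noteq> {}" using assms by simp
  then have "Inf (f ` U) \<in> f ` U" unfolding Inf_enat_def by (auto intro: LeastI)
  then show thesis using that by auto
qed

text \<open>
  An exponent \<open>v\<close> of \<open>a\<close> between \<open>t\<close> and \<open>s\<close> is impossible, since \<open>b v\<close> would divide \<open>M s\<close>.  Hence \<open>M\<close> is
  constant after \<open>t\<close>, the numbers \<open>b u\<close> are \<open>M s\<close> times the denominators of \<open>M s * u\<close>, and the multiples of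
  \<open>t\<close> and \<open>s\<close> by \<open>M s\<close> are Farey neighbours.
\<close>

lemma denoms_larger_imp_determinant:
  fixes a :: "'a::zero puiseux_hat"
  defines "M \<equiv> \<lambda>u. support_lcm a {..<u}"
  defines "b \<equiv> \<lambda>u. lcm (M u) (denom u)"
  assumes "t < s" and larger: "\<And>u. t < u \<Longrightarrow> u < s \<Longrightarrow> max (b s) (b t) < b u"
  shows "of_nat (b s * b t) * (s - t) = of_nat (gcd (b s) (b t))" "M s = gcd (b s) (b t)"
proof -
  have M0: "0 < M u" for u unfolding M_def by (rule support_lcm_pos[of _ u]) auto
  have M_mono: "M u dvd M v" if "u \<le> v" for u v
    unfolding M_def by (rule support_lcm_mono) (use that in auto)
  have none: "ph_nth a v = 0" if v: "t < v" "v < s" for v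
  proof (rule ccontr)
    assume "ph_nth a v \<noteq> 0"
    then have "denom v dvd M s" unfolding M_def using v by (intro support_lcm_dvd) auto
    then have "b v dvd M s" using M_mono[of v s] v unfolding b_def by simp
    then have "b v dvd b s" unfolding b_def by auto
    moreover have "0 < b s" unfolding b_def using M0 by (simp add: lcm_pos_nat)
    ultimately have "b v \<le> b s" by (rule dvd_imp_le)
    then show False using larger[OF v] by simp
  qed
  have Ms: "M s dvd n" if "M t dvd n" "denom t dvd n" for n
    unfolding M_def support_lcm_dvd_iff
  proof (intro ballI impI)
    fix q assume q: "q \<in> {..<s}" "ph_nth a q \<noteq> 0"
    then have "q < t \<or> q = t" using none[of q] by (cases q t rule: linorder_cases) auto
    then show "denom q dvd n" using that q unfolding M_def support_lcm_dvd_iff by auto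
  qed
  have Mu: "M u = M s" if "t < u" "u \<le> s" for u
    unfolding M_def
  proof (rule support_lcm_cong)
    fix q assume "ph_nth a q \<noteq> 0"
    then have "\<not> (t < q \<and> q < s)" using none by blast
    then show "q \<in> {..<u} \<longleftrightarrow> q \<in> {..<s}" using that by auto
  qed
  let ?M = "M s"
  let ?s = "of_nat ?M * s" and ?t = "of_nat ?M * t"
  have bt: "b t = lcm ?M (denom t)"
    unfolding b_def by (rule dvd_antisym) (use Ms M_mono[of t s] \<open>t < s\<close> in \<open>auto intro: dvd_trans\<close>)
  have bs: "b s = ?M * denom ?s" and bt': "b t = ?M * denom ?t"
    unfolding bt unfolding b_def by (rule lcm_denom[OF M0])+
  have "of_nat (denom ?s * denom ?t) * (?s - ?t) = (1 :: rat)"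
  proof (rule neighbours_if_denoms_larger)
    show "?t < ?s" using \<open>t < s\<close> M0 by simp
    fix v assume v: "?t < v" "v < ?s"
    define u where "u = v / of_nat ?M"
    have u: "t < u" "u < s" using v M0[of s] unfolding u_def by (simp_all add: field_simps)
    have vu: "v = of_nat ?M * u" using M0[of s] by (simp add: u_def)
    have "b u = ?M * denom v" unfolding b_def vu using Mu[of u] u lcm_denom[OF M0] by simp
    then show "max (denom ?s) (denom ?t) < denom v" using larger[OF u] unfolding bs bt' by simp
  qed
  note nb = this
  have "gcd (b s) (b t) = ?M * gcd (denom ?s) (denom ?t)"
    unfolding bs bt' by (rule gcd_mult_distrib_nat[symmetric])
  also have "gcd (denom ?s) (denom ?t) = 1" using coprime_neighbours[OF nb] by (simp only: coprime_iff_gcd_eq_1)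
  finally have g: "gcd (b s) (b t) = ?M" by simp
  then show "M s = gcd (b s) (b t)" by simp
  have "of_nat (b s * b t) * (s - t) = of_nat ?M * (of_nat (denom ?s * denom ?t) * (?s - ?t))"
    unfolding bs bt' by (simp add: algebra_simps)
  then show "of_nat (b s * b t) * (s - t) = of_nat (gcd (b s) (b t))" unfolding nb g by simp
qed

text \<open>
  As \<open>M s\<close> divides \<open>b t\<close>, both ends are \<open>M s\<close> times the denominators of two Farey neighbours.  An exponent
  \<open>v\<close> of \<open>a\<close> in between would make \<open>M s * v\<close> an integer, but denominators between neighbours are at least 2.
\<close>

lemma determinant_imp_pos_span:
  fixes a :: "'a::zero puiseux_hat"
  defines "M \<equiv> \<lambda>u. support_lcm a {..<u}"
  defines "b \<equiv> \<lambda>u. lcm (M u) (denom u)"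
  assumes "t < s" and det: "of_nat (b s * b t) * (s - t) = (of_nat (gcd (b s) (b t)) :: rat)" "M s = gcd (b s) (b t)"
    and u: "t < u" "u < s"
  shows "ph_nth a u = 0" "b u \<in> pos_span (b s) (b t)"
proof -
  have M0: "0 < M u" for u unfolding M_def by (rule support_lcm_pos[of _ u]) auto
  have M_mono: "M u dvd M v" if "u \<le> v" for u v
    unfolding M_def by (rule support_lcm_mono) (use that in auto)
  let ?M = "M s"
  let ?s = "of_nat ?M * s" and ?t = "of_nat ?M * t"
  have "?M dvd b t" unfolding det(2) by simp
  then have bt: "b t = lcm ?M (denom t)"
    using M_mono[of t s] \<open>t < s\<close> by (intro dvd_antisym) (auto simp: b_def intro: dvd_trans)
  have bs: "b s = ?M * denom ?s" and bt': "b t = ?M * denom ?t"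
    unfolding bt unfolding b_def by (rule lcm_denom[OF M0])+
  have "of_nat ?M * (of_nat (denom ?s * denom ?t) * (?s - ?t)) = of_nat (b s * b t) * (s - t)"
    unfolding bs bt' by (simp add: algebra_simps)
  also have "\<dots> = of_nat ?M * 1" unfolding det(1) det(2) by simp
  finally have nb: "of_nat (denom ?s * denom ?t) * (?s - ?t) = (1 :: rat)"
    unfolding mult_cancel_left using M0[of s] by auto
  have between: "\<exists>m n. 1 \<le> m \<and> 1 \<le> n \<and> denom (of_nat ?M * v) = m * denom ?s + n * denom ?t"
    if "t < v" "v < s" for v
    using denom_between_neighbours[OF nb, of "of_nat ?M * v"] that M0[of s] by (metis mult_less_cancel_left_pos of_nat_0_less_iff)
  have none: "ph_nth a v = 0" if v: "t < v" "v < s" for v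
  proof (rule ccontr)
    assume "ph_nth a v \<noteq> 0"
    then have "denom v dvd ?M" unfolding M_def using v by (intro support_lcm_dvd) auto
    then have "lcm ?M (denom v) = ?M" by (simp add: lcm_proj1_if_dvd)
    then have "denom (of_nat ?M * v) = 1" using lcm_denom[OF M0, of s v] M0[of s] by simp
    moreover obtain m n where "1 \<le> m" "1 \<le> n" "denom (of_nat ?M * v) = m * denom ?s + n * denom ?t"
      using between[OF v] by blast
    moreover from this have "1 \<le> m * denom ?s" "1 \<le> n * denom ?t" by (simp_all add: Suc_le_eq)
    ultimately show False by linarith
  qed
  show "ph_nth a u = 0" by (rule none[OF u])
  have "M u = ?M"
    unfolding M_def
  proof (rule support_lcm_cong)
    fix q assume "ph_nth a q \<noteq> 0"
    then have "\<not> (t < q \<and> q < s)" using none by blast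
    then show "q \<in> {..<u} \<longleftrightarrow> q \<in> {..<s}" using u by auto
  qed
  then have "b u = ?M * denom (of_nat ?M * u)" unfolding b_def using lcm_denom[OF M0] by simp
  moreover obtain m n where "1 \<le> m" "1 \<le> n" "denom (of_nat ?M * u) = m * denom ?s + n * denom ?t"
    using between[OF u] by blast
  ultimately have "b u = m * b s + n * b t" "1 \<le> m" "1 \<le> n" unfolding bs bt' by (simp_all add: algebra_simps)
  then show "b u \<in> pos_span (b s) (b t)" unfolding pos_span_def by blast
qed

context puiseux_radius
begin

section \<open>Disk domains\<close>

text \<open>
  Either \<open>U\<close> contains infinity, whose multiplicity is 1, or \<open>U\<close> is an open disk.  In the second case the
  multiplicity of the truncated centre divides that of each point and is attained in \<open>U\<close>.
\<close>

lemma disk_domain_dvd: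
  fixes \<zeta> :: "'a::{alg_closed_field, field_char_0} berk"
  assumes \<Gamma>: "vertex_set \<rho> \<Gamma>" "U \<in> berk_domains \<rho> \<Gamma>" and U: "disk_domain \<rho> \<zeta> U"
    and min: "gen_mult \<rho> \<zeta> = (INF \<xi>\<in>U. berk_mult \<xi>)" and \<xi>: "\<xi> \<in> U"
  shows "gen_mult \<rho> \<zeta> dvd berk_mult \<xi>"
proof -
  note dom = berk_domain_properties[OF \<Gamma>]
  have fr: "line frontier_of U = {\<zeta>}" using U by (simp add: disk_domain_def)
  then have "\<zeta> \<in> \<Gamma>" using dom(4) by blast
  then obtain a s where \<zeta>: "\<zeta> = disk_point a (radius s)" using vertex_set_disk_points[OF \<Gamma>(1)] by blast
  let ?r = "radius s"
  have "disk_point a ?r \<notin> U" using dom(3) \<open>\<zeta> \<in> \<Gamma>\<close> \<zeta> by blast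
  then show ?thesis
  proof (rule connected_in_one_direction[OF powr_rho_pos dom(1)])
    assume out: "U \<subseteq> beyond a ?r"
    have eq: "beyond_all {(a, ?r)} = beyond a ?r"
      using openin_subset[OF openin_beyond] by (auto simp: beyond_all_def)
    have "beyond_all {(a, ?r)} \<subseteq> U"
    proof (rule connected_subset_of_domain[OF connectedin_beyond_all])
      show "beyond_all {(a, ?r)} \<inter> line frontier_of U = {}"
        unfolding eq fr \<zeta> by (simp add: disk_point_in_beyond)
      show "beyond_all {(a, ?r)} \<inter> U \<noteq> {}" unfolding eq using out dom(2) by blast
    qed
    then have "None \<in> U" by auto
    then have "gen_mult \<rho> \<zeta> \<le> berk_mult (None :: 'a berk)" unfolding min by (rule INF_lower)
    then have "gen_mult \<rho> \<zeta> = 1"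
      using gen_mult_nonzero[of \<zeta>] by (cases "gen_mult \<rho> \<zeta>") (auto simp: one_enat_def zero_enat_def)
    then show ?thesis by simp
  next
    fix c assume c: "ph_abs \<rho> (c - a) \<le> ?r" "U \<subseteq> open_disk c ?r"
    have "open_disk c ?r \<subseteq> U"
    proof (rule connected_subset_of_domain[OF connectedin_open_disk])
      show "open_disk c ?r \<inter> line frontier_of U = {}" unfolding fr \<zeta> by (simp add: disk_point_in_open_disk)
      show "open_disk c ?r \<inter> U \<noteq> {}" using c dom(2) by blast
    qed
    let ?c = "ph_restrict {..s} c" and ?N = "support_lcm c {..s}"
    have fin: "finite (support ?c)" by (rule finite_support_restrict[of _ s]) auto
    have "ph_abs \<rho> (?c - c) < ?r" unfolding ph_abs_less_iff by (simp add: ph_nth_restrict)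
    then have "Some (eval_norm ?c) \<in> open_disk c ?r" by (simp add: eval_norm_def)
    then have "Some (eval_norm ?c) \<in> U" using \<open>open_disk c ?r \<subseteq> U\<close> by blast
    then have "gen_mult \<rho> \<zeta> \<le> berk_mult (Some (eval_norm ?c))" unfolding min by (rule INF_lower)
    then have le: "gen_mult \<rho> \<zeta> \<le> enat ?N" by (simp add: berk_mult_eval_norm[OF fin] support_lcm_restrict)
    have N_dvd: "enat ?N dvd berk_mult \<eta>" if "\<eta> \<in> U" for \<eta>
      using that c(2) by (intro support_lcm_dvd_berk_mult) blast
    obtain \<eta> where "\<eta> \<in> U" "gen_mult \<rho> \<zeta> = berk_mult \<eta>" using enat_INF_attained[OF dom(2)] min by metis
    then have N_dvd_g: "enat ?N dvd gen_mult \<rho> \<zeta>" using N_dvd by simp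
    obtain g where g: "gen_mult \<rho> \<zeta> = enat g" using le by (cases "gen_mult \<rho> \<zeta>") auto
    have "g \<noteq> 0" using gen_mult_nonzero[of \<zeta>] unfolding g by (simp add: zero_enat_def)
    then have "?N \<le> g" using N_dvd_g unfolding g enat_dvd_enat_iff by (intro dvd_imp_le) auto
    then have "gen_mult \<rho> \<zeta> = enat ?N" using le unfolding g by simp
    then show ?thesis using N_dvd[OF \<xi>] by simp
  qed
qed


section \<open>Annulus domains\<close>

definition farey_neighbours :: "'a::field berk \<Rightarrow> 'a berk \<Rightarrow> bool" where
  "farey_neighbours \<alpha> \<beta> \<longleftrightarrow> berk_less \<rho> \<alpha> \<beta> \<and>
     farey_a \<rho> \<alpha> * int (farey_b \<rho> \<beta>) - int (farey_b \<rho> \<alpha>) * farey_a \<rho> \<beta>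
       = int (gcd (farey_b \<rho> \<alpha>) (farey_b \<rho> \<beta>)) \<and>
     berk_mult \<alpha> = enat (gcd (farey_b \<rho> \<alpha>) (farey_b \<rho> \<beta>))"

definition larger_gen_mult :: "'a::field berk \<Rightarrow> 'a berk \<Rightarrow> 'a berk set \<Rightarrow> bool" where
  "larger_gen_mult \<alpha> \<beta> V \<longleftrightarrow> (\<forall>\<zeta>\<in>V. max (gen_mult \<rho> \<alpha>) (gen_mult \<rho> \<beta>) < gen_mult \<rho> \<zeta>)"

definition gen_mult_in_span :: "'a::field berk \<Rightarrow> 'a berk \<Rightarrow> 'a berk set \<Rightarrow> bool" where
  "gen_mult_in_span \<alpha> \<beta> V \<longleftrightarrow>
    (\<forall>\<zeta>\<in>V. gen_mult \<rho> \<zeta> \<in> insert \<infinity> (enat ` pos_span (farey_b \<rho> \<alpha>) (farey_b \<rho> \<beta>)))"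

lemma farey_b_disk_point_pos:
  fixes a :: "'a::{alg_closed_field, field_char_0} puiseux_hat"
  shows "0 < farey_b \<rho> (disk_point a (radius s))"
  unfolding farey_b_disk_point by (intro lcm_pos_nat support_lcm_pos[of _ s]) auto

lemma gen_mult_eq_farey_b:
  fixes a :: "'a::{alg_closed_field, field_char_0} puiseux_hat"
  shows "gen_mult \<rho> (disk_point a (radius s)) = enat (farey_b \<rho> (disk_point a (radius s)))"
  by (simp add: gen_mult_disk_point farey_b_disk_point)

lemma span_imp_larger_gen_mult:
  fixes a b :: "'a::{alg_closed_field, field_char_0} puiseux_hat"
  assumes "gen_mult_in_span (disk_point a (radius s)) (disk_point b (radius t)) V"
  shows "larger_gen_mult (disk_point a (radius s)) (disk_point b (radius t)) V"
  unfolding larger_gen_mult_def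
proof
  let ?\<alpha> = "disk_point a (radius s)" and ?\<beta> = "disk_point b (radius t)"
  fix \<zeta> assume "\<zeta> \<in> V"
  then have "gen_mult \<rho> \<zeta> \<in> insert \<infinity> (enat ` pos_span (farey_b \<rho> ?\<alpha>) (farey_b \<rho> ?\<beta>))"
    using assms unfolding gen_mult_in_span_def by blast
  then show "max (gen_mult \<rho> ?\<alpha>) (gen_mult \<rho> ?\<beta>) < gen_mult \<rho> \<zeta>"
  proof (elim insertE imageE)
    fix x assume "gen_mult \<rho> \<zeta> = enat x" "x \<in> pos_span (farey_b \<rho> ?\<alpha>) (farey_b \<rho> ?\<beta>)"
    then show ?thesis
      using pos_span_greater[OF farey_b_disk_point_pos farey_b_disk_point_pos] by (simp add: gen_mult_eq_farey_b)
  qed (simp add: gen_mult_eq_farey_b)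
qed

text \<open>
  A point of the annulus is some \<open>\<zeta>(a,r)\<close>, or it lies in an open disk of radius \<open>\<bar>x\<bar>\<^sup>u\<close> at distance \<open>\<bar>x\<bar>\<^sup>u\<close>
  from \<open>a\<close>.  The centre of such a disk has a term of exponent \<open>u\<close>, because \<open>a\<close> has none, and agrees with \<open>a\<close>
  below \<open>u\<close>.
\<close>

lemma gen_mult_in_annulus:
  fixes a :: "'a::{alg_closed_field, field_char_0} puiseux_hat"
  assumes \<zeta>: "\<zeta> \<in> beyond a (radius s) \<inter> open_disk a (radius t)"
    and none: "\<And>u. t < u \<Longrightarrow> u < s \<Longrightarrow> ph_nth a u = 0"
  shows "gen_mult \<rho> \<zeta> = \<infinity> \<or>
    (\<exists>u. t < u \<and> u < s \<and> enat (lcm (support_lcm a {..<u}) (denom u)) dvd gen_mult \<rho> \<zeta>)"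
proof -
  obtain \<nu> where \<nu>: "\<zeta> = Some \<nu>" "\<nu> \<in> seminorms" "radius s < \<nu> [:- a, 1:]" "\<nu> [:- a, 1:] < radius t"
    using \<zeta> by (cases \<zeta>) auto
  define r where "r = \<nu> [:- a, 1:]"
  have r: "0 < r" using \<nu>(3) powr_rho_pos[of "of_rat s"] unfolding r_def by linarith
  have range: "t < u \<and> u < s" if "r = radius u" for u
    using \<nu>(3,4) that unfolding r_def by (simp add: of_rat_less)
  have dir: "\<zeta> = disk_point a r \<or> (\<exists>c. ph_abs \<rho> (c - a) \<le> r \<and> \<zeta> \<in> open_disk c r)"
    using directions_at_disk_point[OF r, of \<zeta> a] \<nu>(1,2) r_def by auto
  show ?thesis
  proof (cases "\<zeta> = disk_point a r")
    case True
    show ?thesis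
    proof (cases "\<exists>u. r = radius u")
      case rational: True
      then obtain u where u: "r = radius u" by blast
      have "gen_mult \<rho> \<zeta> = enat (lcm (support_lcm a {..<u}) (denom u))"
        unfolding True u by (rule gen_mult_disk_point)
      then show ?thesis using range[OF u] by auto
    next
      case False
      then show ?thesis using gen_mult_disk_point_irrational[OF r] True by auto
    qed
  next
    case False
    then obtain c where c: "ph_abs \<rho> (c - a) \<le> r" "\<zeta> \<in> open_disk c r" using dir by blast
    then have "\<nu> [:- c, 1:] < r" using \<nu>(1) by simp
    then have ca: "ph_abs \<rho> (c - a) = r"
      using seminorm_center_le(1)[OF \<nu>(2), of a c] c(1) unfolding r_def ph_abs_commute[of a c] by auto
    then have ne: "c - a \<noteq> 0" using r by auto
    define u where "u = ph_ord (c - a)"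
    have u: "r = radius u" using ca ne by (simp add: ph_abs_nonzero u_def)
    have below: "ph_nth c q = ph_nth a q" if "q < u" for q
      using ph_ord_least(2)[OF ne, of q] that unfolding u_def by auto
    have at: "ph_nth c u \<noteq> 0"
      using ph_ord_least(1)[OF ne] none range[OF u] unfolding u_def by auto
    have "lcm (support_lcm a {..<u}) (denom u) dvd support_lcm c {..u}"
    proof (rule lcm_least)
      show "support_lcm a {..<u} dvd support_lcm c {..u}"
        unfolding support_lcm_dvd_iff using below by (auto intro!: support_lcm_dvd)
      show "denom u dvd support_lcm c {..u}" using at by (auto intro: support_lcm_dvd)
    qed
    then have "enat (lcm (support_lcm a {..<u}) (denom u)) dvd enat (support_lcm c {..u})"
      by (simp only: enat_dvd_enat_iff)
    also have "\<dots> dvd berk_mult \<zeta>" using c(2) unfolding u by (rule support_lcm_dvd_berk_mult)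
    also have "\<dots> dvd gen_mult \<rho> \<zeta>" by (rule berk_mult_dvd_gen_mult)
    finally show ?thesis using range[OF u] by blast
  qed
qed

lemma farey_neighbours_disk_points_iff:
  fixes a :: "'a::{alg_closed_field, field_char_0} puiseux_hat"
  assumes "t < s"
  defines "\<alpha> \<equiv> disk_point a (radius s)" and "\<beta> \<equiv> disk_point a (radius t)"
  shows "farey_neighbours \<alpha> \<beta> \<longleftrightarrow>
      of_nat (farey_b \<rho> \<alpha> * farey_b \<rho> \<beta>) * (s - t) = (of_nat (gcd (farey_b \<rho> \<alpha>) (farey_b \<rho> \<beta>)) :: rat) \<and>
      support_lcm a {..<s} = gcd (farey_b \<rho> \<alpha>) (farey_b \<rho> \<beta>)"
proof -
  have less: "berk_less \<rho> \<alpha> \<beta>"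
    unfolding \<alpha>_def \<beta>_def using assms(1) by (simp add: berk_less_disk_points_iff of_rat_less)
  define D where "D = farey_a \<rho> \<alpha> * int (farey_b \<rho> \<beta>) - int (farey_b \<rho> \<alpha>) * farey_a \<rho> \<beta>"
  have det: "(of_int D :: rat)
      = of_nat (farey_b \<rho> \<alpha> * farey_b \<rho> \<beta>) * (s - t)"
    unfolding D_def \<alpha>_def \<beta>_def by (simp add: farey_a_disk_point algebra_simps)
  have "D = int n \<longleftrightarrow> of_int D = (of_int (int n) :: rat)" for n
    by (simp only: of_int_eq_iff)
  then have "D = int n \<longleftrightarrow> of_nat (farey_b \<rho> \<alpha> * farey_b \<rho> \<beta>) * (s - t) = (of_nat n :: rat)" for n
    unfolding det by (simp only: of_int_of_nat_eq)
  moreover have "berk_mult \<alpha> = enat (support_lcm a {..<s})" unfolding \<alpha>_def by (rule berk_mult_disk_point)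
  ultimately show ?thesis unfolding farey_neighbours_def D_def[symmetric] using less by simp
qed

text \<open>
  The annulus is the set of points strictly between the two disks, and so it contains the interval.  The
  conditions imply each other in a cycle: larger generic multiplicities on the interval, Farey
  neighbours, generic multiplicities in the span, larger generic multiplicities on the annulus.
\<close>

lemma annulus_equivalences_comparable:
  fixes a :: "'a::{alg_closed_field, field_char_0} puiseux_hat"
  assumes "t < s"
  defines "\<alpha> \<equiv> disk_point a (radius s)" and "\<beta> \<equiv> disk_point a (radius t)"
  assumes U: "connectedin line U" "U \<noteq> {}" "\<alpha> \<notin> U" "\<beta> \<notin> U" "line frontier_of U = {\<alpha>, \<beta>}"
  shows "larger_gen_mult \<alpha> \<beta> U \<longleftrightarrow> larger_gen_mult \<alpha> \<beta> (berk_interval \<rho> \<alpha> \<beta>)"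
    "larger_gen_mult \<alpha> \<beta> U \<longleftrightarrow> gen_mult_in_span \<alpha> \<beta> U"
    "larger_gen_mult \<alpha> \<beta> U \<longleftrightarrow> farey_neighbours \<alpha> \<beta>"
    "\<not> farey_neighbours \<beta> \<alpha>"
proof -
  let ?r0 = "radius s" and ?r1 = "radius t"
  have r: "0 < ?r0" "?r0 < ?r1" using assms(1) by (simp_all add: of_rat_less)
  let ?W = "beyond a ?r0 \<inter> open_disk a ?r1"
  have cl: "\<alpha> \<in> line closure_of U" "\<beta> \<in> line closure_of U" using U(5) by (auto simp: frontier_of_def)
  note bound = open_annulus_bound[OF r, of _ a, folded \<alpha>_def \<beta>_def]
  have "U \<subseteq> ?W" using U cl by (intro bound)
  have "?W = beyond_all {(a, ?r0)} \<inter> open_disk a ?r1"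
    using openin_subset[OF openin_open_disk] by (auto simp: beyond_all_def)
  then have "connectedin line ?W" using connectedin_beyond_all_Int_open_disk by metis
  moreover have "?W \<inter> line frontier_of U = {}"
    unfolding U(5) \<alpha>_def \<beta>_def using r by (auto simp: disk_point_in_beyond disk_point_in_open_disk)
  moreover have "?W \<inter> U \<noteq> {}" using \<open>U \<subseteq> ?W\<close> U(2) by blast
  ultimately have "?W \<subseteq> U" by (rule connected_subset_of_domain)
  with \<open>U \<subseteq> ?W\<close> have UW: "U = ?W" by blast
  have I_sub: "berk_interval \<rho> \<alpha> \<beta> \<subseteq> U"
  proof
    fix \<zeta> assume "\<zeta> \<in> berk_interval \<rho> \<alpha> \<beta>"
    then obtain C where C: "connectedin line C" "\<zeta> \<in> C" "\<alpha> \<notin> C" "\<beta> \<notin> C" "\<alpha> \<in> line closure_of C" "\<beta> \<in> line closure_of C"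
      by (rule interval_in_connected)
    show "\<zeta> \<in> U" using bound[OF C(1,3-6)] C(2) unfolding UW by blast
  qed
  note N = farey_neighbours_disk_points_iff[OF assms(1), of a, folded \<alpha>_def \<beta>_def]
  have b: "farey_b \<rho> \<alpha> = lcm (support_lcm a {..<s}) (denom s)" "farey_b \<rho> \<beta> = lcm (support_lcm a {..<t}) (denom t)"
    unfolding \<alpha>_def \<beta>_def by (rule farey_b_disk_point)+
  have I_N: "farey_neighbours \<alpha> \<beta>" if I: "larger_gen_mult \<alpha> \<beta> (berk_interval \<rho> \<alpha> \<beta>)"
  proof -
    have "max (farey_b \<rho> \<alpha>) (farey_b \<rho> \<beta>) < lcm (support_lcm a {..<u}) (denom u)" if u: "t < u" "u < s" for u
    proof -
      have "disk_point a (radius u) \<in> berk_interval \<rho> \<alpha> \<beta>"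
        unfolding \<alpha>_def \<beta>_def using u by (intro disk_point_in_interval) (simp_all add: of_rat_less)
      then have "max (gen_mult \<rho> \<alpha>) (gen_mult \<rho> \<beta>) < gen_mult \<rho> (disk_point a (radius u))"
        using I unfolding larger_gen_mult_def by blast
      then show ?thesis by (simp add: \<alpha>_def \<beta>_def gen_mult_disk_point farey_b_disk_point)
    qed
    then show ?thesis
      using denoms_larger_imp_determinant[OF assms(1), of a] unfolding N b by blast
  qed
  have N_S: "gen_mult_in_span \<alpha> \<beta> U" if "farey_neighbours \<alpha> \<beta>"
    unfolding gen_mult_in_span_def
  proof
    fix \<zeta> assume "\<zeta> \<in> U"
    then have \<zeta>: "\<zeta> \<in> ?W" unfolding UW .
    have det: "ph_nth a u = 0" "lcm (support_lcm a {..<u}) (denom u) \<in> pos_span (farey_b \<rho> \<alpha>) (farey_b \<rho> \<beta>)"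
      if "t < u" "u < s" for u
      using determinant_imp_pos_span[OF assms(1), of a u] \<open>farey_neighbours \<alpha> \<beta>\<close> that unfolding N b by blast+
    show "gen_mult \<rho> \<zeta> \<in> insert \<infinity> (enat ` pos_span (farey_b \<rho> \<alpha>) (farey_b \<rho> \<beta>))"
    proof (cases "gen_mult \<rho> \<zeta>")
      case (enat g)
      then obtain u where u: "t < u" "u < s" "lcm (support_lcm a {..<u}) (denom u) dvd g"
        using gen_mult_in_annulus[OF \<zeta> det(1)] by (auto simp: enat_dvd_enat_iff)
      then obtain k where k: "g = lcm (support_lcm a {..<u}) (denom u) * k" by blast
      have "g \<noteq> 0" using gen_mult_nonzero[of \<zeta>] enat by (simp add: zero_enat_def)
      then have "g \<in> pos_span (farey_b \<rho> \<alpha>) (farey_b \<rho> \<beta>)"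
        unfolding k using det(2)[OF u(1,2)] by (intro pos_span_multiple) (auto simp: k)
      then show ?thesis using enat by simp
    qed simp
  qed
  have S_F: "larger_gen_mult \<alpha> \<beta> U" if "gen_mult_in_span \<alpha> \<beta> U"
    using that unfolding \<alpha>_def \<beta>_def by (rule span_imp_larger_gen_mult)
  have F_I: "larger_gen_mult \<alpha> \<beta> (berk_interval \<rho> \<alpha> \<beta>)" if "larger_gen_mult \<alpha> \<beta> U"
    using that I_sub unfolding larger_gen_mult_def by blast
  show "larger_gen_mult \<alpha> \<beta> U \<longleftrightarrow> larger_gen_mult \<alpha> \<beta> (berk_interval \<rho> \<alpha> \<beta>)"
    "larger_gen_mult \<alpha> \<beta> U \<longleftrightarrow> gen_mult_in_span \<alpha> \<beta> U"
    "larger_gen_mult \<alpha> \<beta> U \<longleftrightarrow> farey_neighbours \<alpha> \<beta>"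
    using I_N N_S S_F F_I by blast+
  have "\<not> berk_less \<rho> \<beta> \<alpha>" unfolding \<alpha>_def \<beta>_def using r by (simp add: berk_less_disk_points_iff)
  then show "\<not> farey_neighbours \<beta> \<alpha>" by (simp add: farey_neighbours_def)
qed

text \<open>
  The diameter \<open>\<bar>x\<bar>\<^sup>u\<close> of the join is the distance of the centres, so that one of them has a term of exponent
  \<open>u\<close>.  The generic multiplicity of the join divides that of the corresponding end.
\<close>

lemma annulus_equivalences_incomparable:
  fixes a b :: "'a::{alg_closed_field, field_char_0} puiseux_hat"
  defines "\<alpha> \<equiv> \<lambda>s. disk_point a (radius s)" and "\<beta> \<equiv> \<lambda>t. disk_point b (radius t)"
  assumes far: "radius s < ph_abs \<rho> (a - b)" "radius t < ph_abs \<rho> (a - b)"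
    and U: "connectedin line U" "U \<noteq> {}" "\<alpha> s \<notin> U" "\<beta> t \<notin> U" "line frontier_of U = {\<alpha> s, \<beta> t}"
  shows "\<not> larger_gen_mult (\<alpha> s) (\<beta> t) U" "\<not> larger_gen_mult (\<alpha> s) (\<beta> t) (berk_interval \<rho> (\<alpha> s) (\<beta> t))"
    "\<not> gen_mult_in_span (\<alpha> s) (\<beta> t) U" "\<not> farey_neighbours (\<alpha> s) (\<beta> t)" "\<not> farey_neighbours (\<beta> t) (\<alpha> s)"
proof -
  let ?r0 = "radius s" and ?r1 = "radius t"
  let ?J = "disk_point a (ph_abs \<rho> (a - b))"
  have far': "?r1 < ph_abs \<rho> (b - a)" using far(2) ph_abs_commute[of a b] by simp
  have R: "0 < ph_abs \<rho> (a - b)" using far(1) powr_rho_pos[of "of_rat s"] by linarith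
  then have ne: "a - b \<noteq> 0" by auto
  define u where "u = ph_ord (a - b)"
  have u: "ph_abs \<rho> (a - b) = radius u" using ne by (simp add: ph_abs_nonzero u_def)
  have us: "u < s" "u < t" using far unfolding u by (simp_all add: of_rat_less)
  have J2: "?J = disk_point b (radius u)" using R unfolding u[symmetric] by (simp add: disk_point_eq_iff)
  have le: "gen_mult \<rho> (disk_point c (radius u)) \<le> gen_mult \<rho> (disk_point c (radius v))"
    if "u < v" "ph_nth c u \<noteq> 0" for v and c :: "'a puiseux_hat"
  proof -
    have "support_lcm c {..<u} dvd support_lcm c {..<v}" by (rule support_lcm_mono) (use that(1) in auto)
    moreover have "denom u dvd support_lcm c {..<v}" using that by (auto intro: support_lcm_dvd)
    ultimately have "lcm (support_lcm c {..<u}) (denom u) dvd lcm (support_lcm c {..<v}) (denom v)"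
      by (meson dvd_lcm1 dvd_trans lcm_least)
    then show ?thesis
      unfolding gen_mult_disk_point enat_ord_simps
      by (intro dvd_imp_le) (use farey_b_disk_point_pos[of c v] in \<open>simp_all add: farey_b_disk_point\<close>)
  qed
  have "ph_nth a u \<noteq> 0 \<or> ph_nth b u \<noteq> 0" using ph_ord_least(1)[OF ne] unfolding u_def by auto
  then have J_le: "gen_mult \<rho> ?J \<le> max (gen_mult \<rho> (\<alpha> s)) (gen_mult \<rho> (\<beta> t))"
  proof
    assume "ph_nth a u \<noteq> 0"
    then show ?thesis using le[OF us(1)] unfolding u \<alpha>_def by (simp add: le_max_iff_disj)
  next
    assume "ph_nth b u \<noteq> 0"
    then show ?thesis using le[OF us(2)] unfolding J2 \<beta>_def by (simp add: le_max_iff_disj)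
  qed
  have J_I: "?J \<in> berk_interval \<rho> (\<alpha> s) (\<beta> t)"
    unfolding \<alpha>_def \<beta>_def using far by (intro join_in_interval) simp_all
  have cl: "\<alpha> s \<in> line closure_of U" "\<beta> t \<in> line closure_of U" using U(5) by (auto simp: frontier_of_def)
  have "U \<subseteq> beyond a ?r0"
    by (rule beyond_bound[OF _ _ far(1) U(1) U(3)[unfolded \<alpha>_def] cl(2)[unfolded \<beta>_def]]) simp_all
  moreover have "U \<subseteq> beyond b ?r1"
    by (rule beyond_bound[OF _ _ far' U(1) U(4)[unfolded \<beta>_def] cl(1)[unfolded \<alpha>_def]]) simp_all
  ultimately have "U \<subseteq> beyond_all {(a, ?r0), (b, ?r1)}"
    using connectedin_subset_topspace[OF U(1)] by (auto simp: beyond_all_def)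
  then have "beyond_all {(a, ?r0), (b, ?r1)} \<subseteq> U"
  proof (intro connected_subset_of_domain[OF connectedin_beyond_all])
    show "beyond_all {(a, ?r0), (b, ?r1)} \<inter> line frontier_of U = {}"
      unfolding U(5) \<alpha>_def \<beta>_def beyond_all_def by (auto simp: disk_point_in_beyond)
  qed (use U(2) in auto)
  moreover have "?J \<in> beyond_all {(a, ?r0), (b, ?r1)}"
    using R far far' by (simp add: beyond_all_def disk_point_in_beyond)
  ultimately have J_U: "?J \<in> U" by blast
  show F: "\<not> larger_gen_mult (\<alpha> s) (\<beta> t) U" and "\<not> larger_gen_mult (\<alpha> s) (\<beta> t) (berk_interval \<rho> (\<alpha> s) (\<beta> t))"
    using J_le J_U J_I unfolding larger_gen_mult_def by (meson not_less)+
  show "\<not> gen_mult_in_span (\<alpha> s) (\<beta> t) U"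
    using F span_imp_larger_gen_mult unfolding \<alpha>_def \<beta>_def by blast
  have "\<not> berk_less \<rho> (\<alpha> s) (\<beta> t)" "\<not> berk_less \<rho> (\<beta> t) (\<alpha> s)"
    unfolding \<alpha>_def \<beta>_def using far far' ph_abs_commute[of a b] by (auto simp: berk_less_disk_points_iff)
  then show "\<not> farey_neighbours (\<alpha> s) (\<beta> t)" "\<not> farey_neighbours (\<beta> t) (\<alpha> s)"
    by (simp_all add: farey_neighbours_def)
qed

lemma annulus_equivalences:
  fixes \<alpha> \<beta> :: "'a::{alg_closed_field, field_char_0} berk"
  assumes \<Gamma>: "vertex_set \<rho> \<Gamma>" "U \<in> berk_domains \<rho> \<Gamma>" and U: "annulus_domain \<rho> \<alpha> \<beta> U"
  shows "(larger_gen_mult \<alpha> \<beta> U \<longleftrightarrow> larger_gen_mult \<alpha> \<beta> (berk_interval \<rho> \<alpha> \<beta>)) \<and>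
    (larger_gen_mult \<alpha> \<beta> U \<longleftrightarrow> gen_mult_in_span \<alpha> \<beta> U) \<and>
    (larger_gen_mult \<alpha> \<beta> U \<longleftrightarrow> farey_neighbours \<alpha> \<beta> \<or> farey_neighbours \<beta> \<alpha>)"
proof -
  note dom = berk_domain_properties[OF \<Gamma>]
  have ne: "\<alpha> \<noteq> \<beta>" and fr: "line frontier_of U = {\<alpha>, \<beta>}" using U by (simp_all add: annulus_domain_def)
  then have "\<alpha> \<in> \<Gamma>" "\<beta> \<in> \<Gamma>" using dom(4) by auto
  then have notin: "\<alpha> \<notin> U" "\<beta> \<notin> U" using dom(3) by auto
  obtain a s where \<alpha>: "\<alpha> = disk_point a (radius s)"
    using vertex_set_disk_points[OF \<Gamma>(1) \<open>\<alpha> \<in> \<Gamma>\<close>] by blast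
  obtain b t where \<beta>: "\<beta> = disk_point b (radius t)"
    using vertex_set_disk_points[OF \<Gamma>(1) \<open>\<beta> \<in> \<Gamma>\<close>] by blast
  let ?r0 = "radius s" and ?r1 = "radius t"
  consider "?r0 < ph_abs \<rho> (a - b)" "?r1 < ph_abs \<rho> (a - b)"
    | "\<beta> = disk_point a ?r1" "t < s" | "\<alpha> = disk_point b ?r0" "s < t"
  proof (cases "?r0 < ph_abs \<rho> (a - b) \<and> ?r1 < ph_abs \<rho> (a - b)")
    case False
    then have "ph_abs \<rho> (a - b) \<le> max ?r0 ?r1" by auto
    moreover have "s \<noteq> t" if "ph_abs \<rho> (a - b) \<le> ?r0" using ne that by (auto simp: \<alpha> \<beta> disk_point_eq_iff)
    ultimately consider "ph_abs \<rho> (a - b) \<le> ?r1" "t < s" | "ph_abs \<rho> (a - b) \<le> ?r0" "s < t"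
      by (cases s t rule: linorder_cases) (auto simp: max_def of_rat_less_eq split: if_splits)
    then show thesis
    proof cases
      case 1
      then have "\<beta> = disk_point a ?r1" by (simp add: \<beta> disk_point_eq_iff ph_abs_commute)
      then show thesis using 1(2) by (rule that(2))
    next
      case 2
      then have "\<alpha> = disk_point b ?r0" by (simp add: \<alpha> disk_point_eq_iff)
      then show thesis using 2(2) by (rule that(3))
    qed
  qed (use that(1) in blast)
  then show ?thesis
  proof cases
    case 1
    from annulus_equivalences_incomparable[OF 1 dom(1,2)] notin fr
    show ?thesis unfolding \<alpha> \<beta> by blast
  next
    case 2
    from annulus_equivalences_comparable[OF 2(2) dom(1,2)] notin fr
    show ?thesis unfolding \<alpha> 2(1) by blast
  next
    case 3
    have fr': "line frontier_of U = {\<beta>, \<alpha>}" using fr by blast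
    have sym: "larger_gen_mult \<alpha> \<beta> V = larger_gen_mult \<beta> \<alpha> V" "gen_mult_in_span \<alpha> \<beta> V = gen_mult_in_span \<beta> \<alpha> V" for V
      by (simp_all add: larger_gen_mult_def max.commute gen_mult_in_span_def pos_span_commute)
    from annulus_equivalences_comparable[OF 3(2) dom(1,2)] notin fr'
    show ?thesis unfolding sym berk_interval_commute[of \<alpha>] unfolding \<beta> 3(1) by blast
  qed
qed

end

theorem theoremB:
  fixes \<rho> :: real and \<Gamma> U :: "('k::{alg_closed_field, field_char_0}) berk set"
  assumes "0 < \<rho>" and "\<rho> < 1"
    and "vertex_set \<rho> \<Gamma>" and "U \<in> berk_domains \<rho> \<Gamma>"
  shows "(\<forall>\<zeta>. disk_domain \<rho> \<zeta> U \<longrightarrow>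
           (farey_domain \<rho> U \<longleftrightarrow> gen_mult \<rho> \<zeta> = (INF \<xi>\<in>U. berk_mult \<xi>)) \<and>
           (farey_domain \<rho> U \<longrightarrow>
             (\<forall>\<xi>\<in>U. gen_mult \<rho> \<zeta> dvd berk_mult \<xi> \<and> berk_mult \<xi> dvd gen_mult \<rho> \<xi>))) \<and>
         (\<forall>\<alpha> \<beta>. annulus_domain \<rho> \<alpha> \<beta> U \<longrightarrow>
           (farey_domain \<rho> U \<longleftrightarrow>
             (INF \<xi>\<in>U. gen_mult \<rho> \<xi>) > max (gen_mult \<rho> \<alpha>) (gen_mult \<rho> \<beta>)) \<and>
           (farey_domain \<rho> U \<longleftrightarrow>
             (\<forall>\<zeta>\<in>berk_interval \<rho> \<alpha> \<beta>. gen_mult \<rho> \<zeta> > max (gen_mult \<rho> \<alpha>) (gen_mult \<rho> \<beta>))) \<and>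
           (farey_domain \<rho> U \<longleftrightarrow>
             (\<forall>\<zeta>\<in>U. gen_mult \<rho> \<zeta> \<in> insert \<infinity> (enat ` pos_span (farey_b \<rho> \<alpha>) (farey_b \<rho> \<beta>)))) \<and>
           (farey_domain \<rho> U \<longleftrightarrow>
             berk_less \<rho> \<alpha> \<beta> \<and>
               farey_a \<rho> \<alpha> * int (farey_b \<rho> \<beta>) - int (farey_b \<rho> \<alpha>) * farey_a \<rho> \<beta>
                 = int (gcd (farey_b \<rho> \<alpha>) (farey_b \<rho> \<beta>)) \<and>
               berk_mult \<alpha> = enat (gcd (farey_b \<rho> \<alpha>) (farey_b \<rho> \<beta>)) \<or>
             berk_less \<rho> \<beta> \<alpha> \<and>
               farey_a \<rho> \<beta> * int (farey_b \<rho> \<alpha>) - int (farey_b \<rho> \<beta>) * farey_a \<rho> \<alpha>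
                 = int (gcd (farey_b \<rho> \<alpha>) (farey_b \<rho> \<beta>)) \<and>
               berk_mult \<beta> = enat (gcd (farey_b \<rho> \<alpha>) (farey_b \<rho> \<beta>))))"
    (is "_ \<and> (\<forall>\<alpha> \<beta>. _ \<longrightarrow> _ \<and> _ \<and> _ \<and> (_ \<longleftrightarrow> ?det \<alpha> \<beta>))")
proof -
  interpret puiseux_radius \<rho> by unfold_locales (use assms in simp_all)
  have not_both: "\<not> (disk_domain \<rho> \<zeta> U \<and> annulus_domain \<rho> \<alpha> \<beta> U)" for \<zeta> \<alpha> \<beta>
    by (auto simp: disk_domain_def annulus_domain_def)
  have disk: "farey_domain \<rho> U \<longleftrightarrow> gen_mult \<rho> \<zeta> = (INF \<xi>\<in>U. berk_mult \<xi>)" if "disk_domain \<rho> \<zeta> U" for \<zeta>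
  proof -
    have "\<zeta>' = \<zeta>" if "disk_domain \<rho> \<zeta>' U" for \<zeta>'
      using that \<open>disk_domain \<rho> \<zeta> U\<close> by (simp add: disk_domain_def)
    then show ?thesis unfolding farey_domain_def using that not_both[of \<zeta>] by metis
  qed
  have annulus: "farey_domain \<rho> U \<longleftrightarrow> larger_gen_mult \<alpha> \<beta> U" if ann: "annulus_domain \<rho> \<alpha> \<beta> U" for \<alpha> \<beta>
  proof -
    have "max (gen_mult \<rho> \<alpha>') (gen_mult \<rho> \<beta>') = max (gen_mult \<rho> \<alpha>) (gen_mult \<rho> \<beta>)"
      if "annulus_domain \<rho> \<alpha>' \<beta>' U" for \<alpha>' \<beta>'
      using that ann unfolding annulus_domain_def by (auto simp: doubleton_eq_iff max.commute)
    then show ?thesis unfolding farey_domain_def larger_gen_mult_def using ann not_both[of _ \<alpha> \<beta>] by metis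
  qed
  have INF: "larger_gen_mult \<alpha> \<beta> U \<longleftrightarrow> (INF \<xi>\<in>U. gen_mult \<rho> \<xi>) > max (gen_mult \<rho> \<alpha>) (gen_mult \<rho> \<beta>)" for \<alpha> \<beta>
  proof
    assume "larger_gen_mult \<alpha> \<beta> U"
    moreover obtain \<xi> where "\<xi> \<in> U" "(INF \<xi>\<in>U. gen_mult \<rho> \<xi>) = gen_mult \<rho> \<xi>"
      using enat_INF_attained[OF berk_domain_properties(2)[OF assms(3,4)]] by metis
    ultimately show "(INF \<xi>\<in>U. gen_mult \<rho> \<xi>) > max (gen_mult \<rho> \<alpha>) (gen_mult \<rho> \<beta>)"
      unfolding larger_gen_mult_def by auto
  next
    assume "(INF \<xi>\<in>U. gen_mult \<rho> \<xi>) > max (gen_mult \<rho> \<alpha>) (gen_mult \<rho> \<beta>)"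
    then show "larger_gen_mult \<alpha> \<beta> U"
      unfolding larger_gen_mult_def using INF_lower[of _ U "gen_mult \<rho>"] less_le_trans by blast
  qed
  show ?thesis
  proof (intro conjI allI impI ballI)
    fix \<zeta> assume \<zeta>: "disk_domain \<rho> \<zeta> U"
    show "farey_domain \<rho> U \<longleftrightarrow> gen_mult \<rho> \<zeta> = (INF \<xi>\<in>U. berk_mult \<xi>)" by (rule disk[OF \<zeta>])
    fix \<xi> assume F: "farey_domain \<rho> U" and \<xi>: "\<xi> \<in> U"
    show "gen_mult \<rho> \<zeta> dvd berk_mult \<xi>"
      using disk_domain_dvd[OF assms(3,4) \<zeta> _ \<xi>] F disk[OF \<zeta>] by blast
    show "berk_mult \<xi> dvd gen_mult \<rho> \<xi>" by (rule berk_mult_dvd_gen_mult)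
  next
    fix \<alpha> \<beta> assume ann: "annulus_domain \<rho> \<alpha> \<beta> U"
    note eq = annulus_equivalences[OF assms(3,4) ann]
    show "farey_domain \<rho> U \<longleftrightarrow> (INF \<xi>\<in>U. gen_mult \<rho> \<xi>) > max (gen_mult \<rho> \<alpha>) (gen_mult \<rho> \<beta>)"
      unfolding annulus[OF ann] by (rule INF)
    show "farey_domain \<rho> U \<longleftrightarrow>
        (\<forall>\<zeta>\<in>berk_interval \<rho> \<alpha> \<beta>. gen_mult \<rho> \<zeta> > max (gen_mult \<rho> \<alpha>) (gen_mult \<rho> \<beta>))"
      using eq unfolding annulus[OF ann] by (simp only: larger_gen_mult_def)
    show "farey_domain \<rho> U \<longleftrightarrow>
        (\<forall>\<zeta>\<in>U. gen_mult \<rho> \<zeta> \<in> insert \<infinity> (enat ` pos_span (farey_b \<rho> \<alpha>) (farey_b \<rho> \<beta>)))"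
      using eq unfolding annulus[OF ann] gen_mult_in_span_def by blast
    show "farey_domain \<rho> U \<longleftrightarrow> ?det \<alpha> \<beta>"
      unfolding annulus[OF ann]
      by (rule eq[THEN conjunct2, THEN conjunct2,
            unfolded farey_neighbours_def gcd.commute[of "farey_b \<rho> \<beta>" "farey_b \<rho> \<alpha>"]])
  qed
qed

end
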